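(* Let $I,J\subset S$ be finitary and let $I_\bullet$ and $I'_\bullet$ be reduced expressions for an $(I,J)$-coset $p$. Assume further that $I'_\bullet$ is of the form $I'_\bullet=[[I\supset \mathrm{LR}(p)]]\circ K_\bullet$, i.e. it begins by removing the elements of $I\setminus\mathrm{LR}(p)$ from $I$ one at a time until reaching $\mathrm{LR}(p)$, and then continues with an expression $K_\bullet$ starting at $\mathrm{LR}(p)$. Then, up to a grading shift, $\mathrm{BS}(I'_\bullet)$ is the restriction of $\mathrm{BS}(K_\bullet)$ from left $R^{\mathrm{LR}(p)}$-modules to left $R^I$-modules, and hence admits an action of $R^{\mathrm{LR}(p)}$. If $f\in\mathrm{Hom}_{<p}(\mathrm{BS}(I_\bullet),\mathrm{BS}(I'_\bullet))$, then $$\operatorname{Im} f\cap\left(R^{\mathrm{LR}(p)}\cdot 1^\otimes_{I'_\bullet}\right)=0.$$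
   Context: Cosets. $(W,S)$ is a Coxeter system with length function $\ell$. For $I\subset S$, $W_I$ is the subgroup generated by $I$; $I$ is finitary if $W_I$ is finite, and then $w_I$ is its longest element and $\ell(I):=\ell(w_I)$. The $*$-product on $W$ is the associative monoid product determined by $s*w=sw$ if $sw>w$ and $s*w=w$ if $sw<w$ ($s\in S$, $w\in W$). For finitary $I,J$, an $(I,J)$-coset is an element $p\in W_I\backslash W/W_J$ (regarded as a triple $(p,I,J)$), with maximal and minimal elements $\overline p,\underline p$; $p\le q$ means $\underline p\le\underline q$ in Bruhat order. The left redundancy of an $(I,J)$-coset $p$ is $\mathrm{LR}(p)=I\cap\underline p J\underline p^{-1}$. Expressions. A (singlestep) expression is a sequence $I_\bullet=[I_0,\dots,I_d]$ of finitary subsets of $S$, consecutive ones differing by adding or removing one element. It expresses the unique $(I_0,I_d)$-coset $q$ with $\overline q=w_{I_0}*\cdots*w_{I_d}$. Recording local maxima and minima gives $I_0=L_0\subset K_1\supset L_1\subset\cdots\subset K_m\supset L_m=I_d$ (with $L_0=K_1$ if $I_\bullet$ starts by decreasing and $K_m=L_m$ if it ends by increasing); $I_\bullet$ is reduced if $\overline q=(w_{K_1}w_{L_1}^{-1})\cdots(w_{K_{m-1}}w_{L_{m-1}}^{-1})w_{K_m}$ with lengths of the factors adding up to $\ell(\overline q)$. $\circ$ denotes concatenation of expressions with matching end and start. Realization. $V$ is a realization of $(W,S)$ over a field $\Bbbk$: a finite-dimensional $\Bbbk$-vector space with $\alpha_s^\vee\in V$, $\alpha_s\in V^*$ ($s\in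 S$), $\langle\alpha_s^\vee,\alpha_s\rangle=2$, such that $s(v)=v-\alpha_s(v)\alpha_s^\vee$ defines a representation of $W$, with the standard Elias–Williamson technical condition that the two-coloured quantum numbers $[m_{st}]_s,[m_{st}]_t$ vanish when $m_{st}<\infty$ (defined by $[0]=0$, $[1]=1$, $[2]_s=-\langle\alpha_s^\vee,\alpha_t\rangle$, $[2]_t=-\langle\alpha_t^\vee,\alpha_s\rangle$, $[2]_s[n]_t=[n+1]_s+[n-1]_s$ and symmetrically). It is assumed balanced ($[m_{st}-1]_s=[m_{st}-1]_t=1$ for $m_{st}<\infty$), reflection faithful ($W$ acts faithfully, and $x\in W$ fixes a codimension one subspace exactly when it is conjugate to an element of $S$) and to satisfy generalized Demazure surjectivity (for each finitary $I$ the Demazure operator $\partial_{w_I}:R\to R^I$, composed from $\partial_s(f)=(f-sf)/\alpha_s$ along a reduced word of $w_I$, is surjective). $R=\mathrm{Sym}(V^* )$ is graded with $V^*$ in degree 2, and $R^I$ is the subring of $W_I$-invariants. Bimodules. $M(i)$ is the grading shift with $M(i)^j=M^{i+j}$. For $I\subset J$ finitary, $\mathrm{BS}([I,J])=R^I$ as $(R^I,R^J)$-bimodule and $\mathrm{BS}([J,I])=R^I(\ell(J)-\ell(I))$ as $(R^J,R^I)$-bimodule; $\mathrm{BS}([I])=R^I$, and $\mathrm{BS}(I_\bullet)=\mathrm{BS}([I_0,I_1])\otimes_{R^{I_1}}\cdots\otimes_{R^{I_{d-1}}}\mathrm{BS}([I_{d-1},I_d])$. The one-tensor is $1^\otimes_{I_\bullet}=1\otimes1\otimes\cdots\otimes1\in\mathrm{BS}(I_\bullet)$.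 $\mathrm{Hom}(M,N)=\bigoplus_{i\in\mathbb Z}\mathrm{Hom}^i(M,N)$, where $\mathrm{Hom}^i(M,N)$ is the space of degree zero bimodule maps $M\to N(i)$. Lower terms. For a downward-closed set $C$ of $(I,J)$-cosets, $\mathrm{Hom}_C$ is the two-sided ideal in the category of graded $(R^I,R^J)$-bimodules generated by the identity maps of $\mathrm{BS}(M_\bullet)$ for all expressions $M_\bullet$ expressing some $q\in C$; i.e. it consists of finite sums of morphisms each factoring through such a $\mathrm{BS}(M_\bullet)$. $\mathrm{Hom}_{<p}$ is $\mathrm{Hom}_C$ for $C=\{q\mid q<p\}$. *)

theory Defs
  imports "HOL-Algebra.Free_Abelian_Groups" "HOL-Algebra.Multiplicative_Group" "HOL-Algebra.Module"
begin

section \<open>Coxeter systems\<close>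

record 'w coxeter = "'w monoid" +
  simple_refls :: "'w set"

definition word_prod :: "('w, 'z) coxeter_scheme \<Rightarrow> 'w list \<Rightarrow> 'w" where
  "word_prod W ss = foldr (mult W) ss (one W)"

text \<open>One step inserts or deletes a relator $(st)^{m_{st}}$, where $m_{st}$ is the order of $st$
  (the case $s = t$ gives the relator $ss$); recall that \<open>group.ord\<close> is $0$ for elements of
  infinite order.\<close>

inductive relator_step :: "('w, 'z) coxeter_scheme \<Rightarrow> 'w list \<Rightarrow> 'w list \<Rightarrow> bool" for W where
  insert_relator: "\<lbrakk>s \<in> simple_refls W; t \<in> simple_refls W; m = group.ord W (s \<otimes>\<^bsub>W\<^esub> t); m \<noteq> 0\<rbrakk>
    \<Longrightarrow> relator_step W (u @ v) (u @ concat (replicate m [s, t]) @ v)"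
| delete_relator: "\<lbrakk>s \<in> simple_refls W; t \<in> simple_refls W; m = group.ord W (s \<otimes>\<^bsub>W\<^esub> t); m \<noteq> 0\<rbrakk>
    \<Longrightarrow> relator_step W (u @ concat (replicate m [s, t]) @ v) (u @ v)"

text \<open>The last clause says that $W = \langle S \mid (st)^{m_{st}} = 1 \text{ for } m_{st} < \infty\rangle$.
  Words without formal inverses suffice, because $ss$ is a relator. The set $S$ may be infinite.\<close>

definition coxeter_system :: "('w, 'z) coxeter_scheme \<Rightarrow> bool" where
  "coxeter_system W \<longleftrightarrow>
     group W \<and> simple_refls W \<subseteq> carrier W \<and> generate W (simple_refls W) = carrier W \<and>
     (\<forall>s\<in>simple_refls W. group.ord W s = 2) \<and>
     (\<forall>ss. set ss \<subseteq> simple_refls W \<longrightarrow> word_prod W ss = \<one>\<^bsub>W\<^esub> \<longrightarrow> rtranclp (relator_step W) ss [])"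

definition len :: "('w, 'z) coxeter_scheme \<Rightarrow> 'w \<Rightarrow> nat" where
  "len W w = (LEAST n. \<exists>ss. set ss \<subseteq> simple_refls W \<and> length ss = n \<and> word_prod W ss = w)"

definition reduced_word :: "('w, 'z) coxeter_scheme \<Rightarrow> 'w list \<Rightarrow> 'w \<Rightarrow> bool" where
  "reduced_word W ss w \<longleftrightarrow>
     set ss \<subseteq> simple_refls W \<and> word_prod W ss = w \<and> length ss = len W w"

definition reflections :: "('w, 'z) coxeter_scheme \<Rightarrow> 'w set" where
  "reflections W = {w \<otimes>\<^bsub>W\<^esub> s \<otimes>\<^bsub>W\<^esub> inv\<^bsub>W\<^esub> w | w s. w \<in> carrier W \<and> s \<in> simple_refls W}"

definition bruhat_le :: "('w, 'z) coxeter_scheme \<Rightarrow> 'w \<Rightarrow> 'w \<Rightarrow> bool" where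
  "bruhat_le W = rtranclp (\<lambda>x y. x \<in> carrier W \<and>
     (\<exists>t\<in>reflections W. y = x \<otimes>\<^bsub>W\<^esub> t \<and> len W x < len W y))"

definition bruhat_less :: "('w, 'z) coxeter_scheme \<Rightarrow> 'w \<Rightarrow> 'w \<Rightarrow> bool" where
  "bruhat_less W x y \<longleftrightarrow> bruhat_le W x y \<and> x \<noteq> y"

definition simple_star :: "('w, 'z) coxeter_scheme \<Rightarrow> 'w \<Rightarrow> 'w \<Rightarrow> 'w" where
  "simple_star W s w = (if bruhat_less W w (s \<otimes>\<^bsub>W\<^esub> w) then s \<otimes>\<^bsub>W\<^esub> w else w)"

text \<open>By associativity $x * y = s_1 * (s_2 * (\cdots * (s_k * y)))$ for a reduced word
  $s_1 \cdots s_k$ of $x$; the result does not depend on the word chosen.\<close>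

definition star :: "('w, 'z) coxeter_scheme \<Rightarrow> 'w \<Rightarrow> 'w \<Rightarrow> 'w" where
  "star W x y = foldr (simple_star W) (SOME ss. reduced_word W ss x) y"

definition parabolic :: "('w, 'z) coxeter_scheme \<Rightarrow> 'w set \<Rightarrow> 'w set" where
  "parabolic W I = generate W I"

definition finitary :: "('w, 'z) coxeter_scheme \<Rightarrow> 'w set \<Rightarrow> bool" where
  "finitary W I \<longleftrightarrow> I \<subseteq> simple_refls W \<and> finite (parabolic W I)"

definition max_elt :: "('w, 'z) coxeter_scheme \<Rightarrow> 'w set \<Rightarrow> 'w" where
  "max_elt W p = (THE x. x \<in> p \<and> (\<forall>y\<in>p. len W y \<le> len W x))"

definition min_elt :: "('w, 'z) coxeter_scheme \<Rightarrow> 'w set \<Rightarrow> 'w" where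
  "min_elt W p = (THE x. x \<in> p \<and> (\<forall>y\<in>p. len W x \<le> len W y))"

definition longest :: "('w, 'z) coxeter_scheme \<Rightarrow> 'w set \<Rightarrow> 'w" where
  "longest W I = max_elt W (parabolic W I)"

section \<open>Double cosets and singlestep expressions\<close>

text \<open>An $(I,J)$-coset is a triple $(p,I,J)$. Throughout, $I$ and $J$ are
  explicit arguments and \<open>p\<close> is the underlying subset of \<open>W\<close>.\<close>

definition double_cosets :: "('w, 'z) coxeter_scheme \<Rightarrow> 'w set \<Rightarrow> 'w set \<Rightarrow> 'w set set" where
  "double_cosets W I J =
     {parabolic W I <#>\<^bsub>W\<^esub> {x} <#>\<^bsub>W\<^esub> parabolic W J | x. x \<in> carrier W}"

definition coset_le :: "('w, 'z) coxeter_scheme \<Rightarrow> 'w set \<Rightarrow> 'w set \<Rightarrow> bool" where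
  "coset_le W p q \<longleftrightarrow> bruhat_le W (min_elt W p) (min_elt W q)"

definition coset_less :: "('w, 'z) coxeter_scheme \<Rightarrow> 'w set \<Rightarrow> 'w set \<Rightarrow> bool" where
  "coset_less W p q \<longleftrightarrow> coset_le W p q \<and> p \<noteq> q"

definition left_redundancy ::
    "('w, 'z) coxeter_scheme \<Rightarrow> 'w set \<Rightarrow> 'w set \<Rightarrow> 'w set \<Rightarrow> 'w set" where
  "left_redundancy W I J p =
     I \<inter> {min_elt W p \<otimes>\<^bsub>W\<^esub> s \<otimes>\<^bsub>W\<^esub> inv\<^bsub>W\<^esub> (min_elt W p) | s. s \<in> J}"

definition singlestep :: "'w set \<Rightarrow> 'w set \<Rightarrow> bool" where
  "singlestep A B \<longleftrightarrow> (\<exists>s. s \<notin> A \<and> B = insert s A) \<or> (\<exists>s. s \<notin> B \<and> A = insert s B)"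

definition expression :: "('w, 'z) coxeter_scheme \<Rightarrow> 'w set list \<Rightarrow> bool" where
  "expression W Is \<longleftrightarrow> Is \<noteq> [] \<and> (\<forall>I\<in>set Is. finitary W I) \<and>
     (\<forall>i. Suc i < length Is \<longrightarrow> singlestep (Is ! i) (Is ! Suc i))"

definition expresses ::
    "('w, 'z) coxeter_scheme \<Rightarrow> 'w set \<Rightarrow> 'w set \<Rightarrow> 'w set list \<Rightarrow> 'w set \<Rightarrow> bool" where
  "expresses W I J Is p \<longleftrightarrow>
     expression W Is \<and> hd Is = I \<and> last Is = J \<and> p \<in> double_cosets W I J \<and>
     max_elt W p = foldr (star W) (map (longest W) Is) \<one>\<^bsub>W\<^esub>"

text \<open>The sets $K_1, \dots, K_m$ and $L_1, \dots, L_{m-1}$, in order of occurrence. The end points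
  count as local maxima when they have no larger neighbour, which covers $K_1 = L_0$ and
  $K_m = L_m$; the end points $L_0$ and $L_m$ themselves are not needed for reducedness.\<close>

definition local_maxima :: "'w set list \<Rightarrow> 'w set list" where
  "local_maxima Is = map (\<lambda>i. Is ! i) (filter
     (\<lambda>i. (i = 0 \<or> Is ! (i - 1) \<subset> Is ! i) \<and> (Suc i = length Is \<or> Is ! Suc i \<subset> Is ! i))
     [0..<length Is])"

definition inner_local_minima :: "'w set list \<Rightarrow> 'w set list" where
  "inner_local_minima Is = map (\<lambda>i. Is ! i) (filter
     (\<lambda>i. 0 < i \<and> Suc i < length Is \<and> Is ! i \<subset> Is ! (i - 1) \<and> Is ! i \<subset> Is ! Suc i)
     [0..<length Is])"

text \<open>The list $w_{K_1} w_{L_1}^{-1}, \dots, w_{K_{m-1}} w_{L_{m-1}}^{-1}, w_{K_m}$; note that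
  \<open>zip\<close> drops $K_m$.\<close>

definition expression_factors :: "('w, 'z) coxeter_scheme \<Rightarrow> 'w set list \<Rightarrow> 'w list" where
  "expression_factors W Is =
     map (\<lambda>(K, L). longest W K \<otimes>\<^bsub>W\<^esub> inv\<^bsub>W\<^esub> (longest W L))
       (zip (local_maxima Is) (inner_local_minima Is))
     @ [longest W (last (local_maxima Is))]"

definition reduced_expression ::
    "('w, 'z) coxeter_scheme \<Rightarrow> 'w set \<Rightarrow> 'w set \<Rightarrow> 'w set list \<Rightarrow> 'w set \<Rightarrow> bool" where
  "reduced_expression W I J Is p \<longleftrightarrow>
     expresses W I J Is p \<and>
     max_elt W p = word_prod W (expression_factors W Is) \<and>
     len W (max_elt W p) = sum_list (map (len W) (expression_factors W Is))"

definition concat_expr :: "'w set list \<Rightarrow> 'w set list \<Rightarrow> 'w set list" where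
  "concat_expr Is Js = Is @ tl Js"

text \<open>An expression of the form $[[I \supset L]]$.\<close>

definition removal_expression :: "'w set list \<Rightarrow> 'w set \<Rightarrow> 'w set \<Rightarrow> bool" where
  "removal_expression Ds I L \<longleftrightarrow> Ds \<noteq> [] \<and> hd Ds = I \<and> last Ds = L \<and>
     (\<forall>i. Suc i < length Ds \<longrightarrow> (\<exists>s\<in>Ds ! i. Ds ! Suc i = Ds ! i - {s}))"

section \<open>Realizations\<close>

text \<open>The space $V$ is the whole type \<open>'v\<close>, with an enumerated basis
  \<open>bas X 0, \<dots>, bas X (dimV X - 1)\<close>; it is used only to write $\mathrm{Sym}(V^*)$ as a polynomial
  ring in the dual basis. The field \<open>rep\<close> is the representation of $W$ on $V$.\<close>

record ('w, 'k, 'v) realization = "'w coxeter" +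
  scal :: "'k \<Rightarrow> 'v \<Rightarrow> 'v"
  dimV :: nat
  bas :: "nat \<Rightarrow> 'v"
  coroot :: "'w \<Rightarrow> 'v"
  root :: "'w \<Rightarrow> 'v \<Rightarrow> 'k"
  rep :: "'w \<Rightarrow> 'v \<Rightarrow> 'v"

text \<open>\<open>qnum x y n\<close> is $[n]_s$ for $x = [2]_s$ and $y = [2]_t$.\<close>

fun qnum :: "'k::comm_ring_1 \<Rightarrow> 'k \<Rightarrow> nat \<Rightarrow> 'k" where
  "qnum x y 0 = 0"
| "qnum x y (Suc 0) = 1"
| "qnum x y (Suc (Suc n)) = x * qnum y x (Suc n) - qnum x y n"

definition quantum_number ::
    "('w, 'k::field, 'v::ab_group_add) realization \<Rightarrow> 'w \<Rightarrow> 'w \<Rightarrow> nat \<Rightarrow> 'k" where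
  "quantum_number X s t n = qnum (- root X t (coroot X s)) (- root X s (coroot X t)) n"

definition is_realization :: "('w, 'k::field, 'v::ab_group_add) realization \<Rightarrow> bool" where
  "is_realization X \<longleftrightarrow>
     coxeter_system X \<and>
     inj_on (bas X) {..<dimV X} \<and>
     finite_dimensional_vector_space (scal X) (bas X ` {..<dimV X}) \<and>
     (\<forall>s\<in>simple_refls X. Vector_Spaces.linear (scal X) (*) (root X s)) \<and>
     (\<forall>s\<in>simple_refls X. root X s (coroot X s) = 2) \<and>
     (\<forall>w\<in>carrier X. Vector_Spaces.linear (scal X) (scal X) (rep X w)) \<and>
     rep X \<one>\<^bsub>X\<^esub> = id \<and>
     (\<forall>x\<in>carrier X. \<forall>y\<in>carrier X. rep X (x \<otimes>\<^bsub>X\<^esub> y) = rep X x \<circ> rep X y) \<and>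
     (\<forall>s\<in>simple_refls X. \<forall>v. rep X s v = v - scal X (root X s v) (coroot X s)) \<and>
     (\<forall>s\<in>simple_refls X. \<forall>t\<in>simple_refls X. s \<noteq> t \<longrightarrow>
        group.ord X (s \<otimes>\<^bsub>X\<^esub> t) \<noteq> 0 \<longrightarrow>
        quantum_number X s t (group.ord X (s \<otimes>\<^bsub>X\<^esub> t)) = 0 \<and>
        quantum_number X t s (group.ord X (s \<otimes>\<^bsub>X\<^esub> t)) = 0)"

definition balanced :: "('w, 'k::field, 'v::ab_group_add) realization \<Rightarrow> bool" where
  "balanced X \<longleftrightarrow> (\<forall>s\<in>simple_refls X. \<forall>t\<in>simple_refls X. s \<noteq> t \<longrightarrow>
     group.ord X (s \<otimes>\<^bsub>X\<^esub> t) \<noteq> 0 \<longrightarrow>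
     quantum_number X s t (group.ord X (s \<otimes>\<^bsub>X\<^esub> t) - 1) = 1 \<and>
     quantum_number X t s (group.ord X (s \<otimes>\<^bsub>X\<^esub> t) - 1) = 1)"

text \<open>The subspace fixed by $x$ must have codimension exactly one: the identity fixes some
  codimension one subspace, but it is not a reflection.\<close>

definition reflection_faithful :: "('w, 'k::field, 'v::ab_group_add) realization \<Rightarrow> bool" where
  "reflection_faithful X \<longleftrightarrow> inj_on (rep X) (carrier X) \<and>
     (\<forall>x\<in>carrier X. vector_space.dim (scal X) {v. rep X x v = v} + 1 = dimV X \<longleftrightarrow> x \<in> reflections X)"

section \<open>The polynomial ring, invariants and Demazure operators\<close>

type_synonym 'k polynomial = "(nat \<Rightarrow>\<^sub>0 nat) \<Rightarrow>\<^sub>0 'k"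

text \<open>$R = \mathrm{Sym}(V^*)$ consists of the polynomials in the variables
  $x_0, \dots, x_{\dim V - 1}$, where $x_i$ is the element of the dual basis belonging to
  \<open>bas X i\<close>.\<close>

definition sym_ring :: "('w, 'k::field, 'v::ab_group_add) realization \<Rightarrow> 'k polynomial set" where
  "sym_ring X = {f. \<forall>m\<in>Poly_Mapping.keys f. Poly_Mapping.keys m \<subseteq> {..<dimV X}}"

definition linear_form ::
    "('w, 'k::field, 'v::ab_group_add) realization \<Rightarrow> ('v \<Rightarrow> 'k) \<Rightarrow> 'k polynomial" where
  "linear_form X l =
     (\<Sum>i<dimV X. Poly_Mapping.single (Poly_Mapping.single i 1) (l (bas X i)))"

definition coord :: "('w, 'k::field, 'v::ab_group_add) realization \<Rightarrow> nat \<Rightarrow> 'v \<Rightarrow> 'k" where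
  "coord X i v = Modules.module.representation (scal X) (bas X ` {..<dimV X}) v (bas X i)"

text \<open>The $\Bbbk$-algebra endomorphism extending the contragredient action
  $w(\lambda) = \lambda \circ w^{-1}$ on $V^*$.\<close>

definition weyl_act ::
    "('w, 'k::field, 'v::ab_group_add) realization \<Rightarrow> 'w \<Rightarrow> 'k polynomial \<Rightarrow> 'k polynomial" where
  "weyl_act X w f = (\<Sum>m\<in>Poly_Mapping.keys f. Poly_Mapping.single 0 (Poly_Mapping.lookup f m) *
     (\<Prod>i\<in>Poly_Mapping.keys m.
        linear_form X (\<lambda>v. coord X i (rep X (inv\<^bsub>X\<^esub> w) v)) ^ Poly_Mapping.lookup m i))"

text \<open>Homogeneity for the grading in which $V^*$ has degree 2.\<close>

definition homogeneous :: "int \<Rightarrow> 'k::field polynomial \<Rightarrow> bool" where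
  "homogeneous d f \<longleftrightarrow> (\<forall>m\<in>Poly_Mapping.keys f.
     2 * int (\<Sum>i\<in>Poly_Mapping.keys m. Poly_Mapping.lookup m i) = d)"

definition invariants ::
    "('w, 'k::field, 'v::ab_group_add) realization \<Rightarrow> 'w set \<Rightarrow> 'k polynomial set" where
  "invariants X I = {f \<in> sym_ring X. \<forall>w\<in>parabolic X I. weyl_act X w f = f}"

definition inv_ring ::
    "('w, 'k::field, 'v::ab_group_add) realization \<Rightarrow> 'w set \<Rightarrow> 'k polynomial ring" where
  "inv_ring X I = \<lparr>carrier = invariants X I, mult = (*), one = 1, zero = 0, add = (+)\<rparr>"

definition demazure_simple ::
    "('w, 'k::field, 'v::ab_group_add) realization \<Rightarrow> 'w \<Rightarrow> 'k polynomial \<Rightarrow> 'k polynomial" where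
  "demazure_simple X s f =
     (THE g. g \<in> sym_ring X \<and> linear_form X (root X s) * g = f - weyl_act X s f)"

text \<open>Balancedness makes this independent of the choice of the reduced word.\<close>

definition demazure ::
    "('w, 'k::field, 'v::ab_group_add) realization \<Rightarrow> 'w \<Rightarrow> 'k polynomial \<Rightarrow> 'k polynomial" where
  "demazure X w = foldr (demazure_simple X) (SOME ss. reduced_word X ss w)"

definition demazure_surjective ::
    "('w, 'k::field, 'v::ab_group_add) realization \<Rightarrow> bool" where
  "demazure_surjective X \<longleftrightarrow>
     (\<forall>I. finitary X I \<longrightarrow> demazure X (longest X I) ` sym_ring X = invariants X I)"

section \<open>Graded bimodules\<close>

text \<open>The rings acting are not part of the record. As in \<open>HOL-Algebra.Module\<close>, the fields
  \<open>mult\<close> and \<open>one\<close> are ignored. The right action is \<open>rsmult M b x\<close> $= x b$.\<close>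

record ('r, 'm) bimodule = "('r, 'm) module" +
  rsmult :: "'r \<Rightarrow> 'm \<Rightarrow> 'm"
  grade :: "int \<Rightarrow> 'm set"

text \<open>Since \<open>B\<close> is commutative, a right \<open>B\<close>-module is the same as a left one.\<close>

definition is_bimodule :: "'r ring \<Rightarrow> 'r ring \<Rightarrow> ('r, 'm) bimodule \<Rightarrow> bool" where
  "is_bimodule A B M \<longleftrightarrow> Module.module A M \<and> Module.module B (M\<lparr>smult := rsmult M\<rparr>) \<and>
     (\<forall>a\<in>carrier A. \<forall>b\<in>carrier B. \<forall>x\<in>carrier M.
        rsmult M b (a \<odot>\<^bsub>M\<^esub> x) = a \<odot>\<^bsub>M\<^esub> rsmult M b x)"

definition shift :: "int \<Rightarrow> ('r, 'm) bimodule \<Rightarrow> ('r, 'm) bimodule" where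
  "shift i M = M\<lparr>grade := \<lambda>j. grade M (i + j)\<rparr>"

definition bimodule_hom ::
    "'r ring \<Rightarrow> 'r ring \<Rightarrow> ('r, 'm) bimodule \<Rightarrow> ('r, 'n) bimodule \<Rightarrow> ('m \<Rightarrow> 'n) set" where
  "bimodule_hom A B M N = {f. f \<in> carrier M \<rightarrow> carrier N \<and>
     (\<forall>x\<in>carrier M. \<forall>y\<in>carrier M. f (x \<oplus>\<^bsub>M\<^esub> y) = f x \<oplus>\<^bsub>N\<^esub> f y) \<and>
     (\<forall>a\<in>carrier A. \<forall>x\<in>carrier M. f (a \<odot>\<^bsub>M\<^esub> x) = a \<odot>\<^bsub>N\<^esub> f x) \<and>
     (\<forall>b\<in>carrier B. \<forall>x\<in>carrier M. f (rsmult M b x) = rsmult N b (f x))}"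

definition hom_deg ::
    "'r ring \<Rightarrow> 'r ring \<Rightarrow> int \<Rightarrow> ('r, 'm) bimodule \<Rightarrow> ('r, 'n) bimodule \<Rightarrow> ('m \<Rightarrow> 'n) set" where
  "hom_deg A B i M N =
     {f \<in> bimodule_hom A B M N. \<forall>j. f ` grade M j \<subseteq> grade (shift i N) j}"

text \<open>$\mathrm{Hom}(M,N) = \bigoplus_i \mathrm{Hom}^i(M,N)$. Morphisms are total functions of which only the
  values on the carrier of \<open>M\<close> matter.\<close>

definition graded_hom ::
    "'r ring \<Rightarrow> 'r ring \<Rightarrow> ('r, 'm) bimodule \<Rightarrow> ('r, 'n) bimodule \<Rightarrow> ('m \<Rightarrow> 'n) set" where
  "graded_hom A B M N = {f \<in> carrier M \<rightarrow> carrier N.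
     \<exists>F h. finite F \<and> (\<forall>i\<in>F. h i \<in> hom_deg A B i M N) \<and>
       (\<forall>x\<in>carrier M. f x = (\<Oplus>\<^bsub>N\<^esub>i\<in>F. h i x))}"

definition graded_iso ::
    "'r ring \<Rightarrow> 'r ring \<Rightarrow> ('r, 'm) bimodule \<Rightarrow> ('r, 'n) bimodule \<Rightarrow> ('m \<Rightarrow> 'n) set" where
  "graded_iso A B M N = {f \<in> bimodule_hom A B M N. bij_betw f (carrier M) (carrier N) \<and>
     (\<forall>j. f ` grade M j = grade N j)}"

section \<open>Bott-Samelson bimodules\<close>

text \<open>For $I_\bullet = [I_0, \dots, I_d]$ we use
  $R^{I_0} \otimes_{R^{I_0}} \mathrm{BS}([I_0,I_1]) \otimes_{R^{I_1}} \cdots \otimes_{R^{I_{d-1}}}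
  \mathrm{BS}([I_{d-1},I_d])$, constructed at once as the free abelian group on the $(d+1)$-tuples
  modulo multiadditivity and the balancing relations. The redundant factor $R^{I_0}$ in position
  $0$ makes this uniform in $d \ge 0$. Position $i > 0$ carries the invariants of the smaller
  one of $I_{i-1}$ and $I_i$.\<close>

definition bs_entry ::
    "('w, 'k::field, 'v::ab_group_add) realization \<Rightarrow> 'w set list \<Rightarrow> nat \<Rightarrow> 'k polynomial set" where
  "bs_entry X Is i =
     (if i = 0 then invariants X (Is ! 0) else invariants X (Is ! (i - 1) \<inter> Is ! i))"

definition bs_tuples ::
    "('w, 'k::field, 'v::ab_group_add) realization \<Rightarrow> 'w set list \<Rightarrow> 'k polynomial list set" where
  "bs_tuples X Is = {a. length a = length Is \<and> (\<forall>i<length Is. a ! i \<in> bs_entry X Is i)}"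

definition bs_relations ::
    "('w, 'k::field, 'v::ab_group_add) realization \<Rightarrow> 'w set list \<Rightarrow> ('k polynomial list \<Rightarrow>\<^sub>0 int) set" where
  "bs_relations X Is =
     {frag_of (a[i := b + c]) - frag_of (a[i := b]) - frag_of (a[i := c]) | a i b c.
        a \<in> bs_tuples X Is \<and> i < length Is \<and> b \<in> bs_entry X Is i \<and> c \<in> bs_entry X Is i} \<union>
     {frag_of (a[i := a ! i * r]) - frag_of (a[Suc i := r * a ! Suc i]) | a i r.
        a \<in> bs_tuples X Is \<and> Suc i < length Is \<and> r \<in> invariants X (Is ! i)}"

definition bs_kernel ::
    "('w, 'k::field, 'v::ab_group_add) realization \<Rightarrow> 'w set list \<Rightarrow> ('k polynomial list \<Rightarrow>\<^sub>0 int) set" where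
  "bs_kernel X Is = generate (free_Abelian_group (bs_tuples X Is)) (bs_relations X Is)"

type_synonym 'k bs_elt = "('k polynomial list \<Rightarrow>\<^sub>0 int) set"

definition bs_group ::
    "('w, 'k::field, 'v::ab_group_add) realization \<Rightarrow> 'w set list \<Rightarrow> 'k bs_elt monoid" where
  "bs_group X Is = free_Abelian_group (bs_tuples X Is) Mod bs_kernel X Is"

definition bs_class ::
    "('w, 'k::field, 'v::ab_group_add) realization \<Rightarrow> 'w set list \<Rightarrow>
     ('k polynomial list \<Rightarrow>\<^sub>0 int) \<Rightarrow> 'k bs_elt" where
  "bs_class X Is x = bs_kernel X Is #>\<^bsub>free_Abelian_group (bs_tuples X Is)\<^esub> x"

definition bs_pure ::
    "('w, 'k::field, 'v::ab_group_add) realization \<Rightarrow> 'w set list \<Rightarrow> 'k polynomial list \<Rightarrow> 'k bs_elt" where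
  "bs_pure X Is a = bs_class X Is (frag_of a)"

text \<open>The additive map sending the pure tensor of \<open>a\<close> to the pure tensor of \<open>t a\<close>, for a map
  \<open>t\<close> on tuples compatible with the relations. The union is over the representatives \<open>x\<close>
  of the class \<open>c\<close>.\<close>

definition bs_induced ::
    "('w, 'k::field, 'v::ab_group_add) realization \<Rightarrow> 'w set list \<Rightarrow>
     ('k polynomial list \<Rightarrow> 'k polynomial list) \<Rightarrow> 'k bs_elt \<Rightarrow> 'k bs_elt" where
  "bs_induced X Js t c = (\<Union>x\<in>c. bs_class X Js (frag_extend (\<lambda>a. frag_of (t a)) x))"

text \<open>A homogeneous element of degree $e$ of $R^I$ has degree $e - (\ell(J) - \ell(I))$ in
  $\mathrm{BS}([J,I]) = R^I(\ell(J) - \ell(I))$.\<close>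

definition bs_shift :: "('w, 'k::field, 'v::ab_group_add) realization \<Rightarrow> 'w set list \<Rightarrow> int" where
  "bs_shift X Is = (\<Sum>i | Suc i < length Is \<and> Is ! Suc i \<subset> Is ! i.
     int (len X (longest X (Is ! i))) - int (len X (longest X (Is ! Suc i))))"

definition bs_grade ::
    "('w, 'k::field, 'v::ab_group_add) realization \<Rightarrow> 'w set list \<Rightarrow> int \<Rightarrow> 'k bs_elt set" where
  "bs_grade X Is j = generate (bs_group X Is) {bs_pure X Is a | a. a \<in> bs_tuples X Is \<and>
     (\<exists>e. (\<forall>i<length Is. homogeneous (e i) (a ! i)) \<and> (\<Sum>i<length Is. e i) - bs_shift X Is = j)}"

definition BS ::
    "('w, 'k::field, 'v::ab_group_add) realization \<Rightarrow> 'w set list \<Rightarrow>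
     ('k polynomial, 'k bs_elt) bimodule" where
  "BS X Is = \<lparr>carrier = carrier (bs_group X Is), mult = undefined, one = undefined,
     zero = one (bs_group X Is), add = mult (bs_group X Is),
     smult = (\<lambda>r. bs_induced X Is (\<lambda>a. a[0 := r * a ! 0])),
     rsmult = (\<lambda>r. bs_induced X Is (\<lambda>a. a[length Is - 1 := a ! (length Is - 1) * r])),
     grade = bs_grade X Is\<rparr>"

definition one_tensor ::
    "('w, 'k::field, 'v::ab_group_add) realization \<Rightarrow> 'w set list \<Rightarrow> 'k bs_elt" where
  "one_tensor X Is = bs_pure X Is (replicate (length Is) 1)"

section \<open>Lower terms\<close>

definition hom_ideal ::
    "('w, 'k::field, 'v::ab_group_add) realization \<Rightarrow> 'w set \<Rightarrow> 'w set \<Rightarrow> 'w set set \<Rightarrow>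
     ('k polynomial, 'm) bimodule \<Rightarrow> ('k polynomial, 'n) bimodule \<Rightarrow> ('m \<Rightarrow> 'n) set" where
  "hom_ideal X I J C M N = {f \<in> carrier M \<rightarrow> carrier N.
     \<exists>(n::nat) Ms g h.
       (\<forall>k<n. (\<exists>q\<in>C. expresses X I J (Ms k) q) \<and>
          h k \<in> graded_hom (inv_ring X I) (inv_ring X J) M (BS X (Ms k)) \<and>
          g k \<in> graded_hom (inv_ring X I) (inv_ring X J) (BS X (Ms k)) N) \<and>
       (\<forall>x\<in>carrier M. f x = (\<Oplus>\<^bsub>N\<^esub>k\<in>{..<n}. g k (h k x)))}"

definition hom_less ::
    "('w, 'k::field, 'v::ab_group_add) realization \<Rightarrow> 'w set \<Rightarrow> 'w set \<Rightarrow> 'w set \<Rightarrow>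
     ('k polynomial, 'm) bimodule \<Rightarrow> ('k polynomial, 'n) bimodule \<Rightarrow> ('m \<Rightarrow> 'n) set" where
  "hom_less X I J p = hom_ideal X I J {q \<in> double_cosets X I J. coset_less X q p}"

section \<open>The action of the invariants of the left redundancy\<close>

text \<open>For a removal expression \<open>Ds\<close> ending where \<open>Ks\<close> starts, this is the map
  $\mathrm{BS}(K_\bullet) \to \mathrm{BS}(D_\bullet \circ K_\bullet)$,
  $m \mapsto 1 \otimes \cdots \otimes 1 \otimes m$.\<close>

definition prepend_ones ::
    "('w, 'k::field, 'v::ab_group_add) realization \<Rightarrow> 'w set list \<Rightarrow> 'w set list \<Rightarrow>
     'k bs_elt \<Rightarrow> 'k bs_elt" where
  "prepend_ones X Ds Ks =
     bs_induced X (concat_expr Ds Ks) (\<lambda>a. replicate (length Ds - 1) 1 @ a)"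

text \<open>The left action on $\mathrm{BS}(D_\bullet \circ K_\bullet)$ transported from
  $\mathrm{BS}(K_\bullet)$ along this bijection.\<close>

definition redundancy_action ::
    "('w, 'k::field, 'v::ab_group_add) realization \<Rightarrow> 'w set list \<Rightarrow> 'w set list \<Rightarrow>
     'k polynomial \<Rightarrow> 'k bs_elt \<Rightarrow> 'k bs_elt" where
  "redundancy_action X Ds Ks r x =
     prepend_ones X Ds Ks
       (r \<odot>\<^bsub>BS X Ks\<^esub> inv_into (carrier (BS X Ks)) (prepend_ones X Ds Ks) x)"

end

theory Submission
  imports Defs
begin

text \<open>A functional on $\mathrm{BS}(M_\bullet)$ with values in $R$ that is left $R^I$-linear and
  right $R^J$-linear up to the twist by some $w \in W$ vanishes unless
  $w \in W_{M_0} \cdots W_{M_d}$: by Galois theory for the invariant rings it splits, up to nonzero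
  factors, into functionals twisted by the elements of that set. If $M_\bullet$ expresses $q$, all
  elements of the set lie below $\overline q$ in the Bruhat order, so that it does not meet $p$
  when $q < p$. On the other hand, since $I'_\bullet$ expresses $p$, there are
  $u_i \in W_{K_i}$ whose product $w$ lies in $p$; evaluation along $1, u_0, u_0 u_1, \dots$
  is a functional on $\mathrm{BS}(I'_\bullet)$ twisted by this $w$ which maps $r \cdot 1^\otimes$
  to $r$ for $r \in R^{\mathrm{LR}(p)}$. It kills every morphism through lower terms, hence $r = 0$
  whenever $r \cdot 1^\otimes$ lies in the image of such a morphism.\<close>

section \<open>Reflections and length\<close>

text \<open>Over the fraction fields of the invariant rings the splitting of functionals is plain
  Galois theory. Over the rings themselves the idempotents have denominators, and one cannot average
  over W_I, whose order may vanish in the field. So Dedekind independence supplies a nonzero trace,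
  a norm makes the remaining denominator invariant, and nonzero factors are cancelled because all
  values lie in the domain R.

  The induction strips one tensor factor at a time and moves the left twist from z to zg with g in
  the first parabolic subgroup. The new functional has to respect the relations in the rest of the
  tensor, which is why one system of pairs is fixed for all functionals at once.

  The coefficient r survives untwisted because the path through \<open>Ks\<close> starts at 1. Such
  a path can end in p: the sets met while elements are removed from I lie in I, and the left
  W_I-stability of p absorbs their factors.

  Lengths, exchange and the Bruhat order are derived from a single cocycle on words, the parity with
  which a reflection occurs, whose invariance under the defining relations is checked
  directly.\<close>

locale coxeter_group = group W for W :: "('w, 'z) coxeter_scheme" (structure) +
  assumes coxeter: "coxeter_system W"
begin

abbreviation S where "S \<equiv> simple_refls W"

lemma S_carrier [simp]: "s \<in> S \<Longrightarrow> s \<in> carrier W"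
  using coxeter unfolding coxeter_system_def by blast

lemma S_ord: "s \<in> S \<Longrightarrow> ord s = 2"
  using coxeter unfolding coxeter_system_def by blast

lemma S_sq [simp]: "s \<in> S \<Longrightarrow> s \<otimes> s = \<one>"
  using pow_ord_eq_1[of s] S_ord[of s] by (simp add: numeral_2_eq_2)

lemma S_not_one: "s \<in> S \<Longrightarrow> s \<noteq> \<one>"
  using S_ord[of s] ord_id by auto

lemma S_inv [simp]: "s \<in> S \<Longrightarrow> inv s = s"
  by (metis S_carrier S_sq inv_equality)

lemma S_sq_left [simp]: "s \<in> S \<Longrightarrow> x \<in> carrier W \<Longrightarrow> s \<otimes> (s \<otimes> x) = x"
  by (metis S_carrier S_sq l_one m_assoc)

lemma S_sq_right [simp]: "s \<in> S \<Longrightarrow> x \<in> carrier W \<Longrightarrow> x \<otimes> s \<otimes> s = x"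
  by (simp add: m_assoc)

lemma inv_cancel [simp]:
  "x \<in> carrier W \<Longrightarrow> y \<in> carrier W \<Longrightarrow> inv x \<otimes> (x \<otimes> y) = y"
  "x \<in> carrier W \<Longrightarrow> y \<in> carrier W \<Longrightarrow> x \<otimes> (inv x \<otimes> y) = y"
  by (simp_all add: m_assoc[symmetric])

lemma word_prod_Nil [simp]: "word_prod W [] = \<one>"
  by (simp add: word_prod_def)

lemma word_prod_Cons [simp]: "word_prod W (s # ss) = s \<otimes> word_prod W ss"
  by (simp add: word_prod_def)

lemma word_prod_closed [simp]: "set ss \<subseteq> carrier W \<Longrightarrow> word_prod W ss \<in> carrier W"
  by (induction ss) auto

lemma word_prod_S [simp]: "set ss \<subseteq> S \<Longrightarrow> word_prod W ss \<in> carrier W"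
  by (rule word_prod_closed) auto

lemma word_prod_append:
  "set us \<subseteq> S \<Longrightarrow> set vs \<subseteq> S \<Longrightarrow>
    word_prod W (us @ vs) = word_prod W us \<otimes> word_prod W vs"
  by (induction us) (auto simp: m_assoc)

lemma word_prod_rev: "set ss \<subseteq> S \<Longrightarrow> word_prod W (rev ss) = inv (word_prod W ss)"
  by (induction ss) (auto simp: word_prod_append inv_mult_group)

lemma parabolic_words:
  assumes "I \<subseteq> S"
  shows "w \<in> parabolic W I \<longleftrightarrow> (\<exists>ss. set ss \<subseteq> I \<and> word_prod W ss = w)"
proof
  assume "w \<in> parabolic W I"
  then show "\<exists>ss. set ss \<subseteq> I \<and> word_prod W ss = w"
    unfolding parabolic_def
  proof (induction rule: generate.induct)
    case one
    then show ?case by (intro exI[of _ "[]"]) simp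
  next
    case (incl h)
    then show ?case using assms by (intro exI[of _ "[h]"]) (auto simp: subset_iff)
  next
    case (inv h)
    then show ?case using assms by (intro exI[of _ "[h]"]) (auto simp: subset_iff)
  next
    case (eng h1 h2)
    then obtain us vs where *: "set us \<subseteq> I" "word_prod W us = h1" "set vs \<subseteq> I" "word_prod W vs = h2"
      by blast
    then have "set us \<subseteq> S" "set vs \<subseteq> S" using assms by blast+
    with * show ?case
      by (intro exI[of _ "us @ vs"]) (simp add: word_prod_append)
  qed
next
  have "set ss \<subseteq> I \<Longrightarrow> word_prod W ss \<in> parabolic W I" for ss
  proof (induction ss)
    case Nil
    then show ?case by (simp add: parabolic_def generate.one)
  next
    case (Cons s ss)
    then show ?case unfolding parabolic_def by (auto intro: generate.eng generate.incl)
  qed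
  moreover assume "\<exists>ss. set ss \<subseteq> I \<and> word_prod W ss = w"
  ultimately show "w \<in> parabolic W I" by blast
qed

lemma parabolic_subgroup: "I \<subseteq> S \<Longrightarrow> subgroup (parabolic W I) W"
  unfolding parabolic_def by (rule generate_is_subgroup) auto

lemma parabolic_carrier: "I \<subseteq> S \<Longrightarrow> x \<in> parabolic W I \<Longrightarrow> x \<in> carrier W"
  by (rule subgroup.mem_carrier[OF parabolic_subgroup])

lemma parabolic_mono: "I \<subseteq> J \<Longrightarrow> parabolic W I \<subseteq> parabolic W J"
  unfolding parabolic_def by (rule mono_generate)

lemma parabolic_incl: "s \<in> I \<Longrightarrow> s \<in> parabolic W I"
  unfolding parabolic_def by (rule generate.incl)

lemma ex_word: "w \<in> carrier W \<Longrightarrow> \<exists>ss. set ss \<subseteq> S \<and> word_prod W ss = w"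
  using parabolic_words[of S w] coxeter by (auto simp: coxeter_system_def parabolic_def)

text \<open>The parity of the number of occurrences of \<open>t\<close> among the reflections
  $s_1 \cdots s_{i-1} s_i s_{i-1} \cdots s_1$ of a word.\<close>

primrec refl_parity :: "'w list \<Rightarrow> 'w \<Rightarrow> bool" where
  "refl_parity [] t = False"
| "refl_parity (s # ss) t = ((s = t) \<noteq> refl_parity ss (s \<otimes> t \<otimes> s))"

text \<open>A cocycle rule: the reflections attached to \<open>us @ vs\<close> are those of
  \<open>us\<close> followed by those of \<open>vs\<close> conjugated by the product of
  \<open>us\<close>.\<close>

lemma refl_parity_append:
  assumes "set us \<subseteq> S" "t \<in> carrier W"
  shows "refl_parity (us @ vs) t \<longleftrightarrow>
    refl_parity us t \<noteq> refl_parity vs (inv (word_prod W us) \<otimes> t \<otimes> word_prod W us)"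
  using assms
proof (induction us arbitrary: t)
  case (Cons s us)
  have "inv (word_prod W us) \<otimes> (s \<otimes> t \<otimes> s) \<otimes> word_prod W us =
      inv (word_prod W (s # us)) \<otimes> t \<otimes> word_prod W (s # us)"
    using Cons.prems by (simp add: inv_mult_group m_assoc)
  with Cons show ?case by auto
qed simp

text \<open>The reflections attached to the word s t s t ... with 2n letters are (st)^k s for k <
  2n, so the parity counts the solutions k of (st)^k s = x.\<close>

lemma alternating_refl_parity:
  assumes "s \<in> S" "t \<in> S" "x \<in> carrier W"
  shows "refl_parity (concat (replicate n [s, t])) x \<longleftrightarrow>
    odd (card {k. k < 2 * n \<and> (s \<otimes> t) [^] k \<otimes> s = x})"
  using assms(3)
proof (induction n arbitrary: x)
  case (Suc n)
  let ?r = "s \<otimes> t"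
  define A where "A = {k. k < 2 * n \<and> ?r [^] k \<otimes> s = t \<otimes> (s \<otimes> x \<otimes> s) \<otimes> t}"
  note [simp] = assms(1,2) Suc.prems
  \<comment> \<open>Removing the first two letters conjugates by st, which moves the index k to k +
    2; the indices 0 and 1 belong to the removed letters.\<close>
  have conj: "?r [^] k \<otimes> s = t \<otimes> (s \<otimes> x \<otimes> s) \<otimes> t \<longleftrightarrow> ?r [^] (k + 2) \<otimes> s = x" for k :: nat
  proof -
    have r: "t \<otimes> s = inv ?r" by (simp add: inv_mult_group)
    have "?r [^] Suc (Suc k) = ?r \<otimes> ?r [^] k \<otimes> ?r"
      by (subst nat_pow_Suc, subst nat_pow_Suc2) simp_all
    then have "?r [^] (k + 2) = ?r \<otimes> ?r [^] k \<otimes> ?r"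
      by (simp only: add_2_eq_Suc')
    then have 1: "?r [^] (k + 2) \<otimes> s = ?r \<otimes> (?r [^] k \<otimes> s) \<otimes> (t \<otimes> s)"
      by (simp add: m_assoc)
    have 2: "t \<otimes> (s \<otimes> x \<otimes> s) \<otimes> t = inv ?r \<otimes> x \<otimes> inv (t \<otimes> s)"
      by (simp add: inv_mult_group m_assoc)
    have 3: "y = inv ?r \<otimes> x \<otimes> inv (t \<otimes> s) \<longleftrightarrow> ?r \<otimes> y \<otimes> (t \<otimes> s) = x"
      if "y \<in> carrier W" for y
    proof
      assume "y = inv ?r \<otimes> x \<otimes> inv (t \<otimes> s)"
      then show "?r \<otimes> y \<otimes> (t \<otimes> s) = x" by (simp add: inv_mult_group m_assoc)
    next
      assume x: "?r \<otimes> y \<otimes> (t \<otimes> s) = x"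
      show "y = inv ?r \<otimes> x \<otimes> inv (t \<otimes> s)"
        unfolding x[symmetric] using that by (simp add: inv_mult_group m_assoc)
    qed
    show ?thesis unfolding 1 2 by (rule 3) simp
  qed
  have "{k. k < 2 * Suc n \<and> ?r [^] k \<otimes> s = x} =
      {k. k = 0 \<and> s = x} \<union> {k. k = 1 \<and> s \<otimes> t \<otimes> s = x} \<union> (\<lambda>k. k + 2) ` A"
  proof (intro equalityI subsetI)
    fix k assume k: "k \<in> {k. k < 2 * Suc n \<and> ?r [^] k \<otimes> s = x}"
    consider "k = 0" | "k = 1" | j where "k = j + 2"
      by (metis One_nat_def Suc_1 add_2_eq_Suc' not0_implies_Suc)
    then show "k \<in> {k. k = 0 \<and> s = x} \<union> {k. k = 1 \<and> s \<otimes> t \<otimes> s = x} \<union> (\<lambda>k. k + 2) ` A"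
    proof cases
      case (3 j)
      then have "j \<in> A" using k by (simp add: A_def conj del: nat_pow_Suc add_2_eq_Suc')
      with 3 show ?thesis by blast
    qed (use k in auto)
  next
    fix k assume "k \<in> {k. k = 0 \<and> s = x} \<union> {k. k = 1 \<and> s \<otimes> t \<otimes> s = x} \<union> (\<lambda>k. k + 2) ` A"
    then show "k \<in> {k. k < 2 * Suc n \<and> ?r [^] k \<otimes> s = x}"
      using conj by (auto simp: A_def simp del: nat_pow_Suc add_2_eq_Suc')
  qed
  moreover have "finite A" by (simp add: A_def)
  moreover have "card ((\<lambda>k. k + 2) ` A) = card A" by (rule card_image) (simp add: inj_on_def)
  ultimately have "card {k. k < 2 * Suc n \<and> ?r [^] k \<otimes> s = x} =
      (if s = x then 1 else 0) + (if s \<otimes> t \<otimes> s = x then 1 else 0) + card A"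
    by (auto simp: card_Un_disjoint card_insert_if)
  moreover have "t = s \<otimes> x \<otimes> s \<longleftrightarrow> s \<otimes> t \<otimes> s = x"
    by (metis S_carrier S_sq_left S_sq_right Suc.prems assms(1,2) m_assoc m_closed)
  moreover have "refl_parity (concat (replicate n [s, t])) (t \<otimes> (s \<otimes> x \<otimes> s) \<otimes> t) \<longleftrightarrow> odd (card A)"
    unfolding A_def by (rule Suc.IH) simp
  ultimately show ?case by auto
qed simp

text \<open>For m the order of st, the element (st)^k s depends on k only modulo m, so among the 2m
  indices each value occurs an even number of times.\<close>

lemma relator_refl_parity:
  assumes "s \<in> S" "t \<in> S" "x \<in> carrier W" and m: "m = ord (s \<otimes> t)"
  shows "\<not> refl_parity (concat (replicate m [s, t])) x"
proof -
  let ?A = "{k::nat. k < m \<and> (s \<otimes> t) [^] k \<otimes> s = x}"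
  have per: "(s \<otimes> t) [^] (k + m) = (s \<otimes> t) [^] k" for k :: nat
    using assms by (simp add: nat_pow_mult[symmetric] pow_ord_eq_1)
  have "{k::nat. k < 2 * m \<and> (s \<otimes> t) [^] k \<otimes> s = x} = ?A \<union> (\<lambda>k. k + m) ` ?A"
  proof (intro equalityI subsetI)
    fix k assume k: "k \<in> {k::nat. k < 2 * m \<and> (s \<otimes> t) [^] k \<otimes> s = x}"
    show "k \<in> ?A \<union> (\<lambda>k. k + m) ` ?A"
    proof (cases "k < m")
      case False
      then have "k = (k - m) + m" "k - m \<in> ?A" using k per[of "k - m"] by auto
      then show ?thesis by blast
    next
      case True
      with k show ?thesis by blast
    qed
  next
    fix k assume "k \<in> ?A \<union> (\<lambda>k. k + m) ` ?A"
    then show "k \<in> {k::nat. k < 2 * m \<and> (s \<otimes> t) [^] k \<otimes> s = x}" using per by auto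
  qed
  moreover have "card (?A \<union> (\<lambda>k. k + m) ` ?A) = card ?A + card ((\<lambda>k. k + m) ` ?A)"
    by (rule card_Un_disjoint) auto
  moreover have "card ((\<lambda>k. k + m) ` ?A) = card ?A" by (rule card_image) (simp add: inj_on_def)
  ultimately have "even (card {k::nat. k < 2 * m \<and> (s \<otimes> t) [^] k \<otimes> s = x})" by simp
  with assms alternating_refl_parity show ?thesis by blast
qed

lemma word_prod_relator:
  assumes "s \<in> S" "t \<in> S"
  shows "word_prod W (concat (replicate m [s, t])) = (s \<otimes> t) [^] m"
proof (induction m)
  case (Suc m)
  moreover have "(s \<otimes> t) [^] Suc m = (s \<otimes> t) \<otimes> (s \<otimes> t) [^] m"
    using assms by (intro nat_pow_Suc2) simp
  ultimately show ?case using assms by (simp add: m_assoc del: nat_pow_Suc)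
qed simp

lemma relator_insertion_parity:
  assumes "s \<in> S" "t \<in> S" "m = ord (s \<otimes> t)" "set (u @ v) \<subseteq> S" "x \<in> carrier W"
  shows "refl_parity (u @ concat (replicate m [s, t]) @ v) x = refl_parity (u @ v) x"
proof -
  let ?r = "concat (replicate m [s, t])"
  have r: "set ?r \<subseteq> S" using assms by (auto simp: set_replicate_conv_if split: if_splits)
  have one: "word_prod W ?r = \<one>" using assms by (simp add: word_prod_relator pow_ord_eq_1)
  have "refl_parity (?r @ v) y = refl_parity v y" if "y \<in> carrier W" for y
    using refl_parity_append[OF r that, of v] relator_refl_parity[OF assms(1,2) that assms(3)]
    by (simp add: one that)
  then show ?thesis using assms by (auto simp: refl_parity_append)
qed

lemma relator_step_parity:
  assumes "relator_step W a b" "set a \<subseteq> S"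
  shows "set b \<subseteq> S \<and> (\<forall>x\<in>carrier W. refl_parity a x = refl_parity b x)"
  using assms
proof cases
  case (insert_relator s t m u v)
  then show ?thesis using assms(2) relator_insertion_parity[of s t m u v]
    by (auto simp: set_replicate_conv_if)
next
  case (delete_relator s t m u v)
  then show ?thesis using assms(2) relator_insertion_parity[of s t m u v]
    by auto
qed

text \<open>Here the presentation of W enters: inserting or deleting a relator changes no parity,
  and every word for 1 is connected with the empty word by such steps.\<close>

lemma refl_parity_trivial:
  assumes "set ss \<subseteq> S" "word_prod W ss = \<one>" "x \<in> carrier W"
  shows "\<not> refl_parity ss x"
proof -
  have "rtranclp (relator_step W) ss []"
    using coxeter assms by (auto simp: coxeter_system_def)
  then have "set ss \<subseteq> S \<longrightarrow> (refl_parity ss x = refl_parity [] x)"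
    by (induction rule: converse_rtranclp_induct)
      (use relator_step_parity assms(3) in auto)
  then show ?thesis using assms by simp
qed

lemma refl_parity_unique:
  assumes "set us \<subseteq> S" "set vs \<subseteq> S" "word_prod W us = word_prod W vs" "x \<in> carrier W"
  shows "refl_parity us x = refl_parity vs x"
proof -
  \<comment> \<open>Any word with the same product as \<open>us\<close> becomes a word for 1 after
    appending \<open>rev us\<close>, which expresses its parity by \<open>us\<close> alone.\<close>
  have *: "refl_parity ws x \<longleftrightarrow>
      refl_parity (rev us) (inv (word_prod W us) \<otimes> x \<otimes> word_prod W us)"
    if "set ws \<subseteq> S" "word_prod W ws = word_prod W us" for ws
  proof -
    have "word_prod W (ws @ rev us) = \<one>"
      using that assms(1) by (simp add: word_prod_append word_prod_rev)
    then have "\<not> refl_parity (ws @ rev us) x"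
      using that assms(1,4) by (intro refl_parity_trivial) auto
    then show ?thesis using refl_parity_append[OF that(1) assms(4), of "rev us"] that by simp
  qed
  show ?thesis using *[of us] *[of vs] assms by simp
qed

text \<open>For a reflection t this is the left inversion condition l(tw) < l(w), see
  \<open>inverted_iff\<close>. By \<open>refl_parity_unique\<close> the word chosen for w is
  immaterial, so the cocycle rule passes from words to W.\<close>

definition inverted :: "'w \<Rightarrow> 'w \<Rightarrow> bool" where
  "inverted w t = refl_parity (SOME ss. set ss \<subseteq> S \<and> word_prod W ss = w) t"

lemma inverted_word:
  assumes "set ss \<subseteq> S" "t \<in> carrier W"
  shows "inverted (word_prod W ss) t = refl_parity ss t"
proof -
  have "\<exists>us. set us \<subseteq> S \<and> word_prod W us = word_prod W ss" using assms by blast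
  from someI_ex[OF this] show ?thesis
    unfolding inverted_def using assms by (intro refl_parity_unique) auto
qed

lemma inverted_mult:
  assumes "u \<in> carrier W" "v \<in> carrier W" "t \<in> carrier W"
  shows "inverted (u \<otimes> v) t \<longleftrightarrow> inverted u t \<noteq> inverted v (inv u \<otimes> t \<otimes> u)"
proof -
  obtain us vs where "set us \<subseteq> S" "word_prod W us = u" "set vs \<subseteq> S" "word_prod W vs = v"
    using ex_word assms by meson
  then show ?thesis
    using refl_parity_append[of us t vs] inverted_word[of "us @ vs" t] inverted_word[of us t]
      inverted_word[of vs "inv u \<otimes> t \<otimes> u"] assms
    by (simp add: word_prod_append)
qed

lemma inverted_one: "t \<in> carrier W \<Longrightarrow> \<not> inverted \<one> t"
  using inverted_word[of "[]" t] by simp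

lemma inverted_simple: "s \<in> S \<Longrightarrow> t \<in> carrier W \<Longrightarrow> inverted s t \<longleftrightarrow> s = t"
  using inverted_word[of "[s]" t] by simp

section \<open>Reflections and the strong exchange condition\<close>

lemma refl_cases:
  assumes "t \<in> reflections W"
  obtains w s where "w \<in> carrier W" "s \<in> S" "t = w \<otimes> s \<otimes> inv w"
  using assms by (auto simp: reflections_def)

lemma refl_carrier [simp]: "t \<in> reflections W \<Longrightarrow> t \<in> carrier W"
  by (erule refl_cases) simp

lemma refl_sq [simp]: "t \<in> reflections W \<Longrightarrow> t \<otimes> t = \<one>"
proof (erule refl_cases)
  fix w s assume *: "w \<in> carrier W" "s \<in> S" "t = w \<otimes> s \<otimes> inv w"
  then show "t \<otimes> t = \<one>" by (simp add: m_assoc)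
qed

lemma refl_conj:
  assumes "x \<in> carrier W" "t \<in> reflections W"
  shows "x \<otimes> t \<otimes> inv x \<in> reflections W"
proof -
  obtain w s where "w \<in> carrier W" "s \<in> S" "t = w \<otimes> s \<otimes> inv w" using assms refl_cases by metis
  then show ?thesis using assms unfolding reflections_def
    by (intro CollectI exI[of _ "x \<otimes> w"] exI[of _ s]) (simp add: m_assoc inv_mult_group)
qed

lemma refl_inv [simp]: "t \<in> reflections W \<Longrightarrow> inv t = t"
  by (metis inv_equality refl_carrier refl_sq)

lemma S_refl: "s \<in> S \<Longrightarrow> s \<in> reflections W"
  unfolding reflections_def by (intro CollectI exI[of _ \<one>] exI[of _ s]) simp

text \<open>With t = u s u^{-1}, the cocycle rule produces contributions of u and of u^{-1} that
  cancel and a single contribution of s.\<close>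

lemma inverted_self:
  assumes "t \<in> reflections W"
  shows "inverted t t"
proof -
  obtain u s where u: "u \<in> carrier W" "s \<in> S" "t = u \<otimes> s \<otimes> inv u" using assms refl_cases by metis
  have t: "t \<in> carrier W" using assms by simp
  have c: "inv u \<otimes> t \<otimes> u = s"
    using u by (simp add: m_assoc)
  have d: "s \<otimes> (inv u \<otimes> t \<otimes> u) \<otimes> s = s" unfolding c using u by simp
  have e: "inv (u \<otimes> s) \<otimes> t \<otimes> (u \<otimes> s) = s"
    using d u t by (simp add: m_assoc inv_mult_group)
  have "inverted t t \<longleftrightarrow> inverted (u \<otimes> s) t \<noteq> inverted (inv u) s"
    using inverted_mult[of "u \<otimes> s" "inv u" t] u t e by simp
  moreover have "inverted (u \<otimes> s) t \<longleftrightarrow> \<not> inverted u t"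
    using inverted_mult[of u s t] u t c by (simp add: inverted_simple)
  moreover have "inverted u t = inverted (inv u) s"
    using inverted_mult[of u "inv u" t] u t c by (simp add: inverted_one)
  ultimately show ?thesis by simp
qed

text \<open>This is the strong exchange condition. An odd number of occurrences means at least one,
  and multiplying by the reflection attached to a letter deletes that letter.\<close>

lemma exchange:
  assumes "set ss \<subseteq> S" "t \<in> carrier W" "refl_parity ss t"
  shows "\<exists>us s vs. ss = us @ s # vs \<and> t \<otimes> word_prod W ss = word_prod W (us @ vs)"
  using assms
proof (induction ss arbitrary: t)
  case (Cons s ss)
  show ?case
  proof (cases "s = t")
    case True
    then show ?thesis using Cons.prems by (intro exI[of _ "[]"] exI[of _ s] exI[of _ ss]) auto
  next
    case False
    then have "refl_parity ss (s \<otimes> t \<otimes> s)" using Cons.prems by simp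
    then obtain us r vs where *: "ss = us @ r # vs"
        "(s \<otimes> t \<otimes> s) \<otimes> word_prod W ss = word_prod W (us @ vs)"
      using Cons.IH[of "s \<otimes> t \<otimes> s"] Cons.prems by auto
    have "t \<otimes> word_prod W (s # ss) = s \<otimes> ((s \<otimes> t \<otimes> s) \<otimes> word_prod W ss)"
      using Cons.prems by (simp add: m_assoc)
    then show ?thesis using *
      by (intro exI[of _ "s # us"] exI[of _ r] exI[of _ vs]) auto
  qed
qed simp

section \<open>Length and inversions\<close>

lemma len_le: "set ss \<subseteq> S \<Longrightarrow> len W (word_prod W ss) \<le> length ss"
  unfolding len_def by (rule Least_le) blast

lemma ex_reduced_word: "w \<in> carrier W \<Longrightarrow> \<exists>ss. reduced_word W ss w"
  unfolding reduced_word_def len_def using ex_word[of w]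
  by (smt (verit, del_insts) LeastI_ex)

lemma reduced_wordD:
  "reduced_word W ss w \<Longrightarrow> set ss \<subseteq> S" "reduced_word W ss w \<Longrightarrow> word_prod W ss = w"
  "reduced_word W ss w \<Longrightarrow> length ss = len W w"
  by (auto simp: reduced_word_def)

lemma inverted_len:
  assumes "w \<in> carrier W" "t \<in> carrier W" "inverted w t"
  shows "len W (t \<otimes> w) < len W w"
proof -
  obtain ss where ss: "reduced_word W ss w" using ex_reduced_word assms by blast
  note r = reduced_wordD[OF ss]
  have "refl_parity ss t" using inverted_word[of ss t] r assms by simp
  then obtain us s vs where *: "ss = us @ s # vs" "t \<otimes> word_prod W ss = word_prod W (us @ vs)"
    using exchange r assms by blast
  have "len W (t \<otimes> w) \<le> length (us @ vs)" using * r len_le[of "us @ vs"] by auto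
  also have "\<dots> < len W w" using * r by simp
  finally show ?thesis .
qed

text \<open>Since t inverts itself, it is an inversion of exactly one of w and tw; so
  \<open>inverted_len\<close> applies to w or to tw and decides which of the two is shorter.\<close>

lemma inverted_iff:
  assumes "w \<in> carrier W" "t \<in> reflections W"
  shows "inverted w t \<longleftrightarrow> len W (t \<otimes> w) < len W w"
proof
  show "inverted w t \<Longrightarrow> len W (t \<otimes> w) < len W w" using inverted_len assms by simp
  assume "len W (t \<otimes> w) < len W w"
  moreover have "len W w < len W (t \<otimes> w)" if "\<not> inverted w t"
  proof -
    have "t \<otimes> (t \<otimes> w) = w" using assms by (metis l_one m_assoc refl_carrier refl_sq)
    moreover have "inverted (t \<otimes> w) t"
      using inverted_mult[of t w t] inverted_self[of t] assms that by simp
    ultimately show ?thesis using inverted_len[of "t \<otimes> w" t] assms by simp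
  qed
  ultimately show "inverted w t" by auto
qed

lemma len_refl_neq:
  assumes "w \<in> carrier W" "t \<in> reflections W"
  shows "len W (t \<otimes> w) \<noteq> len W w"
proof -
  have "t \<otimes> (t \<otimes> w) = w" using assms by (metis l_one m_assoc refl_carrier refl_sq)
  moreover have "inverted (t \<otimes> w) t \<longleftrightarrow> \<not> inverted w t"
    using inverted_mult[of t w t] inverted_self[of t] assms by simp
  ultimately show ?thesis using inverted_iff[of "t \<otimes> w" t] inverted_iff[of w t] assms by auto
qed

lemma len_inv: "w \<in> carrier W \<Longrightarrow> len W (inv w) = len W w"
proof -
  have le: "len W (inv w) \<le> len W w" if w: "w \<in> carrier W" for w
  proof -
    obtain ss where ss: "reduced_word W ss w" using ex_reduced_word w by blast
    note r = reduced_wordD[OF ss]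
    then have "len W (word_prod W (rev ss)) \<le> length (rev ss)" by (intro len_le) simp
    with r show ?thesis by (simp add: word_prod_rev)
  qed
  assume "w \<in> carrier W"
  then show ?thesis using le[of w] le[of "inv w"] by simp
qed

section \<open>Bruhat order\<close>

definition bruhat_step :: "'w \<Rightarrow> 'w \<Rightarrow> bool" where
  "bruhat_step x y \<longleftrightarrow> x \<in> carrier W \<and> (\<exists>t\<in>reflections W. y = x \<otimes> t \<and> len W x < len W y)"

lemma bruhat_le_alt: "bruhat_le W = rtranclp bruhat_step"
  unfolding bruhat_le_def bruhat_step_def by (rule refl)

text \<open>Reflections are stable under conjugation, so xt = (x t x^{-1}) x and a reflection may be
  moved to the other side.\<close>

lemma bruhat_step_left:
  "bruhat_step x y \<longleftrightarrow> x \<in> carrier W \<and> (\<exists>t\<in>reflections W. y = t \<otimes> x \<and> len W x < len W y)"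
proof -
  have "\<exists>t'\<in>reflections W. x \<otimes> t = t' \<otimes> x" if "x \<in> carrier W" "t \<in> reflections W" for t
    using refl_conj[OF that] that by (intro bexI[of _ "x \<otimes> t \<otimes> inv x"]) (auto simp: m_assoc)
  moreover have "\<exists>t'\<in>reflections W. t \<otimes> x = x \<otimes> t'" if "x \<in> carrier W" "t \<in> reflections W" for t
    using refl_conj[of "inv x" t] that
    by (intro bexI[of _ "inv x \<otimes> t \<otimes> x"]) (auto simp: m_assoc[symmetric])
  ultimately show ?thesis unfolding bruhat_step_def by metis
qed

lemma bruhat_step_carrier: "bruhat_step x y \<Longrightarrow> x \<in> carrier W \<and> y \<in> carrier W"
  by (auto simp: bruhat_step_def)

lemma bruhat_step_inv: "bruhat_step x y \<Longrightarrow> bruhat_step (inv x) (inv y)"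
proof -
  assume *: "bruhat_step x y"
  then obtain t where "x \<in> carrier W" "t \<in> reflections W" "y = x \<otimes> t" "len W x < len W y"
    by (auto simp: bruhat_step_def)
  then show ?thesis unfolding bruhat_step_left
    using len_inv[of x] len_inv[of "x \<otimes> t"] by (auto intro!: bexI[of _ t] simp: inv_mult_group)
qed

lemma bruhat_refl [simp]: "bruhat_le W x x"
  by (simp add: bruhat_le_alt)

lemma bruhat_trans: "bruhat_le W x y \<Longrightarrow> bruhat_le W y z \<Longrightarrow> bruhat_le W x z"
  by (simp add: bruhat_le_alt)

lemma bruhat_carrier: "bruhat_le W x y \<Longrightarrow> x \<in> carrier W \<longleftrightarrow> y \<in> carrier W"
  unfolding bruhat_le_alt
  by (induction rule: rtranclp_induct) (auto dest: bruhat_step_carrier)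

lemma bruhat_len: "bruhat_le W x y \<Longrightarrow> x = y \<or> len W x < len W y"
  unfolding bruhat_le_alt
  by (induction rule: rtranclp_induct) (auto simp: bruhat_step_def)

lemma bruhat_le_len: "bruhat_le W x y \<Longrightarrow> len W x \<le> len W y"
  using bruhat_len by fastforce

lemma bruhat_inv: "bruhat_le W x y \<Longrightarrow> bruhat_le W (inv x) (inv y)"
  unfolding bruhat_le_alt
  by (induction rule: rtranclp_induct) (auto intro: bruhat_step_inv rtranclp.rtrancl_into_rtrancl)

lemma bruhat_step_simple:
  "s \<in> S \<Longrightarrow> x \<in> carrier W \<Longrightarrow> len W x < len W (s \<otimes> x) \<Longrightarrow> bruhat_le W x (s \<otimes> x)"
  unfolding bruhat_le_alt
  by (rule r_into_rtranclp) (auto simp: bruhat_step_left intro: S_refl)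

text \<open>Write y = tx. If t = s, then y = sx. Otherwise sts takes sy to sx, and by the cocycle
  rule it is an inversion of sy, because t is an inversion of y and sts differs from s.\<close>

lemma bruhat_step_lift:
  assumes "bruhat_step x y" "s \<in> S"
  shows "s \<otimes> x = y \<or> bruhat_step (s \<otimes> x) (s \<otimes> y)"
proof (rule disjCI)
  assume "\<not> bruhat_step (s \<otimes> x) (s \<otimes> y)"
  moreover obtain t where t: "x \<in> carrier W" "t \<in> reflections W" "y = t \<otimes> x" "len W x < len W y"
    using assms(1) by (auto simp: bruhat_step_left)
  have tt: "t \<otimes> (t \<otimes> x) = x" using t by (metis l_one m_assoc refl_carrier refl_sq)
  let ?t = "s \<otimes> t \<otimes> s"
  have r: "?t \<in> reflections W" using refl_conj[of s t] t assms(2) by simp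
  have "bruhat_step (s \<otimes> x) (s \<otimes> y)" if "s \<noteq> t"
  proof -
    have "inverted (s \<otimes> y) ?t \<longleftrightarrow> inverted s ?t \<noteq> inverted y (s \<otimes> ?t \<otimes> s)"
      using inverted_mult[of s y ?t] t assms by simp
    moreover have "s \<otimes> ?t \<otimes> s = t" using t assms by (simp add: m_assoc)
    moreover have "\<not> inverted s ?t"
      using that t assms by (simp add: inverted_simple) (metis S_carrier S_sq S_sq_left \<open>s \<otimes> ?t \<otimes> s = t\<close> l_one)
    moreover have "inverted y t" using inverted_iff[of y t] t tt by simp
    ultimately have "inverted (s \<otimes> y) ?t" by simp
    moreover have "?t \<otimes> (s \<otimes> y) = s \<otimes> x" using t tt assms by (simp add: m_assoc)
    ultimately have "len W (s \<otimes> x) < len W (s \<otimes> y)"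
      using inverted_len[of "s \<otimes> y" ?t] t assms by simp
    moreover have "s \<otimes> y = ?t \<otimes> (s \<otimes> x)" using t assms by (simp add: m_assoc)
    ultimately show ?thesis using r t assms unfolding bruhat_step_left by auto
  qed
  ultimately show "s \<otimes> x = y" using t by auto
qed

text \<open>Move s along the chain from x to y: each step is either carried over by s or is
  multiplication by s itself, and in the latter case the rest of the chain already leads from sx to
  y.\<close>

lemma bruhat_lift1:
  assumes "bruhat_le W x y" "s \<in> S"
  shows "bruhat_le W (s \<otimes> x) y \<or> bruhat_le W (s \<otimes> x) (s \<otimes> y)"
  using assms(1) unfolding bruhat_le_alt
proof (induction rule: converse_rtranclp_induct)
  case (step x z)
  then show ?case using bruhat_step_lift[OF step(1) assms(2)]
    by (metis converse_rtranclp_into_rtranclp)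
qed simp

lemma bruhat_lift2:
  assumes "bruhat_le W x y" "s \<in> S"
  shows "bruhat_le W x (s \<otimes> y) \<or> bruhat_le W (s \<otimes> x) (s \<otimes> y)"
  using assms(1) unfolding bruhat_le_alt
proof (induction rule: rtranclp_induct)
  case (step z y)
  have "s \<otimes> y = z" if "s \<otimes> z = y"
    using that bruhat_step_carrier[OF step(2)] assms by auto
  then show ?case using step bruhat_step_lift[OF step(2) assms(2)]
    by (metis rtranclp.rtrancl_into_rtrancl)
qed simp

lemma len_simple_neq: "s \<in> S \<Longrightarrow> w \<in> carrier W \<Longrightarrow> len W (s \<otimes> w) \<noteq> len W w"
  by (rule len_refl_neq) (auto intro: S_refl)

text \<open>Both alternatives of \<open>bruhat_lift1\<close> end below y, since s is a left descent
  of y and so sy lies below y.\<close>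

lemma bruhat_lift_up:
  assumes "bruhat_le W x y" "s \<in> S" "y \<in> carrier W" "len W (s \<otimes> y) < len W y"
  shows "bruhat_le W (s \<otimes> x) y"
  using bruhat_lift1[OF assms(1,2)] bruhat_step_simple[of s "s \<otimes> y"] assms
  by (auto intro: bruhat_trans)

lemma bruhat_lift_down:
  assumes "bruhat_le W x y" "s \<in> S" "x \<in> carrier W" "len W x < len W (s \<otimes> x)"
  shows "bruhat_le W x (s \<otimes> y)"
  using bruhat_lift2[OF assms(1,2)] bruhat_step_simple[of s x] assms
  by (auto intro: bruhat_trans)

section \<open>The operators s * - and the Bruhat order\<close>

lemma bruhat_less_simple:
  assumes "s \<in> S" "w \<in> carrier W"
  shows "bruhat_less W w (s \<otimes> w) \<longleftrightarrow> len W w < len W (s \<otimes> w)"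
  using bruhat_len[of w "s \<otimes> w"] bruhat_step_simple[of s w] assms
  by (auto simp: bruhat_less_def)

lemma simple_star_alt:
  assumes "s \<in> S" "w \<in> carrier W"
  shows "simple_star W s w = (if len W w < len W (s \<otimes> w) then s \<otimes> w else w)"
  using assms by (simp add: simple_star_def bruhat_less_simple)

lemma simple_star_carrier [simp]: "s \<in> S \<Longrightarrow> w \<in> carrier W \<Longrightarrow> simple_star W s w \<in> carrier W"
  by (simp add: simple_star_alt)

lemma simple_star_ge: "s \<in> S \<Longrightarrow> w \<in> carrier W \<Longrightarrow> bruhat_le W w (simple_star W s w)"
  by (simp add: simple_star_alt bruhat_step_simple)

lemma simple_star_mono:
  assumes "bruhat_le W x y" "s \<in> S" "x \<in> carrier W"
  shows "bruhat_le W (simple_star W s x) (simple_star W s y)"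
proof -
  have y: "y \<in> carrier W" using assms bruhat_carrier by blast
  consider "len W y < len W (s \<otimes> y)" | "len W (s \<otimes> y) < len W y"
    using len_simple_neq assms y by (meson linorder_neqE_nat)
  then show ?thesis
  proof cases
    case 1
    then have "bruhat_le W y (s \<otimes> y)" using bruhat_step_simple assms y by blast
    then show ?thesis using 1 assms y bruhat_lift1[OF assms(1,2)]
      by (auto simp: simple_star_alt intro: bruhat_trans)
  next
    case 2
    then show ?thesis using assms y bruhat_lift_up[OF assms(1,2)]
      by (auto simp: simple_star_alt)
  qed
qed

end

text \<open>The product set of the parabolic subgroups is the support of a Bott-Samelson bimodule:
  it contains every twist of a nonzero functional (\<open>tensor_functional_support\<close>), and
  each of its elements is the twist of an evaluation.\<close>

primrec path_set :: "('w, 'z) coxeter_scheme \<Rightarrow> 'w set list \<Rightarrow> 'w set" where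
  "path_set W [] = {\<one>\<^bsub>W\<^esub>}"
| "path_set W (I # Is) = {u \<otimes>\<^bsub>W\<^esub> y | u y. u \<in> parabolic W I \<and> y \<in> path_set W Is}"

context coxeter_group
begin

section \<open>Parabolic subgroups and double cosets\<close>

lemma parabolic_induct_left:
  assumes "I \<subseteq> S" "u \<in> parabolic W I" "x \<in> carrier W" "Q x"
    and "\<And>s x. s \<in> I \<Longrightarrow> x \<in> carrier W \<Longrightarrow> Q x \<Longrightarrow> Q (s \<otimes> x)"
  shows "Q (u \<otimes> x)"
proof -
  obtain ss where ss: "set ss \<subseteq> I" "word_prod W ss = u" using parabolic_words assms(1,2) by blast
  from ss(1) have "Q (word_prod W ss \<otimes> x)"
  proof (induction ss)
    case Nil
    then show ?case using assms(3,4) by simp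
  next
    case (Cons s ss)
    moreover have "set ss \<subseteq> S" "s \<in> S" using Cons.prems assms(1) by auto
    ultimately show ?case using assms(3) assms(5)[of s "word_prod W ss \<otimes> x"] by (simp add: m_assoc)
  qed
  with ss show ?thesis by simp
qed

lemma parabolic_induct_right:
  assumes "I \<subseteq> S" "u \<in> parabolic W I" "x \<in> carrier W" "Q x"
    and step: "\<And>s x. s \<in> I \<Longrightarrow> x \<in> carrier W \<Longrightarrow> Q x \<Longrightarrow> Q (x \<otimes> s)"
  shows "Q (x \<otimes> u)"
proof -
  have u: "u \<in> carrier W" "inv u \<in> parabolic W I"
    using assms parabolic_carrier subgroup.m_inv_closed[OF parabolic_subgroup] by auto
  have "Q (inv (inv u \<otimes> inv x))"
  proof (rule parabolic_induct_left[where Q = "\<lambda>y. Q (inv y)", OF assms(1) u(2)])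
    fix s y assume "s \<in> I" "y \<in> carrier W" "Q (inv y)"
    moreover from this have "s \<in> S" using assms(1) by blast
    ultimately show "Q (inv (s \<otimes> y))" using step[of s "inv y"] by (simp add: inv_mult_group)
  qed (use assms in simp_all)
  then show ?thesis using u assms(3) by (simp add: inv_mult_group)
qed

lemma double_cosets_iff:
  "p \<in> double_cosets W I J \<longleftrightarrow>
    (\<exists>x\<in>carrier W. p = {u \<otimes> x \<otimes> v | u v. u \<in> parabolic W I \<and> v \<in> parabolic W J})"
  unfolding double_cosets_def set_mult_def by (auto 0 3)

lemma parabolic_one: "\<one> \<in> parabolic W I"
  unfolding parabolic_def by (rule generate.one)

lemma parabolic_mult: "u \<in> parabolic W I \<Longrightarrow> v \<in> parabolic W I \<Longrightarrow> u \<otimes> v \<in> parabolic W I"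
  unfolding parabolic_def by (rule generate.eng)

lemma parabolic_inv: "I \<subseteq> S \<Longrightarrow> u \<in> parabolic W I \<Longrightarrow> inv u \<in> parabolic W I"
  using subgroup.m_inv_closed[OF parabolic_subgroup] by auto

lemma parabolic_empty: "parabolic W {} = {\<one>}"
  using parabolic_words[of "{}"] by auto

section \<open>Extremal elements of a double coset\<close>

context
  fixes I J p
  assumes I: "I \<subseteq> S" and J: "J \<subseteq> S" and p: "p \<in> double_cosets W I J"
begin

lemma double_coset_carrier: "y \<in> p \<Longrightarrow> y \<in> carrier W"
  using p parabolic_carrier[OF I] parabolic_carrier[OF J] unfolding double_cosets_iff by auto

lemma double_coset_nonempty: "p \<noteq> {}"
  using p parabolic_one unfolding double_cosets_iff by blast

lemma double_coset_closed:
  assumes "y \<in> p" "u \<in> parabolic W I" "v \<in> parabolic W J"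
  shows "u \<otimes> y \<otimes> v \<in> p"
proof -
  obtain x where x: "x \<in> carrier W"
      "p = {u \<otimes> x \<otimes> v | u v. u \<in> parabolic W I \<and> v \<in> parabolic W J}"
    using p unfolding double_cosets_iff by blast
  with assms obtain a b where *: "y = a \<otimes> x \<otimes> b" "a \<in> parabolic W I" "b \<in> parabolic W J" by blast
  then have "u \<otimes> y \<otimes> v = (u \<otimes> a) \<otimes> x \<otimes> (b \<otimes> v)"
    using assms x parabolic_carrier[OF I] parabolic_carrier[OF J] by (simp add: m_assoc)
  with x * assms parabolic_mult show ?thesis by blast
qed

lemma double_coset_closed_left: "y \<in> p \<Longrightarrow> u \<in> parabolic W I \<Longrightarrow> u \<otimes> y \<in> p"
  using double_coset_closed[of y u \<one>] parabolic_one double_coset_carrier parabolic_carrier[OF I]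
  by simp

lemma double_coset_closed_right: "y \<in> p \<Longrightarrow> v \<in> parabolic W J \<Longrightarrow> y \<otimes> v \<in> p"
  using double_coset_closed[of y \<one> v] parabolic_one double_coset_carrier by simp

lemma double_coset_connected:
  assumes "y \<in> p" "z \<in> p"
  shows "\<exists>u\<in>parabolic W I. \<exists>v\<in>parabolic W J. z = u \<otimes> y \<otimes> v"
proof -
  obtain x where x: "x \<in> carrier W"
      "p = {u \<otimes> x \<otimes> v | u v. u \<in> parabolic W I \<and> v \<in> parabolic W J}"
    using p unfolding double_cosets_iff by blast
  from assms x obtain a b where y: "y = a \<otimes> x \<otimes> b" "a \<in> parabolic W I" "b \<in> parabolic W J" by blast
  from assms x obtain c d where z: "z = c \<otimes> x \<otimes> d" "c \<in> parabolic W I" "d \<in> parabolic W J" by blast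
  have "z = (c \<otimes> inv a) \<otimes> y \<otimes> (inv b \<otimes> d)"
    using x y z parabolic_carrier[OF I] parabolic_carrier[OF J] by (simp add: m_assoc)
  moreover have "c \<otimes> inv a \<in> parabolic W I" "inv b \<otimes> d \<in> parabolic W J"
    using y z parabolic_mult parabolic_inv I J by auto
  ultimately show ?thesis by blast
qed

lemma double_coset_finite:
  assumes "finite (parabolic W I)" "finite (parabolic W J)"
  shows "finite p"
proof -
  obtain x where x: "p = {u \<otimes> x \<otimes> v | u v. u \<in> parabolic W I \<and> v \<in> parabolic W J}"
    using p unfolding double_cosets_iff by blast
  then have "p = (\<lambda>(u, v). u \<otimes> x \<otimes> v) ` (parabolic W I \<times> parabolic W J)" by auto
  then show ?thesis using assms by simp
qed

text \<open>A longest element P has all of I as left and all of J as right descents, so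
  multiplication by generators never leaves the set of elements below P. It matters that x need not
  lie in p: \<open>path_set_lower\<close> applies this to the minimal element of another
  coset.\<close>

lemma bruhat_le_double_coset:
  assumes P: "P \<in> p" "\<forall>y\<in>p. len W y \<le> len W P" and x: "bruhat_le W x P"
    and u: "u \<in> parabolic W I" and v: "v \<in> parabolic W J"
  shows "bruhat_le W (u \<otimes> x \<otimes> v) P"
proof -
  note [simp] = double_coset_carrier[OF P(1)]
  have xc: "x \<in> carrier W" using bruhat_carrier[OF x] by simp
  have "bruhat_le W (s \<otimes> y) P" if "s \<in> I" "bruhat_le W y P" for s y
  proof (rule bruhat_lift_up)
    show s: "s \<in> S" using that I by blast
    show "len W (s \<otimes> P) < len W P"
      using len_simple_neq[OF s, of P] P double_coset_closed_left[of P s] parabolic_incl[of s I] that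
      by (simp add: le_neq_implies_less)
  qed (use that in simp_all)
  then have ux: "bruhat_le W (u \<otimes> x) P"
    by (intro parabolic_induct_left[where Q = "\<lambda>y. bruhat_le W y P", OF I u xc x])
  have "bruhat_le W (y \<otimes> s) P" if "s \<in> J" "y \<in> carrier W" "bruhat_le W y P" for s y
  proof -
    have s: "s \<in> S" using that J by blast
    \<comment> \<open>Right multiplication is turned into left multiplication by inversion, which
      preserves lengths and the Bruhat order.\<close>
    have "bruhat_le W (s \<otimes> inv y) (inv P)"
    proof (rule bruhat_lift_up[OF bruhat_inv[OF that(3)] s])
      have "s \<otimes> inv P = inv (P \<otimes> s)" using s by (simp add: inv_mult_group)
      moreover have "len W (inv (P \<otimes> s)) = len W (P \<otimes> s)" "len W (inv P) = len W P"
        using s by (simp_all add: len_inv del: inv_mult_group)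
      moreover have "len W (P \<otimes> s) \<le> len W P"
        using P double_coset_closed_right[of P s] parabolic_incl[of s J] that by simp
      moreover have "len W (s \<otimes> inv P) \<noteq> len W (inv P)" using len_simple_neq[OF s] by simp
      ultimately show "len W (s \<otimes> inv P) < len W (inv P)" by simp
    qed simp
    from bruhat_inv[OF this] show ?thesis using s that by (simp add: inv_mult_group)
  qed
  moreover have "u \<otimes> x \<in> carrier W" using xc parabolic_carrier[OF I u] by simp
  ultimately show ?thesis
    by (intro parabolic_induct_right[where Q = "\<lambda>y. bruhat_le W y P", OF J v _ ux])
qed

text \<open>Dually, a shortest element m has no left descent in I and no right descent in J, so
  \<open>bruhat_lift_down\<close> applies at every step.\<close>

lemma bruhat_ge_double_coset:
  assumes m: "m \<in> p" "\<forall>y\<in>p. len W m \<le> len W y" and x: "bruhat_le W m x"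
    and u: "u \<in> parabolic W I" and v: "v \<in> parabolic W J"
  shows "bruhat_le W m (u \<otimes> x \<otimes> v)"
proof -
  note [simp] = double_coset_carrier[OF m(1)]
  have xc: "x \<in> carrier W" using bruhat_carrier[OF x] by simp
  have "bruhat_le W m (s \<otimes> y)" if "s \<in> I" "bruhat_le W m y" for s y
  proof (rule bruhat_lift_down)
    show s: "s \<in> S" using that I by blast
    show "len W m < len W (s \<otimes> m)"
      using len_simple_neq[OF s, of m] m double_coset_closed_left[of m s] parabolic_incl[of s I] that
      by (simp add: le_neq_implies_less)
  qed (use that in simp_all)
  then have ux: "bruhat_le W m (u \<otimes> x)"
    by (intro parabolic_induct_left[where Q = "\<lambda>y. bruhat_le W m y", OF I u xc x])
  have "bruhat_le W m (y \<otimes> s)" if "s \<in> J" "y \<in> carrier W" "bruhat_le W m y" for s y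
  proof -
    have s: "s \<in> S" using that J by blast
    have "bruhat_le W (inv m) (s \<otimes> inv y)"
    proof (rule bruhat_lift_down[OF bruhat_inv[OF that(3)] s])
      have "s \<otimes> inv m = inv (m \<otimes> s)" using s by (simp add: inv_mult_group)
      moreover have "len W (inv (m \<otimes> s)) = len W (m \<otimes> s)" "len W (inv m) = len W m"
        using s by (simp_all add: len_inv)
      moreover have "len W m \<le> len W (m \<otimes> s)"
        using m double_coset_closed_right[of m s] parabolic_incl[of s J] that by simp
      moreover have "len W (s \<otimes> inv m) \<noteq> len W (inv m)" using len_simple_neq[OF s] by simp
      ultimately show "len W (inv m) < len W (s \<otimes> inv m)" by simp
    qed simp
    from bruhat_inv[OF this] show ?thesis using s that by (simp add: inv_mult_group)
  qed
  moreover have "u \<otimes> x \<in> carrier W" using xc parabolic_carrier[OF I u] by simp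
  ultimately show ?thesis
    by (intro parabolic_induct_right[where Q = "\<lambda>y. bruhat_le W m y", OF J v _ ux])
qed

lemma bruhat_max_double_coset:
  assumes P: "P \<in> p" "\<forall>y\<in>p. len W y \<le> len W P" and "y \<in> p"
  shows "bruhat_le W y P"
proof -
  obtain u v where "u \<in> parabolic W I" "v \<in> parabolic W J" "y = u \<otimes> P \<otimes> v"
    using double_coset_connected assms by meson
  then show ?thesis using bruhat_le_double_coset[OF P bruhat_refl] by simp
qed

lemma bruhat_min_double_coset:
  assumes m: "m \<in> p" "\<forall>y\<in>p. len W m \<le> len W y" and "y \<in> p"
  shows "bruhat_le W m y"
proof -
  obtain u v where "u \<in> parabolic W I" "v \<in> parabolic W J" "y = u \<otimes> m \<otimes> v"
    using double_coset_connected assms by meson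
  then show ?thesis using bruhat_ge_double_coset[OF m bruhat_refl] by simp
qed

text \<open>A longest element dominates p in the Bruhat order, so a second one of the same length
  equals it; this makes the \<open>THE\<close> in \<open>max_elt\<close> legitimate.\<close>

lemma max_elt_double_coset:
  assumes "finite p"
  shows "max_elt W p \<in> p \<and> (\<forall>y\<in>p. len W y \<le> len W (max_elt W p))"
  unfolding max_elt_def
proof (rule theI')
  have "Max (len W ` p) \<in> len W ` p" using assms double_coset_nonempty by (intro Max_in) auto
  then obtain P where "P \<in> p" "len W P = Max (len W ` p)" by auto
  then have P: "P \<in> p" "\<forall>y\<in>p. len W y \<le> len W P" using assms by auto
  show "\<exists>!x. x \<in> p \<and> (\<forall>y\<in>p. len W y \<le> len W x)"
  proof (rule ex1I[of _ P])
    show "P \<in> p \<and> (\<forall>y\<in>p. len W y \<le> len W P)" using P by blast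
    fix x assume x: "x \<in> p \<and> (\<forall>y\<in>p. len W y \<le> len W x)"
    then show "x = P" using bruhat_len[OF bruhat_max_double_coset[OF P, of x]] P leD by blast
  qed
qed

lemma min_elt_double_coset:
  "min_elt W p \<in> p \<and> (\<forall>y\<in>p. len W (min_elt W p) \<le> len W y)"
  unfolding min_elt_def
proof (rule theI')
  obtain m where m: "m \<in> p" "\<forall>y\<in>p. len W m \<le> len W y"
    using double_coset_nonempty ex_has_least_nat[of "\<lambda>y. y \<in> p" _ "len W"] by blast
  show "\<exists>!x. x \<in> p \<and> (\<forall>y\<in>p. len W x \<le> len W y)"
  proof (rule ex1I[of _ m])
    show "m \<in> p \<and> (\<forall>y\<in>p. len W m \<le> len W y)" using m by blast
    fix x assume x: "x \<in> p \<and> (\<forall>y\<in>p. len W x \<le> len W y)"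
    then show "x = m" using bruhat_len[OF bruhat_min_double_coset[OF m, of x]] m leD by blast
  qed
qed

end

lemma double_coset_eq:
  assumes I: "I \<subseteq> S" and J: "J \<subseteq> S" and "p \<in> double_cosets W I J" "q \<in> double_cosets W I J"
    and y: "y \<in> p" "y \<in> q"
  shows "p = q"
proof -
  have "p \<subseteq> q" if pq: "p \<in> double_cosets W I J" "q \<in> double_cosets W I J" "y \<in> p" "y \<in> q" for p q
  proof
    fix z assume "z \<in> p"
    then obtain u v where "u \<in> parabolic W I" "v \<in> parabolic W J" "z = u \<otimes> y \<otimes> v"
      using double_coset_connected[OF I J pq(1) pq(3)] by blast
    then show "z \<in> q" using double_coset_closed[OF I J pq(2) pq(4)] by simp
  qed
  with assms show ?thesis by blast
qed

section \<open>Longest elements and reduced words in parabolic subgroups\<close>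

lemma finitaryD: "finitary W I \<Longrightarrow> I \<subseteq> S" "finitary W I \<Longrightarrow> finite (parabolic W I)"
  by (auto simp: finitary_def)

text \<open>W_I is the double coset of 1 for the pair of I and the empty set, so the results on
  double cosets apply.\<close>

lemma longest:
  assumes "finitary W I"
  shows "longest W I \<in> parabolic W I \<and> (\<forall>y\<in>parabolic W I. len W y \<le> len W (longest W I))"
proof -
  have "u \<otimes> \<one> \<otimes> \<one> = u" if "u \<in> parabolic W I" for u
    using parabolic_carrier[OF finitaryD(1)[OF assms] that] by simp
  then have "{u \<otimes> \<one> \<otimes> v | u v. u \<in> parabolic W I \<and> v \<in> parabolic W {}} = parabolic W I"
    unfolding parabolic_empty by force
  then have "parabolic W I \<in> double_cosets W I {}"
    unfolding double_cosets_iff by (intro bexI[of _ \<one>]) simp_all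
  then show ?thesis unfolding longest_def
    using max_elt_double_coset[of I "{}"] finitaryD[OF assms] by blast
qed

lemma longest_carrier: "finitary W I \<Longrightarrow> longest W I \<in> carrier W"
  using longest parabolic_carrier finitaryD by blast

lemma len_simple_le:
  assumes "s \<in> S" "w \<in> carrier W"
  shows "len W (s \<otimes> w) \<le> Suc (len W w)"
proof -
  obtain ss where "reduced_word W ss w" using ex_reduced_word assms(2) by blast
  note r = reduced_wordD[OF this]
  have "len W (word_prod W (s # ss)) \<le> length (s # ss)" using r assms(1) by (intro len_le) simp
  with r show ?thesis by simp
qed

text \<open>Prepending a letter s either lengthens the element, and then the longer word is reduced,
  or s is an inversion and exchange deletes a letter. No letter outside I is ever
  introduced.\<close>

lemma parabolic_reduced_word_exists:
  assumes "I \<subseteq> S" "set ss \<subseteq> I"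
  shows "\<exists>us. set us \<subseteq> I \<and> reduced_word W us (word_prod W ss)"
  using assms(2)
proof (induction ss)
  case Nil
  have "len W (word_prod W []) = 0" using len_le[of "[]"] by simp
  then show ?case by (intro exI[of _ "[]"]) (simp add: reduced_word_def)
next
  case (Cons s ss)
  then obtain us where us: "set us \<subseteq> I" "reduced_word W us (word_prod W ss)" by auto
  define w where "w = word_prod W ss"
  note r = reduced_wordD[OF us(2), folded w_def]
  have w: "w \<in> carrier W" and s: "s \<in> S" using r Cons.prems assms by auto
  show ?case
  proof (cases "len W (s \<otimes> w) < len W w")
    case False
    then have "len W w < len W (s \<otimes> w)" using len_simple_neq[OF s w] by simp
    moreover have "len W (word_prod W (s # us)) \<le> length (s # us)"
      using r s by (intro len_le) simp
    ultimately have "reduced_word W (s # us) (s \<otimes> w)" using r s by (simp add: reduced_word_def)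
    then show ?thesis using us Cons.prems by (intro exI[of _ "s # us"]) (simp add: w_def)
  next
    case True
    then have "inverted w s" using inverted_iff[OF w S_refl[OF s]] by simp
    then have "refl_parity us s" using inverted_word[of us s] r s by simp
    then obtain as b cs where *: "us = as @ b # cs" "s \<otimes> word_prod W us = word_prod W (as @ cs)"
      using exchange[of us s] r s by auto
    have "len W (s \<otimes> (s \<otimes> w)) \<le> Suc (len W (s \<otimes> w))"
      using s w by (intro len_simple_le) simp_all
    then have "len W w \<le> Suc (len W (s \<otimes> w))" using s w by simp
    moreover have "len W (s \<otimes> w) \<le> length (as @ cs)"
      using len_le[of "as @ cs"] * r by simp
    ultimately have "reduced_word W (as @ cs) (s \<otimes> w)"
      using * r by (simp add: reduced_word_def)
    then show ?thesis using us * by (intro exI[of _ "as @ cs"]) (simp add: w_def)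
  qed
qed

text \<open>Needed because \<open>star\<close> uses an arbitrary reduced word of w_I. Exchange in a
  second word, one over I, shows that removing the first letter s stays in W_I; hence s lies in W_I,
  and a simple reflection in W_I belongs to I.\<close>

lemma parabolic_reduced_word:
  assumes I: "I \<subseteq> S" and "reduced_word W ss w" "w \<in> parabolic W I"
  shows "set ss \<subseteq> I"
  using assms(2,3)
proof (induction ss arbitrary: w)
  case (Cons s ss)
  note r = reduced_wordD[OF Cons.prems(1)]
  define v where "v = word_prod W ss"
  have s: "s \<in> S" and v: "v \<in> carrier W" and w: "w = s \<otimes> v" using r by (auto simp: v_def)
  have sw: "s \<otimes> w = v" using s v w by simp
  have lv: "len W v \<le> length ss" using len_le[of ss] r by (simp add: v_def)
  have "len W w \<le> Suc (len W v)" unfolding w using s v by (rule len_simple_le)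
  then have red: "reduced_word W ss v" using r lv by (simp add: reduced_word_def v_def)
  have "inverted w s" using inverted_iff[of w s] S_refl[OF s] s v sw w lv r by simp
  moreover obtain us where us: "set us \<subseteq> I" "reduced_word W us w"
    using parabolic_reduced_word_exists[OF I] parabolic_words[OF I] Cons.prems by metis
  ultimately have "refl_parity us s" using inverted_word[of us s] reduced_wordD[OF us(2)] s by simp
  then obtain as b cs where "us = as @ b # cs" "s \<otimes> word_prod W us = word_prod W (as @ cs)"
    using exchange[of us s] reduced_wordD[OF us(2)] s by auto
  then have "set (as @ cs) \<subseteq> I" "word_prod W (as @ cs) = v"
    using us reduced_wordD[OF us(2)] sw by auto
  then have vI: "v \<in> parabolic W I" using parabolic_words[OF I] by blast
  have "s = w \<otimes> inv v" using w s v by (simp add: m_assoc)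
  then have "s \<in> parabolic W I" using vI Cons.prems parabolic_mult parabolic_inv[OF I] by simp
  \<comment> \<open>A reduced word of s over I has exactly one letter, and this letter is s.\<close>
  then obtain ts where ts: "set ts \<subseteq> I" "reduced_word W ts s"
    using parabolic_reduced_word_exists[OF I] parabolic_words[OF I] by metis
  have "length ts \<le> 1" using reduced_wordD(3)[OF ts(2)] len_le[of "[s]"] s by simp
  moreover have "ts \<noteq> []" using reduced_wordD(2)[OF ts(2)] S_not_one[OF s] by auto
  ultimately obtain t where "ts = [t]" by (cases ts) auto
  then have "s \<in> I" using ts reduced_wordD[OF ts(2)] I by auto
  with Cons.IH[OF red vI] show ?case by simp
qed simp

section \<open>Star products of longest elements\<close>

lemma foldr_star_carrier: "set ss \<subseteq> S \<Longrightarrow> x \<in> carrier W \<Longrightarrow> foldr (simple_star W) ss x \<in> carrier W"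
  by (induction ss) auto

lemma foldr_star_mono:
  "set ss \<subseteq> S \<Longrightarrow> x \<in> carrier W \<Longrightarrow> bruhat_le W x y \<Longrightarrow>
    bruhat_le W (foldr (simple_star W) ss x) (foldr (simple_star W) ss y)"
  by (induction ss) (auto intro!: simple_star_mono foldr_star_carrier)

lemma foldr_star_ge:
  "set ss \<subseteq> S \<Longrightarrow> x \<in> carrier W \<Longrightarrow> bruhat_le W x (foldr (simple_star W) ss x)"
  by (induction ss) (auto intro: simple_star_ge foldr_star_carrier bruhat_trans)

text \<open>The operator s * - is monotone and dominates left multiplication by s.\<close>

lemma word_prod_le_foldr_star:
  "set ss \<subseteq> S \<Longrightarrow> bruhat_le W (word_prod W ss) (foldr (simple_star W) ss \<one>)"
proof (induction ss)
  case (Cons s ss)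
  then have "bruhat_le W (simple_star W s (word_prod W ss))
      (simple_star W s (foldr (simple_star W) ss \<one>))"
    by (intro simple_star_mono) auto
  moreover have "bruhat_le W (s \<otimes> word_prod W ss) (simple_star W s (word_prod W ss))"
  proof -
    have *: "s \<in> S" "word_prod W ss \<in> carrier W" using Cons.prems by auto
    then show ?thesis
      using bruhat_step_simple[of s "s \<otimes> word_prod W ss"] len_simple_neq[of s "word_prod W ss"]
      by (auto simp: simple_star_alt)
  qed
  ultimately show ?case using bruhat_trans by simp
qed simp

lemma bruhat_one_le:
  assumes "x \<in> carrier W"
  shows "bruhat_le W \<one> x"
proof -
  have "set ss \<subseteq> S \<Longrightarrow> bruhat_le W \<one> (word_prod W ss)" for ss
  proof (induction ss)
    case (Cons s ss)
    have "len W \<one> = 0" using len_le[of "[]"] by simp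
    then have "len W \<one> < len W (s \<otimes> \<one>)" using len_simple_neq[of s \<one>] Cons.prems by simp
    then show ?case using Cons by (auto intro: bruhat_lift_down)
  qed simp
  then show ?thesis using ex_word[OF assms] by blast
qed

context
  fixes I x
  assumes I: "I \<subseteq> S" and x: "x \<in> carrier W"
    and min: "\<And>v. v \<in> parabolic W I \<Longrightarrow> len W x \<le> len W (v \<otimes> x)"
begin

text \<open>If x is shortest in W_I x, no reflection in W_I is an inversion of x; by the cocycle
  rule s is then an inversion of ux exactly when it is one of u.\<close>

lemma minimal_coset_len:
  assumes s: "s \<in> I" and u: "u \<in> parabolic W I"
  shows "len W (u \<otimes> x) < len W (s \<otimes> (u \<otimes> x)) \<longleftrightarrow> len W u < len W (s \<otimes> u)"
proof -
  have uc: "u \<in> carrier W" using u I by (rule parabolic_carrier[rotated])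
  have sS: "s \<in> S" using s I by blast
  let ?t = "inv u \<otimes> s \<otimes> u"
  have "?t \<in> parabolic W I" using s u I parabolic_mult parabolic_inv parabolic_incl by metis
  then have "\<not> len W (?t \<otimes> x) < len W x" using min by (simp add: not_less)
  moreover have t: "?t \<in> reflections W" using refl_conj[of "inv u" s] uc S_refl[OF sS] by simp
  ultimately have "\<not> inverted x ?t" using inverted_iff[OF x t] by simp
  then have "inverted (u \<otimes> x) s = inverted u s" using inverted_mult[of u x s] uc sS x by simp
  moreover have "len W y < len W (s \<otimes> y) \<longleftrightarrow> \<not> inverted y s" if "y \<in> carrier W" for y
    using inverted_iff[OF that S_refl[OF sS]] len_simple_neq[OF sS that] by auto
  ultimately show ?thesis using uc x by simp
qed

text \<open>By \<open>minimal_coset_len\<close> each operator s * - with s in I makes the same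
  decision on ux as on u, so the factor x is carried along.\<close>

lemma minimal_coset_star:
  assumes "set ss \<subseteq> I" and u: "u \<in> parabolic W I"
  shows "foldr (simple_star W) ss u \<in> parabolic W I \<and>
    foldr (simple_star W) ss (u \<otimes> x) = foldr (simple_star W) ss u \<otimes> x"
  using assms(1)
proof (induction ss)
  case (Cons s ss)
  define v where "v = foldr (simple_star W) ss u"
  have v: "v \<in> parabolic W I" "foldr (simple_star W) ss (u \<otimes> x) = v \<otimes> x"
    using Cons by (auto simp: v_def)
  have s: "s \<in> I" "s \<in> S" using Cons.prems I by auto
  have vc: "v \<in> carrier W" by (rule parabolic_carrier[OF I v(1)])
  show ?case using s v vc x minimal_coset_len[OF s(1) v(1)] parabolic_mult parabolic_incl[OF s(1)]
    by (auto simp: simple_star_alt m_assoc simp flip: v_def)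
qed (use u in simp)

end

text \<open>For x0 shortest in W_I x one has w_I * x = w_I x0: the operators act on the factor in
  W_I, where they can only end at w_I. Since w_I has every s in I as a left descent, so has w_I
  x0.\<close>

lemma star_longest:
  assumes I: "finitary W I" and x: "x \<in> carrier W"
  defines "z \<equiv> star W (longest W I) x"
  shows "\<exists>u\<in>parabolic W I. z = u \<otimes> x" "bruhat_le W x z"
    and "\<And>s. s \<in> I \<Longrightarrow> len W (s \<otimes> z) < len W z"
proof -
  note IS = finitaryD(1)[OF I]
  note lc = longest_carrier[OF I]
  define ss where "ss = (SOME ss. reduced_word W ss (longest W I))"
  have "reduced_word W ss (longest W I)"
    unfolding ss_def using ex_reduced_word[OF lc] by (rule someI_ex)
  note r = reduced_wordD[OF this]
  have ss: "set ss \<subseteq> I"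
    using parabolic_reduced_word[OF IS \<open>reduced_word W ss (longest W I)\<close>] longest[OF I] by blast
  have z: "z = foldr (simple_star W) ss x" by (simp add: z_def star_def ss_def)
  show "bruhat_le W x z" unfolding z using r x by (intro foldr_star_ge) auto
  obtain x0 where x0: "x0 \<in> {u \<otimes> x | u. u \<in> parabolic W I}"
      "\<forall>y\<in>{u \<otimes> x | u. u \<in> parabolic W I}. len W x0 \<le> len W y"
  proof -
    have "\<one> \<otimes> x \<in> {u \<otimes> x | u. u \<in> parabolic W I}" using parabolic_one by blast
    from ex_has_least_nat[of "\<lambda>y. y \<in> {u \<otimes> x | u. u \<in> parabolic W I}", OF this, of "len W"]
    show ?thesis using that by blast
  qed
  then obtain a where a: "x0 = a \<otimes> x" "a \<in> parabolic W I" by blast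
  note ac = parabolic_carrier[OF IS a(2)]
  have x0c: "x0 \<in> carrier W" using a ac x by simp
  have min: "len W x0 \<le> len W (v \<otimes> x0)" if "v \<in> parabolic W I" for v
  proof -
    have "v \<otimes> x0 = (v \<otimes> a) \<otimes> x" using a ac x parabolic_carrier[OF IS that] by (simp add: m_assoc)
    then show ?thesis using x0(2) that a parabolic_mult by blast
  qed
  have xa: "x = inv a \<otimes> x0" using a ac x by simp
  define w where "w = foldr (simple_star W) ss (inv a)"
  have "inv a \<in> parabolic W I" using a parabolic_inv IS by simp
  then have w: "w \<in> parabolic W I" "z = w \<otimes> x0"
    unfolding w_def z xa using minimal_coset_star[OF IS x0c min ss] by auto
  \<comment> \<open>Started at 1 the operators of a word of w_I reach an element above w_I; by
    monotonicity this also holds when they start at a^{-1}. Nothing in W_I is longer, so w =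
    w_I.\<close>
  have "bruhat_le W (longest W I) w"
    unfolding w_def r(2)[symmetric] using r(1) ac
    by (intro bruhat_trans[OF word_prod_le_foldr_star foldr_star_mono[OF _ one_closed bruhat_one_le]])
      simp_all
  then have "longest W I = w" using bruhat_len longest[OF I] w leD by blast
  moreover have "len W (s \<otimes> longest W I) < len W (longest W I)" if "s \<in> I" for s
  proof -
    have "s \<in> S" using that IS by blast
    moreover have "s \<otimes> longest W I \<in> parabolic W I"
      using parabolic_mult parabolic_incl[OF that] longest[OF I] by blast
    ultimately show ?thesis using longest[OF I] len_simple_neq[of s "longest W I"] lc
      by (simp add: le_neq_implies_less)
  qed
  ultimately show "len W (s \<otimes> z) < len W z" if "s \<in> I" for s
    using minimal_coset_len[OF IS x0c min that w(1)] len_simple_neq[of s z] that IS w(2) x0c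
      parabolic_carrier[OF IS w(1)]
    by (metis m_closed nat_neq_iff order_less_asym subsetD)
  have "z = (w \<otimes> a) \<otimes> x" using w a ac x parabolic_carrier[OF IS w(1)] by (simp add: m_assoc)
  then show "\<exists>u\<in>parabolic W I. z = u \<otimes> x" using w a parabolic_mult by blast
qed

section \<open>Products of parabolic subgroups\<close>

lemma path_set_carrier:
  "\<forall>I\<in>set Is. I \<subseteq> S \<Longrightarrow> y \<in> path_set W Is \<Longrightarrow> y \<in> carrier W"
proof (induction Is arbitrary: y)
  case (Cons I Is)
  then obtain u z where "y = u \<otimes> z" "u \<in> parabolic W I" "z \<in> carrier W" by auto
  then show ?case using parabolic_carrier[of I u] Cons.prems by simp
qed simp

lemma path_setI: "u \<in> parabolic W I \<Longrightarrow> y \<in> path_set W Is \<Longrightarrow> u \<otimes> y \<in> path_set W (I # Is)"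
  by auto

text \<open>Every s in I is a left descent of w_I * z, so an element below z stays below w_I * z
  under multiplication by W_I.\<close>

lemma path_set_star:
  assumes "\<forall>I\<in>set Is. finitary W I"
  defines "z \<equiv> foldr (star W) (map (longest W) Is) \<one>"
  shows "z \<in> path_set W Is \<and> (\<forall>y\<in>path_set W Is. bruhat_le W y z)"
  using assms(1) unfolding z_def
proof (induction Is)
  case (Cons I Is)
  define z where "z = foldr (star W) (map (longest W) Is) \<one>"
  have IH: "z \<in> path_set W Is" "\<And>y. y \<in> path_set W Is \<Longrightarrow> bruhat_le W y z"
    using Cons by (auto simp: z_def)
  have I: "finitary W I" using Cons.prems by simp
  have IsS: "\<forall>I\<in>set Is. I \<subseteq> S" using Cons.prems finitaryD by auto
  have zc: "z \<in> carrier W" using path_set_carrier[OF IsS IH(1)] .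
  note st = star_longest[OF I zc]
  obtain u where u: "u \<in> parabolic W I" "star W (longest W I) z = u \<otimes> z" using st(1) by blast
  have uc: "u \<in> carrier W" using u parabolic_carrier finitaryD(1)[OF I] by blast
  have "bruhat_le W (v \<otimes> y) (star W (longest W I) z)"
    if v: "v \<in> parabolic W I" and y: "y \<in> path_set W Is" for v y
  proof (rule parabolic_induct_left[OF finitaryD(1)[OF I] v])
    show "y \<in> carrier W" using path_set_carrier[OF IsS y] .
    show "bruhat_le W y (star W (longest W I) z)" using IH(2)[OF y] st(2) bruhat_trans by blast
    fix s x assume "s \<in> I" "bruhat_le W x (star W (longest W I) z)"
    then show "bruhat_le W (s \<otimes> x) (star W (longest W I) z)"
      using st(3) u uc zc finitaryD(1)[OF I] by (intro bruhat_lift_up) auto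
  qed
  then show ?case using u IH(1) by (auto simp: z_def)
qed simp

lemma path_set_closed_left:
  assumes "I \<subseteq> S" "\<forall>I\<in>set Is. I \<subseteq> S" "u \<in> parabolic W I" "y \<in> path_set W (I # Is)"
  shows "u \<otimes> y \<in> path_set W (I # Is)"
proof -
  obtain v z where vz: "y = v \<otimes> z" "v \<in> parabolic W I" "z \<in> path_set W Is" using assms(4) by auto
  then have "u \<otimes> y = (u \<otimes> v) \<otimes> z"
    using assms parabolic_carrier[OF assms(1)] path_set_carrier[OF assms(2)] by (simp add: m_assoc)
  with path_setI[OF parabolic_mult[OF assms(3) vz(2)] vz(3)] show ?thesis by simp
qed

lemma path_set_closed_right:
  assumes "\<forall>I\<in>set Is. I \<subseteq> S" "Is \<noteq> []" "u \<in> parabolic W (last Is)" "y \<in> path_set W Is"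
  shows "y \<otimes> u \<in> path_set W Is"
  using assms
proof (induction Is arbitrary: y)
  case (Cons I Is)
  obtain v z where vz: "y = v \<otimes> z" "v \<in> parabolic W I" "z \<in> path_set W Is" using Cons.prems(4) by auto
  have c: "v \<in> carrier W" "z \<in> carrier W" "u \<in> carrier W"
    using vz Cons.prems parabolic_carrier[of I] parabolic_carrier[of "last (I # Is)" u]
      path_set_carrier[of Is z] last_in_set[of "I # Is"] by auto
  show ?case
  proof (cases "Is = []")
    case True
    then have "y = v" "u \<in> parabolic W I" using vz c Cons.prems by auto
    then show ?thesis using True vz(2) c path_setI[of "v \<otimes> u" I \<one> "[]"] parabolic_mult by simp
  next
    case False
    then have "z \<otimes> u \<in> path_set W Is" using Cons vz by simp
    moreover have "y \<otimes> u = v \<otimes> (z \<otimes> u)" using vz c by (simp add: m_assoc)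
    ultimately show ?thesis using path_setI[OF vz(2)] by simp
  qed
qed simp

lemma path_set_lower:
  assumes I: "finitary W I" and J: "finitary W J"
    and p: "p \<in> double_cosets W I J" and q: "q \<in> double_cosets W I J"
    and less: "coset_less W q p" and Ms: "expresses W I J Ms q" and w: "w \<in> p"
  shows "w \<notin> path_set W Ms"
proof
  assume wM: "w \<in> path_set W Ms"
  note IS = finitaryD(1)[OF I] and JS = finitaryD(1)[OF J]
  define P where "P = max_elt W p"
  define Q where "Q = max_elt W q"
  have P: "P \<in> p" "\<forall>y\<in>p. len W y \<le> len W P"
    unfolding P_def using max_elt_double_coset[OF IS JS p] double_coset_finite[OF IS JS p]
      finitaryD(2)[OF I] finitaryD(2)[OF J] by blast+
  have Q: "Q \<in> q" "\<forall>y\<in>q. len W y \<le> len W Q"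
    unfolding Q_def using max_elt_double_coset[OF IS JS q] double_coset_finite[OF IS JS q]
      finitaryD(2)[OF I] finitaryD(2)[OF J] by blast+
  have fin: "\<forall>I\<in>set Ms. finitary W I" and ne: "Ms \<noteq> []" and hd: "hd Ms = I" and la: "last Ms = J"
    and Qs: "Q = foldr (star W) (map (longest W) Ms) \<one>"
    using Ms by (auto simp: expresses_def expression_def Q_def)
  have sub: "\<forall>I\<in>set Ms. I \<subseteq> S" using fin finitaryD by blast
  obtain u v where uv: "u \<in> parabolic W I" "v \<in> parabolic W J" "P = u \<otimes> w \<otimes> v"
    using double_coset_connected[OF IS JS p w P(1)] by blast
  obtain Ms' where Ms': "Ms = I # Ms'" using ne hd by (cases Ms) auto
  \<comment> \<open>Stability under W_I on the left and W_J on the right carries w to the longest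
    element P of p, so P itself lies in the product set and hence below Q.\<close>
  have "u \<otimes> w \<in> path_set W Ms"
    using path_set_closed_left[of I Ms' u w] uv wM IS sub Ms' by simp
  then have "P \<in> path_set W Ms" using path_set_closed_right[OF sub ne] uv la by simp
  then have PQ: "bruhat_le W P Q" using path_set_star[OF fin] Qs by simp
  have "bruhat_le W (min_elt W q) (min_elt W p)" using less by (simp add: coset_less_def coset_le_def)
  moreover have "bruhat_le W (min_elt W p) P"
    using bruhat_max_double_coset[OF IS JS p P] min_elt_double_coset[OF IS JS p] by blast
  ultimately have "bruhat_le W (min_elt W q) P" by (rule bruhat_trans)
  \<comment> \<open>Conversely Q arises from the minimal element of q, which lies below P, by
    multiplication with W_I and W_J; this keeps it below P.\<close>
  moreover obtain a b where "a \<in> parabolic W I" "b \<in> parabolic W J" "Q = a \<otimes> min_elt W q \<otimes> b"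
    using double_coset_connected[OF IS JS q _ Q(1)] min_elt_double_coset[OF IS JS q] by meson
  ultimately have "bruhat_le W Q P" using bruhat_le_double_coset[OF IS JS p P] by simp
  with PQ have "P = Q" using bruhat_len bruhat_le_len leD by blast
  then have "p = q" using double_coset_eq[OF IS JS p q] P Q by simp
  then show False using less by (simp add: coset_less_def)
qed

lemma expresses_meets_path_set:
  assumes "expresses W I J Is p"
  shows "p \<inter> path_set W Is \<noteq> {}"
proof -
  have IJ: "finitary W I" "finitary W J" and fin: "\<forall>I\<in>set Is. finitary W I"
    and p: "p \<in> double_cosets W I J"
    using assms hd_in_set[of Is] last_in_set[of Is] by (auto simp: expresses_def expression_def)
  have "max_elt W p \<in> p"
    using max_elt_double_coset double_coset_finite p finitaryD IJ by meson
  moreover have "max_elt W p \<in> path_set W Is"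
    using path_set_star[OF fin] assms by (simp add: expresses_def)
  ultimately show ?thesis by blast
qed

text \<open>Factors from W_D with D contained in I are absorbed by W_I. The sets met while removing
  elements from I are of this kind.\<close>

lemma path_set_append_subset:
  assumes "I \<subseteq> S" "\<forall>D\<in>set Ds. D \<subseteq> I" "\<forall>K\<in>set Ks. K \<subseteq> S"
  shows "path_set W (Ds @ Ks) \<subseteq> path_set W (I # Ks)"
  using assms(2)
proof (induction Ds)
  case Nil
  then show ?case using parabolic_one path_set_carrier[OF assms(3)] by force
next
  case (Cons D Ds)
  show ?case
  proof
    fix y assume "y \<in> path_set W ((D # Ds) @ Ks)"
    then obtain u z where "y = u \<otimes> z" "u \<in> parabolic W D" "z \<in> path_set W (Ds @ Ks)"
      by auto
    moreover from this have "z \<in> path_set W (I # Ks)" using Cons by auto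
    moreover have "parabolic W D \<subseteq> parabolic W I" using Cons.prems by (intro parabolic_mono) simp
    ultimately show "y \<in> path_set W (I # Ks)"
      using path_set_closed_left[OF assms(1,3), of u z] by blast
  qed
qed

end

section \<open>Galois theory of finite groups of ring automorphisms\<close>

text \<open>R is a subset of the ambient domain and \<open>act\<close> is constrained only there,
  since the laws of \<open>weyl_act\<close> are available only on polynomials in the coordinates of
  V. Working in a domain is what allows nonzero factors to be cancelled.\<close>

locale ring_action = group G for G :: "('g, 'z) monoid_scheme" (structure) +
  fixes R :: "'r::idom set" and act :: "'g \<Rightarrow> 'r \<Rightarrow> 'r"
  assumes R_one [simp]: "1 \<in> R"
    and R_add [simp]: "a \<in> R \<Longrightarrow> b \<in> R \<Longrightarrow> a + b \<in> R"
    and R_uminus [simp]: "a \<in> R \<Longrightarrow> - a \<in> R"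
    and R_mult [simp]: "a \<in> R \<Longrightarrow> b \<in> R \<Longrightarrow> a * b \<in> R"
    and act_closed [simp]: "g \<in> carrier G \<Longrightarrow> a \<in> R \<Longrightarrow> act g a \<in> R"
    and act_add: "g \<in> carrier G \<Longrightarrow> a \<in> R \<Longrightarrow> b \<in> R \<Longrightarrow> act g (a + b) = act g a + act g b"
    and act_mult: "g \<in> carrier G \<Longrightarrow> a \<in> R \<Longrightarrow> b \<in> R \<Longrightarrow> act g (a * b) = act g a * act g b"
    and act_one [simp]: "g \<in> carrier G \<Longrightarrow> act g 1 = 1"
    and act_id [simp]: "a \<in> R \<Longrightarrow> act \<one> a = a"
    and act_comp: "g \<in> carrier G \<Longrightarrow> h \<in> carrier G \<Longrightarrow> a \<in> R \<Longrightarrow> act (g \<otimes> h) a = act g (act h a)"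
    and act_faithful: "g \<in> carrier G \<Longrightarrow> h \<in> carrier G \<Longrightarrow> g \<noteq> h \<Longrightarrow> \<exists>a\<in>R. act g a \<noteq> act h a"
begin

lemma R_zero [simp]: "0 \<in> R"
  using R_add[OF R_one R_uminus[OF R_one]] by simp

lemma R_diff [simp]: "a \<in> R \<Longrightarrow> b \<in> R \<Longrightarrow> a - b \<in> R"
  using R_add[of a "- b"] by simp

lemma R_sum [simp]: "(\<And>i. i \<in> A \<Longrightarrow> f i \<in> R) \<Longrightarrow> sum f A \<in> R"
  by (induction A rule: infinite_finite_induct) auto

lemma R_prod [simp]: "(\<And>i. i \<in> A \<Longrightarrow> f i \<in> R) \<Longrightarrow> prod f A \<in> R"
  by (induction A rule: infinite_finite_induct) auto

lemma R_sum_list [simp]: "(\<And>i. i \<in> set xs \<Longrightarrow> f i \<in> R) \<Longrightarrow> (\<Sum>i\<leftarrow>xs. f i) \<in> R"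
  by (induction xs) auto

lemma act_zero [simp]: "g \<in> carrier G \<Longrightarrow> act g 0 = 0"
  by (metis act_add R_zero add_0 add_cancel_right_right)

lemma act_uminus: "g \<in> carrier G \<Longrightarrow> a \<in> R \<Longrightarrow> act g (- a) = - act g a"
  using act_add[of g a "- a"] by (simp add: add_eq_0_iff)

lemma act_sum:
  "g \<in> carrier G \<Longrightarrow> (\<And>i. i \<in> A \<Longrightarrow> f i \<in> R) \<Longrightarrow> act g (sum f A) = (\<Sum>i\<in>A. act g (f i))"
  by (induction A rule: infinite_finite_induct) (auto simp: act_add)

lemma act_prod:
  "g \<in> carrier G \<Longrightarrow> (\<And>i. i \<in> A \<Longrightarrow> f i \<in> R) \<Longrightarrow> act g (prod f A) = (\<Prod>i\<in>A. act g (f i))"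
  by (induction A rule: infinite_finite_induct) (auto simp: act_mult)

lemma act_sum_list:
  "g \<in> carrier G \<Longrightarrow> (\<And>i. i \<in> set xs \<Longrightarrow> f i \<in> R) \<Longrightarrow>
    act g (\<Sum>i\<leftarrow>xs. f i) = (\<Sum>i\<leftarrow>xs. act g (f i))"
  by (induction xs) (auto simp: act_add)

lemma act_inv_cancel [simp]:
  "g \<in> carrier G \<Longrightarrow> a \<in> R \<Longrightarrow> act g (act (inv g) a) = a"
  "g \<in> carrier G \<Longrightarrow> a \<in> R \<Longrightarrow> act (inv g) (act g a) = a"
  by (simp_all flip: act_comp)

lemma act_eq_0_iff: "g \<in> carrier G \<Longrightarrow> a \<in> R \<Longrightarrow> act g a = 0 \<longleftrightarrow> a = 0"
  by (metis act_inv_cancel(2) act_zero inv_closed)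

text \<open>Dedekind's argument: the relation at ab minus \<open>act g b\<close> times the relation
  at a no longer contains the term of g. The coefficients are arbitrary elements of the ambient
  domain.\<close>

lemma dedekind_independence:
  assumes "finite A" "A \<subseteq> carrier G" "\<And>a. a \<in> R \<Longrightarrow> (\<Sum>g\<in>A. c g * act g a) = 0"
  shows "\<forall>g\<in>A. c g = 0"
  using assms
proof (induction A arbitrary: c)
  case (insert g A)
  have gc: "x \<in> carrier G" if "x \<in> insert g A" for x using insert.prems(1) that by blast
  have "c h = 0" if h: "h \<in> A" for h
  proof -
    obtain b where b: "b \<in> R" "act g b \<noteq> act h b"
      using act_faithful[of g h] insert.prems insert.hyps h by blast
    have "\<forall>h\<in>A. c h * (act h b - act g b) = 0"
    proof (rule insert.IH)
      fix a assume a: "a \<in> R"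
      have "0 = (\<Sum>h\<in>insert g A. c h * act h (a * b)) - act g b * (\<Sum>h\<in>insert g A. c h * act h a)"
        using insert.prems(2)[of "a * b"] insert.prems(2)[of a] a b by simp
      also have "\<dots> = (\<Sum>h\<in>insert g A. c h * (act h b - act g b) * act h a)"
        unfolding sum_distrib_left sum_subtractf[symmetric] using gc a b
        by (intro sum.cong refl) (simp add: act_mult algebra_simps)
      finally show "(\<Sum>h\<in>A. c h * (act h b - act g b) * act h a) = 0"
        using insert.hyps by simp
    qed (use insert.prems in auto)
    with b h show ?thesis by auto
  qed
  moreover from this have "c g = 0"
    using insert.prems(2)[of 1] insert.prems(1) insert.hyps by (simp add: subset_iff)
  ultimately show ?case by simp
qed simp

section \<open>Invariants, traces, norms and the splitting of functionals\<close>

definition fixed :: "'g set \<Rightarrow> 'r set" where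
  "fixed H = {a \<in> R. \<forall>h\<in>H. act h a = a}"

lemma fixed_R: "a \<in> fixed H \<Longrightarrow> a \<in> R"
  by (simp add: fixed_def)

lemma fixed_act: "a \<in> fixed H \<Longrightarrow> h \<in> H \<Longrightarrow> act h a = a"
  by (simp add: fixed_def)

lemma fixed_mono: "H \<subseteq> K \<Longrightarrow> fixed K \<subseteq> fixed H"
  by (auto simp: fixed_def)

lemma fixed_closed:
  assumes "H \<subseteq> carrier G"
  shows "1 \<in> fixed H" "0 \<in> fixed H"
    and "a \<in> fixed H \<Longrightarrow> b \<in> fixed H \<Longrightarrow> a * b \<in> fixed H"
    and "a \<in> fixed H \<Longrightarrow> b \<in> fixed H \<Longrightarrow> a + b \<in> fixed H"
    and "a \<in> fixed H \<Longrightarrow> - a \<in> fixed H"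
  using assms by (auto simp: fixed_def act_mult act_add act_uminus subset_iff)

lemma subgroup_translate_bij:
  assumes "subgroup H G" "g \<in> H"
  shows "bij_betw (\<lambda>h. g \<otimes> h) H H"
proof (rule bij_betw_byWitness[where f' = "\<lambda>h. inv g \<otimes> h"])
  have c: "h \<in> carrier G" if "h \<in> H" for h using subgroup.mem_carrier[OF assms(1) that] .
  show "\<forall>h\<in>H. inv g \<otimes> (g \<otimes> h) = h" "\<forall>h\<in>H. g \<otimes> (inv g \<otimes> h) = h"
    using c assms(2) by (auto simp: m_assoc[symmetric])
  show "(\<lambda>h. g \<otimes> h) ` H \<subseteq> H" "(\<lambda>h. inv g \<otimes> h) ` H \<subseteq> H"
    using assms subgroup.m_closed subgroup.m_inv_closed by fast+
qed

definition trace :: "'g set \<Rightarrow> 'r \<Rightarrow> 'r" where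
  "trace H a = (\<Sum>h\<in>H. act h a)"

lemma trace_fixed:
  assumes "subgroup H G" "a \<in> R"
  shows "trace H a \<in> fixed H"
proof -
  have c: "h \<in> carrier G" if "h \<in> H" for h using subgroup.mem_carrier[OF assms(1) that] .
  have "act g (trace H a) = trace H a" if "g \<in> H" for g
  proof -
    have "act g (trace H a) = (\<Sum>h\<in>H. act (g \<otimes> h) a)"
      unfolding trace_def using c that assms(2) by (simp add: act_sum act_comp)
    also have "\<dots> = trace H a"
      unfolding trace_def by (rule sum.reindex_bij_betw[OF subgroup_translate_bij[OF assms(1) that]])
    finally show ?thesis .
  qed
  then show ?thesis unfolding fixed_def using c assms(2) by (auto simp: trace_def)
qed

lemma norm_fixed:
  assumes "subgroup H G" "a \<in> R"
  shows "(\<Prod>h\<in>H. act h a) \<in> fixed H"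
proof -
  have c: "h \<in> carrier G" if "h \<in> H" for h using subgroup.mem_carrier[OF assms(1) that] .
  have "act g (\<Prod>h\<in>H. act h a) = (\<Prod>h\<in>H. act h a)" if "g \<in> H" for g
  proof -
    have "act g (\<Prod>h\<in>H. act h a) = (\<Prod>h\<in>H. act (g \<otimes> h) a)"
      using c that assms(2) by (simp add: act_prod act_comp)
    also have "\<dots> = (\<Prod>h\<in>H. act h a)"
      by (rule prod.reindex_bij_betw[OF subgroup_translate_bij[OF assms(1) that]])
    finally show ?thesis .
  qed
  then show ?thesis unfolding fixed_def using c assms(2) by auto
qed

text \<open>An automorphism fixing all traces contradicts the independence of the elements of
  \<open>H\<close> and of its coset.\<close>

lemma fixed_separates:
  assumes H: "subgroup H G" "finite H" and g: "g \<in> carrier G" "g \<notin> H"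
  shows "\<exists>a\<in>fixed H. act g a \<noteq> a"
proof (rule ccontr)
  assume "\<not> ?thesis"
  then have tr: "\<And>a. a \<in> R \<Longrightarrow> act g (trace H a) = trace H a" using trace_fixed[OF H(1)] by blast
  have c: "h \<in> carrier G" if "h \<in> H" for h using subgroup.mem_carrier[OF H(1) that] .
  define A where "A = (\<lambda>h. g \<otimes> h) ` H"
  have inj: "inj_on (\<lambda>h. g \<otimes> h) H" using g c by (auto intro!: inj_onI)
  have disj: "A \<inter> H = {}"
  proof -
    have "g \<in> H" if "h \<in> H" "g \<otimes> h \<in> H" for h
    proof -
      have "(g \<otimes> h) \<otimes> inv h \<in> H" using that H(1) subgroup.m_closed subgroup.m_inv_closed by metis
      then show ?thesis using g c that by (simp add: m_assoc)
    qed
    then show ?thesis using g by (auto simp: A_def)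
  qed
  have "\<forall>x\<in>A \<union> H. (if x \<in> H then - 1 else 1 :: 'r) = 0"
  proof (rule dedekind_independence)
    fix a assume a: "a \<in> R"
    have "(\<Sum>x\<in>A \<union> H. (if x \<in> H then - 1 else 1) * act x a)
        = (\<Sum>x\<in>A. act x a) - (\<Sum>x\<in>H. act x a)"
    proof -
      have "(\<Sum>x\<in>A. (if x \<in> H then - 1 else 1) * act x a) = (\<Sum>x\<in>A. act x a)"
        using disj by (intro sum.cong) auto
      moreover have "(\<Sum>x\<in>H. (if x \<in> H then - 1 else 1) * act x a) = - (\<Sum>x\<in>H. act x a)"
        by (simp add: sum_negf)
      ultimately show ?thesis using disj H(2) by (subst sum.union_disjoint) (auto simp: A_def)
    qed
    also have "(\<Sum>x\<in>A. act x a) = (\<Sum>h\<in>H. act g (act h a))"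
      unfolding A_def sum.reindex[OF inj] using g c a by (simp add: act_comp)
    also have "\<dots> = act g (trace H a)" unfolding trace_def using g c a by (simp add: act_sum)
    finally show "(\<Sum>x\<in>A \<union> H. (if x \<in> H then - 1 else 1) * act x a) = 0"
      using tr[OF a] by (simp add: trace_def)
  qed (use H(2) g c in \<open>auto simp: A_def\<close>)
  then have "(if \<one> \<in> H then - 1 else 1 :: 'r) = 0" using subgroup.one_closed[OF H(1)] by blast
  then show False by (simp split: if_splits)
qed

text \<open>The list stands for an element of the tensor product of R and R^H, namely the product
  over u of 1 (x) b_u - u(b_u) (x) 1, and v sends s (x) r to s v(r).\<close>

lemma separating_pairs_prod:
  assumes "finite A" "A \<subseteq> carrier G" "H \<subseteq> carrier G" "\<And>u. u \<in> A \<Longrightarrow> b u \<in> fixed H"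
  shows "\<exists>ps. set ps \<subseteq> R \<times> fixed H \<and>
    (\<forall>v\<in>carrier G. (\<Sum>(s, r)\<leftarrow>ps. s * act v r) = (\<Prod>u\<in>A. act v (b u) - act u (b u)))"
  using assms(1,2,4)
proof (induction A)
  case empty
  show ?case using fixed_closed[OF assms(3)] by (intro exI[of _ "[(1, 1)]"]) simp
next
  case (insert u A)
  then obtain ps where ps: "set ps \<subseteq> R \<times> fixed H"
      "\<forall>v\<in>carrier G. (\<Sum>(s, r)\<leftarrow>ps. s * act v r) = (\<Prod>u\<in>A. act v (b u) - act u (b u))"
    by auto
  have bu: "b u \<in> fixed H" "b u \<in> R" using insert.prems fixed_R by auto
  have u: "u \<in> carrier G" using insert.prems by simp
  \<comment> \<open>Multiplying out one further factor yields two copies of the list, one for each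
    summand of the factor.\<close>
  define qs where
    "qs = map (\<lambda>(s, r). (s, r * b u)) ps @ map (\<lambda>(s, r). (- (act u (b u) * s), r)) ps"
  have "set qs \<subseteq> R \<times> fixed H"
    using ps(1) bu u fixed_closed[OF assms(3)] by (auto simp: qs_def subset_iff)
  moreover have "(\<Sum>(s, r)\<leftarrow>qs. s * act v r) = (\<Prod>u\<in>insert u A. act v (b u) - act u (b u))"
    if v: "v \<in> carrier G" for v
  proof -
    have "(\<Sum>(s, r)\<leftarrow>qs. s * act v r)
        = (\<Sum>(s, r)\<leftarrow>ps. act v (b u) * (s * act v r)) + (\<Sum>(s, r)\<leftarrow>ps. - act u (b u) * (s * act v r))"
      unfolding qs_def map_append sum_list_append map_map using ps(1) v bu fixed_R
      by (intro arg_cong2[of _ _ _ _ "(+)"] arg_cong[of _ _ sum_list] map_cong refl)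
        (auto simp: act_mult[OF v _ bu(2)])
    also have "\<dots> = (act v (b u) - act u (b u)) * (\<Sum>(s, r)\<leftarrow>ps. s * act v r)"
      unfolding case_prod_unfold sum_list_const_mult by (simp add: algebra_simps)
    finally show ?thesis using ps(2) v insert.hyps by simp
  qed
  ultimately show ?case by blast
qed

text \<open>Each u in K outside H moves some H-invariant b_u. The resulting product vanishes at v
  outside H because of the factor u = v; for v in H every b_u is fixed, which gives the constant
  D.\<close>

lemma separating_pairs:
  assumes K: "subgroup K G" "finite K" and H: "subgroup H G" "H \<subseteq> K"
  shows "\<exists>ps D. set ps \<subseteq> R \<times> fixed H \<and> D \<in> R \<and> D \<noteq> 0 \<and>
    (\<forall>v\<in>K. (\<Sum>(s, r)\<leftarrow>ps. s * act v r) = (if v \<in> H then D else 0))"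
proof -
  have fH: "finite H" using H K by (blast intro: finite_subset)
  have Kc: "K \<subseteq> carrier G" and Hc: "H \<subseteq> carrier G" using K H subgroup.subset by auto
  have "\<forall>u\<in>K - H. \<exists>b\<in>fixed H. act u b \<noteq> b" using fixed_separates[OF H(1) fH] Kc by blast
  then obtain b where b: "\<And>u. u \<in> K - H \<Longrightarrow> b u \<in> fixed H \<and> act u (b u) \<noteq> b u"
    using bchoice[of "K - H" "\<lambda>u b. b \<in> fixed H \<and> act u b \<noteq> b"] by blast
  then obtain ps where ps: "set ps \<subseteq> R \<times> fixed H" "\<forall>v\<in>carrier G.
      (\<Sum>(s, r)\<leftarrow>ps. s * act v r) = (\<Prod>u\<in>K - H. act v (b u) - act u (b u))"
    using separating_pairs_prod[of "K - H" H b] K Kc Hc by auto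
  define D where "D = (\<Prod>u\<in>K - H. b u - act u (b u))"
  have "D \<in> R" unfolding D_def using b fixed_R Kc by (intro R_prod R_diff act_closed) auto
  moreover have "D \<noteq> 0" unfolding D_def using b K by fastforce
  moreover have "(\<Sum>(s, r)\<leftarrow>ps. s * act v r) = (if v \<in> H then D else 0)" if v: "v \<in> K" for v
  proof (cases "v \<in> H")
    case True
    have "(\<Prod>u\<in>K - H. act v (b u) - act u (b u)) = D"
      unfolding D_def using True b fixed_act[of _ H v] by (intro prod.cong refl) fastforce
    then show ?thesis using ps(2) v Kc True by auto
  next
    case False
    then have "(\<Prod>u\<in>K - H. act v (b u) - act u (b u)) = 0" using v K by (intro prod_zero) auto
    then show ?thesis using ps(2) v Kc False by auto
  qed
  ultimately show ?thesis using ps(1) by blast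
qed

text \<open>The coefficients of a functional \<open>\<theta>\<close> on $R^H$ that is $R^K$-linear (twisted
  by \<open>z\<close>) in its expansion, up to a nonzero factor, as a combination of the embeddings
  \<open>act (z \<otimes> g)\<close> for \<open>g \<in> K\<close>.\<close>

definition twist_coeff :: "('r \<times> 'r) list \<Rightarrow> 'g \<Rightarrow> ('r \<Rightarrow> 'r) \<Rightarrow> 'r" where
  "twist_coeff qs g \<theta> = (\<Sum>(s, r)\<leftarrow>qs. act g s * \<theta> r)"

lemma sum_list_sum_swap: "(\<Sum>x\<leftarrow>xs. \<Sum>i\<in>A. f x i) = (\<Sum>i\<in>A. \<Sum>x\<leftarrow>xs. f x i :: 'x::comm_monoid_add)"
  by (induction xs) (auto simp: sum.distrib)

text \<open>The pairs act like dual bases of R^H over R^K up to the factor d: applying \<theta> to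
  ad = sum of Tr_K(as) r exhibits it as a combination of the embeddings by zg. They are chosen
  before z and \<theta>, so that one choice serves all tails of a tensor.\<close>

lemma twisted_functional_coeffs:
  assumes K: "subgroup K G" "finite K" and H: "subgroup H G" "H \<subseteq> K"
  shows "\<exists>qs. set qs \<subseteq> R \<times> fixed H \<and> (\<forall>z\<in>carrier G. \<forall>\<theta>.
    (\<forall>a\<in>fixed H. \<forall>b\<in>fixed H. \<theta> (a + b) = \<theta> a + \<theta> b) \<longrightarrow>
    (\<forall>a\<in>fixed K. \<forall>b\<in>fixed H. \<theta> (a * b) = act z a * \<theta> b) \<longrightarrow>
      (\<forall>g\<in>K. \<forall>b\<in>fixed H. twist_coeff qs (z \<otimes> g) (\<lambda>r. \<theta> (b * r)) = act (z \<otimes> g) b * twist_coeff qs (z \<otimes> g) \<theta>)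
      \<and> ((\<forall>g\<in>K. twist_coeff qs (z \<otimes> g) \<theta> = 0) \<longrightarrow> (\<forall>a\<in>fixed H. \<theta> a = 0)))"
proof -
  have fH: "finite H" using H K by (blast intro: finite_subset)
  have Kc: "K \<subseteq> carrier G" and Hc: "H \<subseteq> carrier G" using K H subgroup.subset by auto
  note [simp] = subsetD[OF Kc] subsetD[OF Hc]
  note fHc = fixed_closed[OF Hc] and fKc = fixed_closed[OF Kc]
  have fKH: "a \<in> fixed H" if "a \<in> fixed K" for a using that fixed_mono[OF H(2)] by blast
  obtain ps D where ps: "set ps \<subseteq> R \<times> fixed H" and D: "D \<in> R" "D \<noteq> 0"
    and psD: "\<And>v. v \<in> K \<Longrightarrow> (\<Sum>(s, r)\<leftarrow>ps. s * act v r) = (if v \<in> H then D else 0)"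
    using separating_pairs[OF K H] by blast
  \<comment> \<open>The trace of D itself may vanish, so D is rescaled first; if every c failed,
    Dedekind independence would force D = 0.\<close>
  have "\<exists>c\<in>R. trace H (c * D) \<noteq> 0"
  proof (rule ccontr)
    assume "\<not> ?thesis"
    then have "\<And>c. c \<in> R \<Longrightarrow> (\<Sum>h\<in>H. act h D * act h c) = 0"
      unfolding trace_def using D by (auto simp: act_mult mult.commute)
    then have "\<forall>h\<in>H. act h D = 0" by (intro dedekind_independence[OF fH Hc])
    then show False using D subgroup.one_closed[OF H(1)] by auto
  qed
  then obtain c where c: "c \<in> R" "trace H (c * D) \<noteq> 0" by blast
  define qs where "qs = map (\<lambda>(s, r). (c * s, r)) ps"
  have qs: "set qs \<subseteq> R \<times> fixed H" using ps c by (auto simp: qs_def)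
  have qsR: "s \<in> R" "r \<in> fixed H" "r \<in> R" if "(s, r) \<in> set qs" for s r
    using qs that fixed_R by auto
  define E where "E = c * D"
  have E: "E \<in> R" using c D by (simp add: E_def)
  have qsE: "(\<Sum>(s, r)\<leftarrow>qs. s * act v r) = (if v \<in> H then E else 0)" if "v \<in> K" for v
    using psD[OF that] by (simp add: qs_def o_def case_prod_unfold mult.assoc sum_list_const_mult E_def)
  define d where "d = trace H E"
  have d: "d \<in> fixed H" "d \<noteq> 0" unfolding d_def using trace_fixed[OF H(1) E] c(2) by (auto simp: E_def)
  have dR: "d \<in> R" using d fixed_R by simp
  have oneK: "\<one> \<in> K" using K(1) by (rule subgroup.one_closed)
  \<comment> \<open>The factor d is only H-invariant and cannot be pulled out of \<theta>. Its norm
    N over K can, and in N = d d' the cofactor d' is again H-invariant.\<close>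
  define N where "N = (\<Prod>g\<in>K. act g d)"
  define d' where "d' = (\<Prod>g\<in>K - {\<one>}. act g d)"
  have N: "N \<in> fixed K" unfolding N_def by (rule norm_fixed[OF K(1) dR])
  have N0: "N \<noteq> 0" unfolding N_def using K(2) d dR by (simp add: act_eq_0_iff)
  have Nd: "N = d * d'" unfolding N_def d'_def using prod.remove[OF K(2) oneK, of "\<lambda>g. act g d"] dR by simp
  have d'R: "d' \<in> R" unfolding d'_def using dR by (intro R_prod) auto
  have d': "d' \<in> fixed H"
  proof -
    have "act h d' = d'" if h: "h \<in> H" for h
    proof -
      have "d * act h d' = act h N" unfolding Nd using h dR d'R d by (simp add: act_mult fixed_act)
      also have "\<dots> = d * d'" using N h H(2) Nd by (auto simp: fixed_act)
      finally show ?thesis using d by simp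
    qed
    then show ?thesis using d'R by (simp add: fixed_def)
  qed
  have inv_in: "inv g \<otimes> h \<in> K" if "g \<in> K" "h \<in> K" for g h
    using that K(1) subgroup.m_closed subgroup.m_inv_closed by metis
  \<comment> \<open>After the traces are expanded, the pairs kill every g outside H. What remains is
    a times the sum of the \<open>act g E\<close> over H, that is, a times d.\<close>
  have expand: "a * d = (\<Sum>(s, r)\<leftarrow>qs. trace K (a * s) * r)" if a: "a \<in> fixed H" for a
  proof -
    have aR: "a \<in> R" using a fixed_R by simp
    have "(\<Sum>(s, r)\<leftarrow>qs. trace K (a * s) * r) = (\<Sum>x\<leftarrow>qs. \<Sum>g\<in>K. act g a * (act g (fst x) * snd x))"
      unfolding trace_def case_prod_unfold using qsR aR
      by (intro arg_cong[of _ _ sum_list] map_cong refl)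
        (auto simp: sum_distrib_right act_mult mult.assoc intro!: sum.cong)
    also have "\<dots> = (\<Sum>g\<in>K. act g a * (\<Sum>x\<leftarrow>qs. act g (fst x) * snd x))"
      unfolding sum_list_sum_swap by (simp add: sum_list_const_mult)
    also have "\<dots> = (\<Sum>g\<in>K. if g \<in> H then act g a * act g E else 0)"
    proof (intro sum.cong refl)
      fix g assume g: "g \<in> K"
      have "(\<Sum>x\<leftarrow>qs. act g (fst x) * snd x) = act g (\<Sum>(s, r)\<leftarrow>qs. s * act (inv g) r)"
        using g qsR by (subst act_sum_list)
          (auto simp: act_mult case_prod_unfold intro!: arg_cong[of _ _ sum_list])
      moreover have "inv g \<in> K" "inv g \<in> H \<longleftrightarrow> g \<in> H"
        using g K(1) H(1) subgroup.m_inv_closed[of K G g] subgroup.m_inv_closed[of H G g]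
          subgroup.m_inv_closed[of H G "inv g"] by auto
      ultimately show "act g a * (\<Sum>x\<leftarrow>qs. act g (fst x) * snd x) = (if g \<in> H then act g a * act g E else 0)"
        using g by (simp add: qsE)
    qed
    also have "\<dots> = (\<Sum>g\<in>H. act g a * act g E)"
      using K(2) H(2) by (simp add: sum.inter_restrict[symmetric] Int_absorb1)
    also have "\<dots> = a * d" unfolding d_def trace_def sum_distrib_left using a
      by (intro sum.cong refl) (simp add: fixed_act)
    finally show ?thesis by simp
  qed
  show ?thesis
  proof (intro exI[of _ qs] conjI qs ballI allI impI)
    fix z \<theta> assume z: "z \<in> carrier G"
      and add: "\<forall>a\<in>fixed H. \<forall>b\<in>fixed H. \<theta> (a + b) = \<theta> a + \<theta> b"
      and lin: "\<forall>a\<in>fixed K. \<forall>b\<in>fixed H. \<theta> (a * b) = act z a * \<theta> b"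
    have \<theta>0: "\<theta> 0 = 0" using add fHc(2) by (metis add_cancel_right_left add_0)
    have \<theta>_sum: "\<theta> (\<Sum>x\<leftarrow>xs. f x) = (\<Sum>x\<leftarrow>xs. \<theta> (f x))" "(\<Sum>x\<leftarrow>xs. f x) \<in> fixed H"
      if "\<And>x. x \<in> set xs \<Longrightarrow> f x \<in> fixed H" for f :: "'r \<times> 'r \<Rightarrow> 'r" and xs
      using that by (induction xs) (auto simp: \<theta>0 add fHc)
    have twisted_functional_expansion:
      "\<theta> (a * d) = (\<Sum>g\<in>K. act (z \<otimes> g) a * twist_coeff qs (z \<otimes> g) \<theta>)" if a: "a \<in> fixed H" for a
    proof -
      have aR: "a \<in> R" using a fixed_R by simp
      have tr: "trace K (a * s) \<in> fixed K" if "s \<in> R" for s using trace_fixed[OF K(1)] aR that by simp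
      have "\<theta> (a * d) = (\<Sum>x\<leftarrow>qs. \<theta> (trace K (a * fst x) * snd x))"
        unfolding expand[OF a] case_prod_unfold using qsR tr fKH fHc by (intro \<theta>_sum) auto
      also have "\<dots> = (\<Sum>x\<leftarrow>qs. \<Sum>g\<in>K. act (z \<otimes> g) a * (act (z \<otimes> g) (fst x) * \<theta> (snd x)))"
      proof (intro arg_cong[of _ _ sum_list] map_cong refl)
        fix x assume "x \<in> set qs"
        then have x: "fst x \<in> R" "snd x \<in> fixed H" using qsR[of "fst x" "snd x"] by auto
        have "\<theta> (trace K (a * fst x) * snd x) = act z (trace K (a * fst x)) * \<theta> (snd x)"
          using lin tr x by simp
        also have "act z (trace K (a * fst x)) = (\<Sum>g\<in>K. act (z \<otimes> g) a * act (z \<otimes> g) (fst x))"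
          unfolding trace_def using z x aR by (simp add: act_sum act_comp act_mult)
        finally show "\<theta> (trace K (a * fst x) * snd x) =
            (\<Sum>g\<in>K. act (z \<otimes> g) a * (act (z \<otimes> g) (fst x) * \<theta> (snd x)))"
          by (simp add: sum_distrib_right mult.assoc)
      qed
      also have "\<dots> = (\<Sum>g\<in>K. act (z \<otimes> g) a * twist_coeff qs (z \<otimes> g) \<theta>)"
        unfolding sum_list_sum_swap twist_coeff_def by (simp add: sum_list_const_mult case_prod_unfold)
      finally show ?thesis .
    qed
    \<comment> \<open>Replacing a by ad' turns the factor d into N, which leaves \<theta> as
      \<open>act z N\<close>.\<close>
    have scaled: "act z N * \<theta> a = (\<Sum>h\<in>K. act (z \<otimes> h) (a * d') * twist_coeff qs (z \<otimes> h) \<theta>)"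
      if a: "a \<in> fixed H" for a
    proof -
      have "act z N * \<theta> a = \<theta> (N * a)" using lin N a by simp
      also have "N * a = (a * d') * d" by (simp add: Nd)
      finally show ?thesis using twisted_functional_expansion[of "a * d'"] a d' fHc by simp
    qed
    have zN: "act z N \<noteq> 0" using z N0 N fixed_R by (simp add: act_eq_0_iff)
    {
      fix a assume "\<forall>g\<in>K. twist_coeff qs (z \<otimes> g) \<theta> = 0" "a \<in> fixed H"
      then have "act z N * \<theta> a = 0" using scaled by simp
      then show "\<theta> a = 0" using zN by simp
    }
    fix g b assume g: "g \<in> K" and b: "b \<in> fixed H"
    \<comment> \<open>T keeps the h in the coset gH, the only ones not killed by the pairs; on R^H
      the elements zh and zg act alike. Since T does not involve b, comparing \<open>key\<close> for
      b and for 1 gives the claim once \<open>act z N\<close> is cancelled.\<close>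
    define T where "T = (\<Sum>h\<in>K. if inv g \<otimes> h \<in> H
      then act (z \<otimes> h) d' * twist_coeff qs (z \<otimes> h) \<theta> * act (z \<otimes> g) E else 0)"
    have key: "act z N * twist_coeff qs (z \<otimes> g) (\<lambda>r. \<theta> (b * r)) = act (z \<otimes> g) b * T"
      if b: "b \<in> fixed H" for b
    proof -
      have bR: "b \<in> R" using b fixed_R by simp
      have "act z N * twist_coeff qs (z \<otimes> g) (\<lambda>r. \<theta> (b * r))
          = (\<Sum>x\<leftarrow>qs. act (z \<otimes> g) (fst x) * (act z N * \<theta> (b * snd x)))"
        unfolding twist_coeff_def sum_list_const_mult[symmetric] case_prod_unfold
        by (simp add: mult.left_commute)
      also have "\<dots> = (\<Sum>x\<leftarrow>qs. \<Sum>h\<in>K. act (z \<otimes> h) (b * d') * twist_coeff qs (z \<otimes> h) \<theta> *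
          (act (z \<otimes> g) (fst x) * act (z \<otimes> h) (snd x)))"
      proof (intro arg_cong[of _ _ sum_list] map_cong refl)
        fix x assume "x \<in> set qs"
        then have x: "fst x \<in> R" "snd x \<in> fixed H" "snd x \<in> R" using qsR[of "fst x" "snd x"] by auto
        have "act z N * \<theta> (b * snd x) = (\<Sum>h\<in>K. act (z \<otimes> h) (b * snd x * d') * twist_coeff qs (z \<otimes> h) \<theta>)"
          using scaled[of "b * snd x"] b x fHc by simp
        then show "act (z \<otimes> g) (fst x) * (act z N * \<theta> (b * snd x)) =
          (\<Sum>h\<in>K. act (z \<otimes> h) (b * d') * twist_coeff qs (z \<otimes> h) \<theta> *
            (act (z \<otimes> g) (fst x) * act (z \<otimes> h) (snd x)))"
          using z x bR d'R by (simp add: sum_distrib_left act_mult mult.assoc mult.left_commute mult.commute)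
      qed
      also have "\<dots> = (\<Sum>h\<in>K. act (z \<otimes> h) (b * d') * twist_coeff qs (z \<otimes> h) \<theta> *
          (\<Sum>x\<leftarrow>qs. act (z \<otimes> g) (fst x) * act (z \<otimes> h) (snd x)))"
        unfolding sum_list_sum_swap by (simp add: sum_list_const_mult)
      also have "\<dots> = act (z \<otimes> g) b * T"
        unfolding T_def sum_distrib_left
      proof (intro sum.cong refl)
        fix h assume h: "h \<in> K"
        have gh: "act (z \<otimes> h) a = act (z \<otimes> g) (act (inv g \<otimes> h) a)" if "a \<in> R" for a
        proof -
          have "z \<otimes> h = (z \<otimes> g) \<otimes> (inv g \<otimes> h)" using z g h by (simp add: m_assoc[symmetric]) (simp add: m_assoc)
          then show ?thesis using z g h that by (simp add: act_comp)
        qed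
        have "(\<Sum>x\<leftarrow>qs. act (z \<otimes> g) (fst x) * act (z \<otimes> h) (snd x))
            = act (z \<otimes> g) (\<Sum>(s, r)\<leftarrow>qs. s * act (inv g \<otimes> h) r)"
          using g h z qsR by (subst act_sum_list)
            (auto simp: act_mult case_prod_unfold gh intro!: arg_cong[of _ _ sum_list])
        also have "\<dots> = (if inv g \<otimes> h \<in> H then act (z \<otimes> g) E else 0)"
          using qsE[OF inv_in[OF g h]] z g by simp
        finally show "act (z \<otimes> h) (b * d') * twist_coeff qs (z \<otimes> h) \<theta> *
            (\<Sum>x\<leftarrow>qs. act (z \<otimes> g) (fst x) * act (z \<otimes> h) (snd x)) =
          act (z \<otimes> g) b * (if inv g \<otimes> h \<in> H
            then act (z \<otimes> h) d' * twist_coeff qs (z \<otimes> h) \<theta> * act (z \<otimes> g) E else 0)"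
          using z h bR d'R gh[OF bR] b by (simp add: act_mult fixed_act)
      qed
      finally show ?thesis .
    qed
    have "act z N * twist_coeff qs (z \<otimes> g) \<theta> = T" using key[OF fHc(1)] z g by simp
    then have "act z N * twist_coeff qs (z \<otimes> g) (\<lambda>r. \<theta> (b * r)) =
        act z N * (act (z \<otimes> g) b * twist_coeff qs (z \<otimes> g) \<theta>)"
      using key[OF b] by (simp add: mult.left_commute)
    then show "twist_coeff qs (z \<otimes> g) (\<lambda>r. \<theta> (b * r)) = act (z \<otimes> g) b * twist_coeff qs (z \<otimes> g) \<theta>"
      using zN by simp
  qed
qed

end

section \<open>The action on the polynomial ring\<close>

text \<open>\<open>weyl_act\<close> is the special case of linear substitutions
  (\<open>weyl_act_subst\<close>), so additivity, multiplicativity and the composition rule are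
  proved once for arbitrary \<phi>.\<close>

definition poly_subst :: "(nat \<Rightarrow> 'k polynomial) \<Rightarrow> 'k::field polynomial \<Rightarrow> 'k polynomial" where
  "poly_subst \<phi> f = (\<Sum>m\<in>Poly_Mapping.keys f. Poly_Mapping.single 0 (Poly_Mapping.lookup f m) *
     (\<Prod>i\<in>Poly_Mapping.keys m. \<phi> i ^ Poly_Mapping.lookup m i))"

abbreviation poly_const :: "'k::field \<Rightarrow> 'k polynomial" where
  "poly_const c \<equiv> Poly_Mapping.single 0 c"

abbreviation poly_var :: "nat \<Rightarrow> 'k::field polynomial" where
  "poly_var i \<equiv> Poly_Mapping.single (Poly_Mapping.single i (Suc 0)) 1"

abbreviation monom_subst :: "(nat \<Rightarrow> 'k::field polynomial) \<Rightarrow> (nat \<Rightarrow>\<^sub>0 nat) \<Rightarrow> 'k polynomial" where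
  "monom_subst \<phi> m \<equiv> \<Prod>i\<in>Poly_Mapping.keys m. \<phi> i ^ Poly_Mapping.lookup m i"

lemma poly_const_add: "poly_const (a + b) = poly_const a + poly_const b"
  by (simp add: single_add)

lemma poly_const_sum: "poly_const (sum f A) = (\<Sum>i\<in>A. poly_const (f i))"
  by (induction A rule: infinite_finite_induct) (auto simp: single_add)

lemma poly_const_mult: "poly_const (a * b) = poly_const a * poly_const b"
  by (simp add: mult_single)

lemma poly_subst_superset:
  assumes "finite A" "Poly_Mapping.keys f \<subseteq> A"
  shows "poly_subst \<phi> f = (\<Sum>m\<in>A. poly_const (Poly_Mapping.lookup f m) * monom_subst \<phi> m)"
  unfolding poly_subst_def using assms
  by (intro sum.mono_neutral_left) (auto simp: in_keys_iff)

lemma monom_subst_superset: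
  assumes "finite A" "Poly_Mapping.keys m \<subseteq> A"
  shows "monom_subst \<phi> m = (\<Prod>i\<in>A. \<phi> i ^ Poly_Mapping.lookup m i)"
  using assms by (intro prod.mono_neutral_left) (auto simp: in_keys_iff)

lemma monom_subst_add: "monom_subst \<phi> (m + n) = monom_subst \<phi> m * monom_subst \<phi> n"
proof -
  let ?A = "Poly_Mapping.keys m \<union> Poly_Mapping.keys n"
  have "monom_subst \<phi> (m + n) = (\<Prod>i\<in>?A. \<phi> i ^ Poly_Mapping.lookup (m + n) i)"
    using Poly_Mapping.keys_add[of m n] by (intro monom_subst_superset) auto
  also have "\<dots> = monom_subst \<phi> m * monom_subst \<phi> n"
    using monom_subst_superset[of ?A m \<phi>] monom_subst_superset[of ?A n \<phi>]
    by (simp add: lookup_add power_add prod.distrib)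
  finally show ?thesis .
qed

lemma poly_subst_add: "poly_subst \<phi> (f + g) = poly_subst \<phi> f + poly_subst \<phi> g"
proof -
  let ?A = "Poly_Mapping.keys f \<union> Poly_Mapping.keys g"
  have "poly_subst \<phi> (f + g) = (\<Sum>m\<in>?A. poly_const (Poly_Mapping.lookup (f + g) m) * monom_subst \<phi> m)"
    using Poly_Mapping.keys_add[of f g] by (intro poly_subst_superset) auto
  also have "\<dots> = poly_subst \<phi> f + poly_subst \<phi> g"
    using poly_subst_superset[of ?A f \<phi>] poly_subst_superset[of ?A g \<phi>]
    by (simp add: lookup_add poly_const_add distrib_right sum.distrib)
  finally show ?thesis .
qed

lemma poly_subst_zero [simp]: "poly_subst \<phi> 0 = 0"
  by (simp add: poly_subst_def)

lemma poly_subst_sum: "poly_subst \<phi> (sum f A) = (\<Sum>i\<in>A. poly_subst \<phi> (f i))"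
  by (induction A rule: infinite_finite_induct) (auto simp: poly_subst_add)

lemma poly_subst_single: "poly_subst \<phi> (Poly_Mapping.single m c) = poly_const c * monom_subst \<phi> m"
  by (subst poly_subst_superset[of "{m}"]) auto

lemma poly_mapping_sum_singles:
  "f = (\<Sum>m\<in>Poly_Mapping.keys f. Poly_Mapping.single m (Poly_Mapping.lookup f m))"
proof (rule poly_mapping_eqI)
  fix k
  have "(\<Sum>m\<in>Poly_Mapping.keys f. Poly_Mapping.lookup f m when m = k) = Poly_Mapping.lookup f k"
    by (cases "k \<in> Poly_Mapping.keys f")
      (auto simp: when_def in_keys_iff sum.delta if_distrib cong: if_cong)
  then show "Poly_Mapping.lookup f k =
      Poly_Mapping.lookup (\<Sum>m\<in>Poly_Mapping.keys f. Poly_Mapping.single m (Poly_Mapping.lookup f m)) k"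
    by (simp add: lookup_sum lookup_single)
qed

text \<open>Both sides are biadditive in f and g, which reduces the claim to single terms.\<close>

lemma poly_subst_mult: "poly_subst \<phi> (f * g) = poly_subst \<phi> f * poly_subst \<phi> g"
proof -
  let ?s = "\<lambda>f m. Poly_Mapping.single m (Poly_Mapping.lookup f m)"
  have 1: "poly_subst \<phi> (?s f m * ?s g n) = poly_subst \<phi> (?s f m) * poly_subst \<phi> (?s g n)" for m n
    unfolding mult_single[of m _ n] poly_subst_single monom_subst_add unfolding poly_const_mult
    by (simp only: mult_ac)
  have "f * g = (\<Sum>m\<in>Poly_Mapping.keys f. \<Sum>n\<in>Poly_Mapping.keys g. ?s f m * ?s g n)"
    unfolding sum_product[symmetric]
    by (rule arg_cong2[of _ _ _ _ "(*)"] poly_mapping_sum_singles)+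
  then have "poly_subst \<phi> (f * g) =
      (\<Sum>m\<in>Poly_Mapping.keys f. \<Sum>n\<in>Poly_Mapping.keys g. poly_subst \<phi> (?s f m) * poly_subst \<phi> (?s g n))"
    by (simp add: poly_subst_sum 1)
  also have "\<dots> = (\<Sum>m\<in>Poly_Mapping.keys f. poly_subst \<phi> (?s f m)) *
      (\<Sum>n\<in>Poly_Mapping.keys g. poly_subst \<phi> (?s g n))"
    by (simp add: sum_product)
  also have "\<dots> = poly_subst \<phi> f * poly_subst \<phi> g"
    unfolding poly_subst_sum[symmetric] by (simp flip: poly_mapping_sum_singles)
  finally show ?thesis .
qed

lemma poly_subst_const [simp]: "poly_subst \<phi> (poly_const c) = poly_const c"
  by (simp add: poly_subst_single)

lemma poly_subst_one [simp]: "poly_subst \<phi> 1 = 1"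
  using poly_subst_const[of \<phi> 1] by simp

lemma poly_subst_var [simp]: "poly_subst \<phi> (poly_var i) = \<phi> i"
  by (simp add: poly_subst_single)

lemma poly_subst_power: "poly_subst \<phi> (f ^ n) = poly_subst \<phi> f ^ n"
  by (induction n) (auto simp: poly_subst_mult)

lemma poly_subst_prod: "poly_subst \<phi> (prod f A) = (\<Prod>i\<in>A. poly_subst \<phi> (f i))"
  by (induction A rule: infinite_finite_induct) (auto simp: poly_subst_mult)

lemma poly_subst_subst: "poly_subst \<phi> (poly_subst \<psi> f) = poly_subst (\<lambda>i. poly_subst \<phi> (\<psi> i)) f"
  by (simp add: poly_subst_def[of \<psi>] poly_subst_def[of "\<lambda>i. poly_subst \<phi> (\<psi> i)"]
      poly_subst_sum poly_subst_mult poly_subst_prod poly_subst_power)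

lemma poly_subst_var_id: "poly_subst poly_var f = f"
proof -
  have "monom_subst poly_var m = Poly_Mapping.single m (1 :: 'a)" for m :: "nat \<Rightarrow>\<^sub>0 nat"
  proof -
    have pow: "poly_var i ^ n = (Poly_Mapping.single (Poly_Mapping.single i n) 1 :: 'a polynomial)" for i n
      by (induction n) (auto simp: mult_single single_add[symmetric])
    have "(\<Prod>i\<in>A. Poly_Mapping.single (e i) 1) = (Poly_Mapping.single (sum e A) 1 :: 'a polynomial)"
      if "finite A" for A and e :: "nat \<Rightarrow> nat \<Rightarrow>\<^sub>0 nat"
      using that by (induction A) (auto simp: mult_single)
    then show ?thesis by (simp add: pow flip: poly_mapping_sum_singles)
  qed
  then show ?thesis
    unfolding poly_subst_def by (simp add: mult_single flip: poly_mapping_sum_singles)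
qed

section \<open>The Weyl group action on the symmetric algebra\<close>

locale faithful_realization =
  fixes X :: "('w, 'k::field, 'v::ab_group_add) realization" (structure)
  assumes realization: "is_realization X" and faithful: "reflection_faithful X"
begin

lemma coxeter_system_X: "coxeter_system X"
  using realization by (simp add: is_realization_def)

sublocale coxeter_group X
proof
  have "group X" using coxeter_system_X by (simp add: coxeter_system_def)
  then interpret group X .
  show "\<And>x y. x \<in> carrier X \<Longrightarrow> y \<in> carrier X \<Longrightarrow> x \<otimes> y \<in> carrier X"
    "\<And>x y z. x \<in> carrier X \<Longrightarrow> y \<in> carrier X \<Longrightarrow> z \<in> carrier X \<Longrightarrow> x \<otimes> y \<otimes> z = x \<otimes> (y \<otimes> z)"
    "\<one> \<in> carrier X" "\<And>x. x \<in> carrier X \<Longrightarrow> \<one> \<otimes> x = x" "\<And>x. x \<in> carrier X \<Longrightarrow> x \<otimes> \<one> = x"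
    "carrier X \<subseteq> Units X"
    by (auto simp: m_assoc Units_eq)
qed (rule coxeter_system_X)

interpretation V: finite_dimensional_vector_space "scal X" "bas X ` {..<dimV X}"
  using realization by (simp add: is_realization_def)

lemma bas_inj: "inj_on (bas X) {..<dimV X}"
  using realization by (simp add: is_realization_def)

lemma coord_bas:
  assumes "i < dimV X" "j < dimV X"
  shows "coord X i (bas X j) = (if i = j then 1 else 0)"
  unfolding coord_def using assms bas_inj
  by (subst V.representation_basis[OF V.independent_Basis]) (auto simp: inj_on_eq_iff)

lemma coord_expansion: "v = (\<Sum>i<dimV X. scal X (coord X i v) (bas X i))"
proof -
  have "(\<Sum>b\<in>bas X ` {..<dimV X}. scal X (V.representation (bas X ` {..<dimV X}) v b) b) = v"
    using V.span_Basis by (intro V.sum_representation_eq V.independent_Basis) auto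
  then show ?thesis unfolding coord_def by (simp add: sum.reindex[OF bas_inj])
qed

lemma coord_linear: "Vector_Spaces.linear (scal X) (*) (coord X i)"
proof -
  interpret K: vector_space "(*) :: 'k \<Rightarrow> 'k \<Rightarrow> 'k"
    by unfold_locales (auto simp: algebra_simps)
  show ?thesis
    unfolding coord_def using V.span_Basis
    by unfold_locales (auto simp: V.representation_add V.representation_scale V.independent_Basis)
qed

lemma linear_expansion:
  assumes "Vector_Spaces.linear (scal X) (*) l"
  shows "l v = (\<Sum>i<dimV X. coord X i v * l (bas X i))"
proof -
  interpret L: Vector_Spaces.linear "scal X" "(*)" l by fact
  show ?thesis by (subst coord_expansion[of v]) (simp add: L.sum L.scale)
qed

lemma rep_linear: "w \<in> carrier X \<Longrightarrow> Vector_Spaces.linear (scal X) (scal X) (rep X w)"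
  using realization by (simp add: is_realization_def)

lemma rep_one: "rep X \<one> = id"
  using realization by (simp add: is_realization_def)

lemma rep_mult: "x \<in> carrier X \<Longrightarrow> y \<in> carrier X \<Longrightarrow> rep X (x \<otimes> y) = rep X x \<circ> rep X y"
  using realization by (simp add: is_realization_def)

lemma rep_inj: "inj_on (rep X) (carrier X)"
  using faithful by (simp add: reflection_faithful_def)

lemma linear_coord_rep:
  "w \<in> carrier X \<Longrightarrow> Vector_Spaces.linear (scal X) (*) (\<lambda>v. coord X i (rep X w v))"
  using Vector_Spaces.linear_compose[OF rep_linear coord_linear] by (simp add: o_def)

lemma weyl_act_subst:
  "weyl_act X w = poly_subst (\<lambda>i. linear_form X (\<lambda>v. coord X i (rep X (inv w) v)))"
  by (rule ext) (simp add: weyl_act_def poly_subst_def)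

lemma linear_form_alt: "linear_form X l = (\<Sum>i<dimV X. poly_const (l (bas X i)) * poly_var i)"
  by (simp add: linear_form_def mult_single)

lemma lookup_linear_form:
  assumes "j < dimV X"
  shows "Poly_Mapping.lookup (linear_form X l) (Poly_Mapping.single j (Suc 0)) = l (bas X j)"
proof -
  have "Poly_Mapping.single i (Suc 0) = Poly_Mapping.single j (Suc 0) \<longleftrightarrow> i = j" for i
    by (metis lookup_single_eq lookup_single_not_eq nat.distinct(1))
  then show ?thesis using assms
    by (simp add: linear_form_def lookup_sum lookup_single when_def)
qed

text \<open>On linear forms the substitution is the contragredient representation. The composition
  law of the action on all polynomials is read off from this.\<close>

lemma weyl_act_linear_form:
  assumes w: "w \<in> carrier X" and l: "Vector_Spaces.linear (scal X) (*) l"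
  shows "weyl_act X w (linear_form X l) = linear_form X (\<lambda>v. l (rep X (inv w) v))"
proof -
  have "weyl_act X w (linear_form X l) =
      (\<Sum>i<dimV X. poly_const (l (bas X i)) * linear_form X (\<lambda>v. coord X i (rep X (inv w) v)))"
    unfolding weyl_act_subst linear_form_alt[of l] by (simp add: poly_subst_sum poly_subst_mult)
  also have "\<dots> = (\<Sum>i<dimV X. \<Sum>j<dimV X.
      poly_const (coord X i (rep X (inv w) (bas X j)) * l (bas X i)) * poly_var j)"
    unfolding linear_form_alt sum_distrib_left by (simp add: poly_const_mult mult_ac)
  also have "\<dots> = (\<Sum>j<dimV X. poly_const (l (rep X (inv w) (bas X j))) * poly_var j)"
  proof (subst sum.swap, intro sum.cong refl)
    fix j
    have "poly_const (l (rep X (inv w) (bas X j))) =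
        (\<Sum>i<dimV X. poly_const (coord X i (rep X (inv w) (bas X j)) * l (bas X i)))"
      by (subst linear_expansion[OF l]) (rule poly_const_sum)
    then show "(\<Sum>i<dimV X. poly_const (coord X i (rep X (inv w) (bas X j)) * l (bas X i)) * poly_var j) =
        poly_const (l (rep X (inv w) (bas X j))) * poly_var j"
      by (simp add: sum_distrib_right)
  qed
  finally show ?thesis unfolding linear_form_alt .
qed

lemma sym_ring_const: "poly_const c \<in> sym_ring X"
  by (auto simp: sym_ring_def)

lemma sym_ring_var: "i < dimV X \<Longrightarrow> poly_var i \<in> sym_ring X"
  by (auto simp: sym_ring_def)

lemma sym_ring_add: "f \<in> sym_ring X \<Longrightarrow> g \<in> sym_ring X \<Longrightarrow> f + g \<in> sym_ring X"
  unfolding sym_ring_def using Poly_Mapping.keys_add[of f g] by blast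

lemma sym_ring_uminus: "f \<in> sym_ring X \<Longrightarrow> - f \<in> sym_ring X"
  by (auto simp: sym_ring_def in_keys_iff)

lemma sym_ring_mult:
  assumes "f \<in> sym_ring X" "g \<in> sym_ring X"
  shows "f * g \<in> sym_ring X"
  unfolding sym_ring_def
proof (intro CollectI ballI)
  fix m assume "m \<in> Poly_Mapping.keys (f * g)"
  then obtain a b where "m = a + b" "a \<in> Poly_Mapping.keys f" "b \<in> Poly_Mapping.keys g"
    using keys_mult[of f g] by blast
  then show "Poly_Mapping.keys m \<subseteq> {..<dimV X}"
    using assms Poly_Mapping.keys_add[of a b] unfolding sym_ring_def by blast
qed

lemma sym_ring_one: "1 \<in> sym_ring X"
  using sym_ring_const[of 1] by simp

lemma sym_ring_sum: "(\<And>i. i \<in> A \<Longrightarrow> f i \<in> sym_ring X) \<Longrightarrow> sum f A \<in> sym_ring X"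
  using sym_ring_const[of 0] by (induction A rule: infinite_finite_induct) (auto intro: sym_ring_add)

lemma sym_ring_prod: "(\<And>i. i \<in> A \<Longrightarrow> f i \<in> sym_ring X) \<Longrightarrow> prod f A \<in> sym_ring X"
  using sym_ring_one by (induction A rule: infinite_finite_induct) (auto intro: sym_ring_mult)

lemma sym_ring_power: "f \<in> sym_ring X \<Longrightarrow> f ^ n \<in> sym_ring X"
  using sym_ring_one by (induction n) (auto intro: sym_ring_mult)

lemma sym_ring_linear_form: "linear_form X l \<in> sym_ring X"
  unfolding linear_form_alt
  by (intro sym_ring_sum sym_ring_mult sym_ring_const sym_ring_var) simp

lemma weyl_act_sym_ring: "weyl_act X w f \<in> sym_ring X"
  unfolding weyl_act_subst poly_subst_def
  by (intro sym_ring_sum sym_ring_mult sym_ring_const sym_ring_prod sym_ring_power sym_ring_linear_form)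

text \<open>The substitution attached to a group element gives no control over variables of index at
  least dim V, so the action laws are only claimed on \<open>sym_ring X\<close>, where such
  variables do not occur.\<close>

lemma poly_subst_cong:
  assumes "f \<in> sym_ring X" "\<And>i. i < dimV X \<Longrightarrow> \<phi> i = \<psi> i"
  shows "poly_subst \<phi> f = poly_subst \<psi> f"
  unfolding poly_subst_def using assms
  by (intro sum.cong prod.cong refl arg_cong2[of _ _ _ _ "(*)"]) (auto simp: sym_ring_def subset_iff)

lemma linear_form_coord: "i < dimV X \<Longrightarrow> linear_form X (coord X i) = poly_var i"
  unfolding linear_form_alt by (simp add: coord_bas if_distrib[of poly_const] if_distrib[of "\<lambda>x. x * _"] sum.delta cong: if_cong)

sublocale ring_action X "sym_ring X" "weyl_act X"
proof
  show "1 \<in> sym_ring X" by (rule sym_ring_one)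
  show "a + b \<in> sym_ring X" "a * b \<in> sym_ring X" if "a \<in> sym_ring X" "b \<in> sym_ring X" for a b
    using that by (auto intro: sym_ring_add sym_ring_mult)
  show "- a \<in> sym_ring X" if "a \<in> sym_ring X" for a
    using that by (rule sym_ring_uminus)
  show "weyl_act X g a \<in> sym_ring X" for g a
    by (rule weyl_act_sym_ring)
  show "weyl_act X g (a + b) = weyl_act X g a + weyl_act X g b"
    "weyl_act X g (a * b) = weyl_act X g a * weyl_act X g b" "weyl_act X g 1 = 1" for g a b
    by (simp_all add: weyl_act_subst poly_subst_add poly_subst_mult)
  show "weyl_act X \<one> a = a" if "a \<in> sym_ring X" for a
    using poly_subst_cong[OF that, of _ poly_var]
    by (simp add: weyl_act_subst rep_one linear_form_coord poly_subst_var_id)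
  show "weyl_act X (g \<otimes> h) a = weyl_act X g (weyl_act X h a)"
    if "g \<in> carrier X" "h \<in> carrier X" "a \<in> sym_ring X" for g h a
    unfolding weyl_act_subst[of h] weyl_act_subst[of "g \<otimes> h"]
    unfolding weyl_act_subst[of g] poly_subst_subst
    unfolding weyl_act_subst[of g, symmetric] using that
    by (simp add: weyl_act_linear_form linear_coord_rep inv_mult_group rep_mult)
  show "\<exists>a\<in>sym_ring X. weyl_act X g a \<noteq> weyl_act X h a"
    if gh: "g \<in> carrier X" "h \<in> carrier X" "g \<noteq> h" for g h
  proof (rule ccontr)
    assume "\<not> ?thesis"
    then have "weyl_act X g (poly_var i) = weyl_act X h (poly_var i)" if "i < dimV X" for i
      using sym_ring_var[OF that] by blast
    then have "linear_form X (\<lambda>v. coord X i (rep X (inv g) v)) =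
        linear_form X (\<lambda>v. coord X i (rep X (inv h) v))" if "i < dimV X" for i
      using that by (simp add: weyl_act_subst)
    \<comment> \<open>Comparing coefficients of the linear forms shows that
      \<open>rep X (inv g)\<close> and \<open>rep X (inv h)\<close> have the same matrix, and the
      representation is faithful.\<close>
    then have *: "coord X i (rep X (inv g) (bas X j)) = coord X i (rep X (inv h) (bas X j))"
      if "i < dimV X" "j < dimV X" for i j
      using that lookup_linear_form by metis
    have "rep X (inv g) v = rep X (inv h) v" for v
    proof -
      have "coord X i (rep X (inv g) v) = coord X i (rep X (inv h) v)" if "i < dimV X" for i
        using linear_expansion[OF linear_coord_rep[of "inv g" i], of v]
          linear_expansion[OF linear_coord_rep[of "inv h" i], of v] gh that by (simp add: *)
      then have "(\<Sum>i<dimV X. scal X (coord X i (rep X (inv g) v)) (bas X i)) =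
          (\<Sum>i<dimV X. scal X (coord X i (rep X (inv h) v)) (bas X i))"
        by (intro sum.cong) auto
      then show ?thesis
        using coord_expansion[of "rep X (inv g) v"] coord_expansion[of "rep X (inv h) v"] by simp
    qed
    then have "inv g = inv h" using rep_inj gh by (simp add: inj_on_def fun_eq_iff)
    then show False using gh inv_inv by metis
  qed
qed

lemma invariants_fixed: "invariants X I = fixed (parabolic X I)"
  by (simp add: invariants_def fixed_def)

end

section \<open>Functionals on tensor products\<close>

text \<open>These conditions say that \<open>\<psi>\<close> kills \<open>bs_relations\<close> and
  hence descends to the tensor product (\<open>bs_lift_class\<close>). Staying on tuples makes it
  possible to strip the first factor without an associativity isomorphism.\<close>

definition tensor_functional ::
    "('w, 'k::field, 'v::ab_group_add) realization \<Rightarrow> 'w set list \<Rightarrow>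
     ('k polynomial list \<Rightarrow> 'a::ab_group_add) \<Rightarrow> bool" where
  "tensor_functional X Is \<psi> \<longleftrightarrow> (\<forall>a\<in>bs_tuples X Is.
     (\<forall>i<length Is. \<forall>b\<in>bs_entry X Is i. \<forall>c\<in>bs_entry X Is i.
        \<psi> (a[i := b + c]) = \<psi> (a[i := b]) + \<psi> (a[i := c])) \<and>
     (\<forall>i. Suc i < length Is \<longrightarrow> (\<forall>r\<in>invariants X (Is ! i).
        \<psi> (a[i := a ! i * r]) = \<psi> (a[Suc i := r * a ! Suc i]))))"

text \<open>The left twist z is a separate parameter because it runs along a path in
  \<open>tensor_functional_support\<close> while the right twist w stays fixed.\<close>

definition twisted_linear ::
    "('w, 'k::field, 'v::ab_group_add) realization \<Rightarrow> 'w set list \<Rightarrow> 'w \<Rightarrow> 'w \<Rightarrow>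
     ('k polynomial list \<Rightarrow> 'k polynomial) \<Rightarrow> bool" where
  "twisted_linear X Is z w \<psi> \<longleftrightarrow> (\<forall>a\<in>bs_tuples X Is.
     (\<forall>r\<in>invariants X (hd Is). \<psi> (a[0 := r * a ! 0]) = weyl_act X z r * \<psi> a) \<and>
     (\<forall>r\<in>invariants X (last Is).
        \<psi> (a[length Is - 1 := a ! (length Is - 1) * r]) = weyl_act X w r * \<psi> a))"

lemma tensor_functionalD:
  assumes "tensor_functional X Is \<psi>" "a \<in> bs_tuples X Is"
  shows "i < length Is \<Longrightarrow> b \<in> bs_entry X Is i \<Longrightarrow> c \<in> bs_entry X Is i \<Longrightarrow>
      \<psi> (a[i := b + c]) = \<psi> (a[i := b]) + \<psi> (a[i := c])"
    and "Suc i < length Is \<Longrightarrow> r \<in> invariants X (Is ! i) \<Longrightarrow>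
      \<psi> (a[i := a ! i * r]) = \<psi> (a[Suc i := r * a ! Suc i])"
  using assms by (auto simp: tensor_functional_def)

lemma twisted_linearD:
  assumes "twisted_linear X Is z w \<psi>" "a \<in> bs_tuples X Is"
  shows "r \<in> invariants X (hd Is) \<Longrightarrow> \<psi> (a[0 := r * a ! 0]) = weyl_act X z r * \<psi> a"
    and "r \<in> invariants X (last Is) \<Longrightarrow>
      \<psi> (a[length Is - 1 := a ! (length Is - 1) * r]) = weyl_act X w r * \<psi> a"
  using assms by (auto simp: twisted_linear_def)

lemma bs_tuples_length: "a \<in> bs_tuples X Is \<Longrightarrow> length a = length Is"
  by (simp add: bs_tuples_def)

lemma bs_tuples_entry: "a \<in> bs_tuples X Is \<Longrightarrow> i < length Is \<Longrightarrow> a ! i \<in> bs_entry X Is i"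
  by (simp add: bs_tuples_def)

lemma bs_tuples_update:
  "a \<in> bs_tuples X Is \<Longrightarrow> b \<in> bs_entry X Is i \<Longrightarrow> a[i := b] \<in> bs_tuples X Is"
  by (simp add: bs_tuples_def) (metis nth_list_update_eq nth_list_update_neq)

context faithful_realization
begin

section \<open>Invariant rings and the support of a functional\<close>

lemma invariants_one: "I \<subseteq> S \<Longrightarrow> 1 \<in> invariants X I"
  and invariants_zero: "I \<subseteq> S \<Longrightarrow> 0 \<in> invariants X I"
  and invariants_mult:
    "I \<subseteq> S \<Longrightarrow> a \<in> invariants X I \<Longrightarrow> b \<in> invariants X I \<Longrightarrow> a * b \<in> invariants X I"
  and invariants_add:
    "I \<subseteq> S \<Longrightarrow> a \<in> invariants X I \<Longrightarrow> b \<in> invariants X I \<Longrightarrow> a + b \<in> invariants X I"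
  and invariants_uminus: "I \<subseteq> S \<Longrightarrow> a \<in> invariants X I \<Longrightarrow> - a \<in> invariants X I"
  unfolding invariants_fixed using fixed_closed[of "parabolic X I"] subgroup.subset[OF parabolic_subgroup]
  by auto

lemma invariants_antimono: "I \<subseteq> J \<Longrightarrow> invariants X J \<subseteq> invariants X I"
  unfolding invariants_fixed by (intro fixed_mono parabolic_mono)

lemma invariants_sym_ring: "r \<in> invariants X I \<Longrightarrow> r \<in> sym_ring X"
  by (simp add: invariants_def)

lemma bs_entry_mult:
  assumes "\<forall>I\<in>set Is. I \<subseteq> S" "i < length Is" "a \<in> bs_entry X Is i" "b \<in> bs_entry X Is i"
  shows "a * b \<in> bs_entry X Is i" "a + b \<in> bs_entry X Is i"
proof -
  have "Is ! i \<subseteq> S" "Is ! 0 \<subseteq> S"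
    using assms(1) nth_mem[OF assms(2)] nth_mem[OF order.strict_trans1[OF le0 assms(2)]] by blast+
  moreover have "Is ! (i - 1) \<inter> Is ! i \<subseteq> S" using \<open>Is ! i \<subseteq> S\<close> by blast
  ultimately show "a * b \<in> bs_entry X Is i" "a + b \<in> bs_entry X Is i"
    using assms(3,4) by (auto simp: bs_entry_def intro: invariants_mult invariants_add)
qed

lemma bs_entry_one:
  assumes "\<forall>I\<in>set Is. I \<subseteq> S" "i < length Is"
  shows "1 \<in> bs_entry X Is i" "0 \<in> bs_entry X Is i"
proof -
  have "Is ! i \<subseteq> S" "Is ! 0 \<subseteq> S"
    using assms(1) nth_mem[OF assms(2)] nth_mem[OF order.strict_trans1[OF le0 assms(2)]] by blast+
  moreover have "Is ! (i - 1) \<inter> Is ! i \<subseteq> S" using \<open>Is ! i \<subseteq> S\<close> by blast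
  ultimately show "1 \<in> bs_entry X Is i" "0 \<in> bs_entry X Is i"
    by (auto simp: bs_entry_def intro: invariants_one invariants_zero)
qed

lemma invariants_bs_entry: "r \<in> invariants X (Is ! i) \<Longrightarrow> r \<in> bs_entry X Is i"
  using invariants_antimono[of "Is ! (i - 1) \<inter> Is ! i" "Is ! i"] by (auto simp: bs_entry_def)

lemma invariants_bs_entry_Suc: "r \<in> invariants X (Is ! i) \<Longrightarrow> r \<in> bs_entry X Is (Suc i)"
  using invariants_antimono[of "Is ! i \<inter> Is ! Suc i" "Is ! i"] by (auto simp: bs_entry_def)

text \<open>The new second entry lies in $R^{I \cap J}$ and not in $R^J$, so \<open>r\<close> only has to be
  invariant under $W_{I \cap J}$.\<close>

definition extend_tuple :: "'k polynomial \<Rightarrow> 'k polynomial list \<Rightarrow> 'k polynomial list" where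
  "extend_tuple r l = 1 # r * hd l # tl l"

lemma extend_tuple_nth_Suc:
  "l \<noteq> [] \<Longrightarrow> extend_tuple r l ! Suc i = (if i = 0 then r * l ! 0 else l ! i)"
  by (cases l) (auto simp: extend_tuple_def nth_Cons split: nat.splits)

lemma extend_tuple_update:
  "l \<noteq> [] \<Longrightarrow> extend_tuple r (l[i := b]) = (extend_tuple r l)[Suc i := if i = 0 then r * b else b]"
  by (cases l; cases i) (auto simp: extend_tuple_def)

lemma bs_entry_Cons_Suc:
  "bs_entry X (I # J # Is) (Suc i) = (if i = 0 then invariants X (I \<inter> J) else bs_entry X (J # Is) i)"
  by (cases i) (auto simp: bs_entry_def)

lemma extend_tuple_in:
  assumes "I \<subseteq> S" "J \<subseteq> S" "r \<in> invariants X (I \<inter> J)" "l \<in> bs_tuples X (J # Is)"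
  shows "extend_tuple r l \<in> bs_tuples X (I # J # Is)"
proof -
  have l: "l \<noteq> []" "length l = Suc (length Is)" using bs_tuples_length[OF assms(4)] by auto
  have "l ! 0 \<in> invariants X J" using bs_tuples_entry[OF assms(4), of 0] by (simp add: bs_entry_def)
  then have "l ! 0 \<in> invariants X (I \<inter> J)" using invariants_antimono[of "I \<inter> J" J] by auto
  then have r: "r * l ! 0 \<in> invariants X (I \<inter> J)" using assms by (intro invariants_mult) auto
  have "extend_tuple r l ! i \<in> bs_entry X (I # J # Is) i" if "i < Suc (Suc (length Is))" for i
  proof (cases i)
    case 0
    then show ?thesis using invariants_one[OF assms(1)] by (simp add: extend_tuple_def bs_entry_def)
  next
    case (Suc j)
    then show ?thesis using r that bs_tuples_entry[OF assms(4), of j] l(1)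
      by (auto simp: extend_tuple_nth_Suc bs_entry_Cons_Suc)
  qed
  then show ?thesis unfolding bs_tuples_def using l by (auto simp: extend_tuple_def)
qed

text \<open>The redundant first factor R^J of the shorter tensor product is absorbed into the entry
  from R^{I \<inter> J}, so the relations of the tail are relations of the longer product one
  position further on.\<close>

lemma extend_tuple_functional:
  assumes IS: "I \<subseteq> S" "J \<subseteq> S" "\<forall>K\<in>set Is. K \<subseteq> S" and \<psi>: "tensor_functional X (I # J # Is) \<psi>"
    and r: "r \<in> invariants X (I \<inter> J)"
  shows "tensor_functional X (J # Is) (\<lambda>l. \<psi> (extend_tuple r l))"
  unfolding tensor_functional_def
proof (intro ballI conjI allI impI)
  fix a i b c
  assume a: "a \<in> bs_tuples X (J # Is)" and i: "i < length (J # Is)"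
    and bc: "b \<in> bs_entry X (J # Is) i" "c \<in> bs_entry X (J # Is) i"
  have ne: "a \<noteq> []" using bs_tuples_length[OF a] by auto
  note t = extend_tuple_in[OF IS(1,2) r a]
  have rm: "r * d \<in> invariants X (I \<inter> J)" if "d \<in> invariants X J" for d
    using that invariants_antimono[of "I \<inter> J" J] IS r by (intro invariants_mult) auto
  show "\<psi> (extend_tuple r (a[i := b + c])) =
      \<psi> (extend_tuple r (a[i := b])) + \<psi> (extend_tuple r (a[i := c]))"
    using tensor_functionalD(1)[OF \<psi> t, of "Suc i"] i bc rm
    by (cases "i = 0") (auto simp: extend_tuple_update[OF ne] bs_entry_Cons_Suc distrib_left bs_entry_def)
next
  fix a i s
  assume a: "a \<in> bs_tuples X (J # Is)" and i: "Suc i < length (J # Is)"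
    and s: "s \<in> invariants X ((J # Is) ! i)"
  have ne: "a \<noteq> []" using bs_tuples_length[OF a] by auto
  note t = extend_tuple_in[OF IS(1,2) r a]
  show "\<psi> (extend_tuple r (a[i := a ! i * s])) = \<psi> (extend_tuple r (a[Suc i := s * a ! Suc i]))"
    using tensor_functionalD(2)[OF \<psi> t, of "Suc i" s] i s
    by (cases "i = 0") (simp_all add: extend_tuple_update[OF ne] extend_tuple_nth_Suc[OF ne] mult.assoc)
qed

lemma tensor_functional_sum_list:
  assumes "\<And>x. x \<in> set xs \<Longrightarrow> tensor_functional X Is (\<psi> x)"
  shows "tensor_functional X Is (\<lambda>a. \<Sum>x\<leftarrow>xs. c x * \<psi> x a :: 'k polynomial)"
  using assms
proof (induction xs)
  case Nil
  then show ?case by (simp add: tensor_functional_def)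
next
  case (Cons x xs)
  then have "tensor_functional X Is (\<psi> x)" "tensor_functional X Is (\<lambda>a. \<Sum>x\<leftarrow>xs. c x * \<psi> x a)"
    by simp_all
  then show ?case unfolding tensor_functional_def by (simp add: distrib_left)
qed

text \<open>The support of a Bott-Samelson bimodule: by Galois theory for $R^{I \cap J}$ over $R^I$ a
  functional on a tensor product splits, up to nonzero factors, into functionals on the tensor product
  without the first factor, twisted by the elements of $W_I$.\<close>

lemma tensor_functional_support:
  assumes "\<forall>I\<in>set Is. finitary X I" "Is \<noteq> []" "z \<in> carrier X" "w \<in> carrier X"
    and "tensor_functional X Is \<psi>" "twisted_linear X Is z w \<psi>" "a \<in> bs_tuples X Is" "\<psi> a \<noteq> 0"
  shows "inv z \<otimes> w \<in> path_set X Is"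
  using assms
proof (induction Is arbitrary: z \<psi> a)
  case (Cons I Is)
  note z = Cons.prems(3) and w = Cons.prems(4) and \<psi> = Cons.prems(5) and tw = Cons.prems(6)
  have I: "finitary X I" "I \<subseteq> S" using Cons.prems finitaryD by auto
  have IsS: "\<forall>K\<in>set Is. K \<subseteq> S" using Cons.prems finitaryD by auto
  note K = parabolic_subgroup[OF I(2)] finitaryD(2)[OF I(1)]
  show ?case
  proof (cases Is)
    case Nil
    have la: "length a = 1" using bs_tuples_length[OF Cons.prems(7)] Nil by simp
    have a0: "a ! 0 \<in> invariants X I"
      using bs_tuples_entry[OF Cons.prems(7), of 0] by (simp add: bs_entry_def)
    have one: "[1] \<in> bs_tuples X [I]" using invariants_one[OF I(2)] by (simp add: bs_tuples_def bs_entry_def)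
    \<comment> \<open>On the single factor R^I the functional is determined by its value at 1. Left
      and right linearity then force z and w to agree on R^I, and by \<open>fixed_separates\<close>
      they differ by an element of W_I.\<close>
    have L: "\<psi> [r] = weyl_act X z r * \<psi> [1]" and R: "\<psi> [r] = weyl_act X w r * \<psi> [1]"
      if "r \<in> invariants X I" for r
      using twisted_linearD(1)[OF tw, of "[1]" r] twisted_linearD(2)[OF tw, of "[1]" r] one that Nil
      by auto
    have "a = [a ! 0]" using la by (cases a) auto
    then have "\<psi> [1] \<noteq> 0" using L[OF a0] Cons.prems(8) by auto
    then have eq: "weyl_act X z r = weyl_act X w r" if "r \<in> invariants X I" for r
      using L[OF that] R[OF that] by simp
    have "weyl_act X (inv z \<otimes> w) r = r" if "r \<in> invariants X I" for r
      using eq[OF that] z w invariants_sym_ring[OF that]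
      by (simp add: act_comp) (metis act_inv_cancel(2))
    then have "inv z \<otimes> w \<in> parabolic X I"
      using fixed_separates[OF K, of "inv z \<otimes> w"] z w unfolding invariants_fixed by auto
    then show ?thesis using path_setI[of "inv z \<otimes> w" I \<one> "[]"] Nil z w by simp
  next
    case (Cons J Is')
    have J: "finitary X J" "J \<subseteq> S" using Cons.prems(1) Cons finitaryD by auto
    have IJ: "I \<inter> J \<subseteq> S" using I by blast
    have Hs: "subgroup (parabolic X (I \<inter> J)) X" "parabolic X (I \<inter> J) \<subseteq> parabolic X I"
      using parabolic_subgroup[OF IJ] parabolic_mono[of "I \<inter> J" I] by auto
    note tc = twisted_functional_coeffs[OF K Hs, folded invariants_fixed]
    obtain qs where qs: "set qs \<subseteq> sym_ring X \<times> invariants X (I \<inter> J)"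
      and coeff: "\<forall>z\<in>carrier X. \<forall>\<theta>.
        (\<forall>a\<in>invariants X (I \<inter> J). \<forall>b\<in>invariants X (I \<inter> J). \<theta> (a + b) = \<theta> a + \<theta> b) \<longrightarrow>
        (\<forall>a\<in>invariants X I. \<forall>b\<in>invariants X (I \<inter> J). \<theta> (a * b) = weyl_act X z a * \<theta> b) \<longrightarrow>
        (\<forall>g\<in>parabolic X I. \<forall>b\<in>invariants X (I \<inter> J).
          twist_coeff qs (z \<otimes> g) (\<lambda>r. \<theta> (b * r)) = weyl_act X (z \<otimes> g) b * twist_coeff qs (z \<otimes> g) \<theta>) \<and>
        ((\<forall>g\<in>parabolic X I. twist_coeff qs (z \<otimes> g) \<theta> = 0) \<longrightarrow> (\<forall>a\<in>invariants X (I \<inter> J). \<theta> a = 0))"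
      using tc by (elim exE conjE) (rule that)
    note coeff = coeff[rule_format, THEN conjunct1, rule_format] coeff[rule_format, THEN conjunct2, rule_format]
    have JIJ: "r \<in> invariants X (I \<inter> J)" if "r \<in> invariants X J" for r
      using that invariants_antimono[of "I \<inter> J" J] by auto
    have IIJ: "r \<in> invariants X (I \<inter> J)" if "r \<in> invariants X I" for r
      using that invariants_antimono[of "I \<inter> J" I] by auto
    \<comment> \<open>With the tail l frozen, this is a functional of the entry in R^{I \<inter> J}
      that is R^I-linear up to the twist z.\<close>
    define \<theta> where "\<theta> l r = \<psi> (extend_tuple r l)" for l r
    have \<theta>_add: "\<theta> l (r + s) = \<theta> l r + \<theta> l s"
      if l: "l \<in> bs_tuples X Is" and rs: "r \<in> invariants X (I \<inter> J)" "s \<in> invariants X (I \<inter> J)" for l r s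
    proof -
      have ne: "l \<noteq> []" using bs_tuples_length[OF l] Cons by auto
      have l0: "hd l \<in> invariants X J"
        using bs_tuples_entry[OF l, of 0] Cons ne by (simp add: bs_entry_def hd_conv_nth)
      have t: "extend_tuple r l \<in> bs_tuples X (I # Is)"
        using extend_tuple_in[OF I(2) J(2) rs(1)] l Cons by simp
      have "\<psi> ((extend_tuple r l)[1 := r * hd l + s * hd l]) =
          \<psi> ((extend_tuple r l)[1 := r * hd l]) + \<psi> ((extend_tuple r l)[1 := s * hd l])"
        using tensor_functionalD(1)[OF \<psi> t, of 1 "r * hd l" "s * hd l"] Cons rs JIJ[OF l0] IJ
        by (simp add: bs_entry_def invariants_mult)
      then show ?thesis unfolding \<theta>_def by (simp add: extend_tuple_def distrib_right)
    qed
    have \<theta>_lin: "\<theta> l (r * s) = weyl_act X z r * \<theta> l s"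
      if l: "l \<in> bs_tuples X Is" and rs: "r \<in> invariants X I" "s \<in> invariants X (I \<inter> J)" for l r s
    proof -
      have t: "extend_tuple s l \<in> bs_tuples X (I # Is)"
        using extend_tuple_in[OF I(2) J(2) rs(2)] l Cons by simp
      have "\<psi> ((extend_tuple s l)[0 := r]) = \<psi> ((extend_tuple s l)[1 := r * (s * hd l)])"
        using tensor_functionalD(2)[OF \<psi> t, of 0 r] Cons rs by (simp add: extend_tuple_def)
      moreover have "\<psi> ((extend_tuple s l)[0 := r]) = weyl_act X z r * \<psi> (extend_tuple s l)"
        using twisted_linearD(1)[OF tw t, of r] rs by (simp add: extend_tuple_def)
      ultimately show ?thesis unfolding \<theta>_def by (simp add: extend_tuple_def mult.assoc)
    qed
    have la: "length a = length (I # Is)" using bs_tuples_length[OF Cons.prems(7)] .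
    then obtain a0 a1 t where a: "a = a0 # a1 # t" using Cons by (auto simp: length_Suc_conv)
    have a01: "a0 \<in> invariants X I" "a1 \<in> invariants X (I \<inter> J)"
      using bs_tuples_entry[OF Cons.prems(7), of 0] bs_tuples_entry[OF Cons.prems(7), of 1] Cons a
      by (auto simp: bs_entry_def)
    \<comment> \<open>The entry a1 need not lie in R^J, so it becomes the argument r and the tail
      starts with 1 instead.\<close>
    have l: "1 # t \<in> bs_tuples X Is"
      unfolding bs_tuples_def
    proof (intro CollectI conjI allI impI)
      show "length (1 # t) = length Is" using la a by simp
      fix i assume "i < length Is"
      then show "(1 # t) ! i \<in> bs_entry X Is i"
        using bs_tuples_entry[OF Cons.prems(7), of "Suc i"] invariants_one[OF J(2)] Cons a
        by (cases i) (auto simp: bs_entry_def)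
    qed
    have "\<psi> a = weyl_act X z a0 * \<theta> (1 # t) a1"
    proof -
      have "extend_tuple a1 (1 # t) \<in> bs_tuples X (I # Is)"
        using extend_tuple_in[OF I(2) J(2) a01(2)] l Cons by simp
      from twisted_linearD(1)[OF tw this, of a0] show ?thesis
        using a01 by (simp add: \<theta>_def a extend_tuple_def)
    qed
    then have "\<theta> (1 # t) a1 \<noteq> 0" using Cons.prems(8) by auto
    \<comment> \<open>Some coefficient does not vanish. Passing to it removes the first tensor
      factor and moves the left twist from z to zg.\<close>
    then obtain g where g: "g \<in> parabolic X I" "twist_coeff qs (z \<otimes> g) (\<theta> (1 # t)) \<noteq> 0"
      using coeff(2)[OF z \<theta>_add[OF l] \<theta>_lin[OF l] _ a01(2)] by blast
    have gc: "g \<in> carrier X" using g parabolic_carrier[OF I(2)] by blast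
    define \<psi>' where "\<psi>' l = twist_coeff qs (z \<otimes> g) (\<theta> l)" for l
    have \<psi>'_alt: "\<psi>' = (\<lambda>l. \<Sum>x\<leftarrow>qs. weyl_act X (z \<otimes> g) (fst x) * \<psi> (extend_tuple (snd x) l))"
      by (simp add: fun_eq_iff \<psi>'_def twist_coeff_def \<theta>_def case_prod_unfold)
    have "tensor_functional X Is \<psi>'"
      unfolding \<psi>'_alt
    proof (rule tensor_functional_sum_list)
      fix x assume "x \<in> set qs"
      then have "snd x \<in> invariants X (I \<inter> J)" using qs by auto
      then show "tensor_functional X Is (\<lambda>l. \<psi> (extend_tuple (snd x) l))"
        using extend_tuple_functional[of I J Is' \<psi>] \<psi> I J IsS Cons by simp
    qed
    moreover have "twisted_linear X Is (z \<otimes> g) w \<psi>'"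
      unfolding twisted_linear_def
    proof (intro ballI conjI)
      fix l r assume l: "l \<in> bs_tuples X Is" and r: "r \<in> invariants X (hd Is)"
      have ne: "l \<noteq> []" using bs_tuples_length[OF l] Cons by auto
      have rJ: "r \<in> invariants X (I \<inter> J)" using r JIJ Cons by simp
      \<comment> \<open>An element of R^J acting on the left of the tail can be read as a multiplier
        of the argument of \<theta>, where the coefficient transforms by zg.\<close>
      have "\<theta> (l[0 := r * l ! 0]) = (\<lambda>s. \<theta> l (r * s))"
        using ne by (cases l) (auto simp: \<theta>_def extend_tuple_def fun_eq_iff ac_simps)
      then show "\<psi>' (l[0 := r * l ! 0]) = weyl_act X (z \<otimes> g) r * \<psi>' l"
        using coeff(1)[OF z \<theta>_add[OF l] \<theta>_lin[OF l] g(1) rJ] by (simp add: \<psi>'_def)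
    next
      fix l r assume l: "l \<in> bs_tuples X Is" and r: "r \<in> invariants X (last Is)"
      let ?n = "length Is - 1"
      have ne: "l \<noteq> []" using bs_tuples_length[OF l] Cons by auto
      have n: "length (I # Is) - 1 = Suc ?n" using Cons by simp
      have "\<psi> (extend_tuple s (l[?n := l ! ?n * r])) = weyl_act X w r * \<psi> (extend_tuple s l)"
        if s: "s \<in> invariants X (I \<inter> J)" for s
      proof -
        have t: "extend_tuple s l \<in> bs_tuples X (I # Is)"
          using extend_tuple_in[OF I(2) J(2) s] l Cons by simp
        show ?thesis using twisted_linearD(2)[OF tw t, of r] r Cons unfolding n
          by (simp add: extend_tuple_update[OF ne] extend_tuple_nth_Suc[OF ne] mult.assoc split: if_splits)
      qed
      then show "\<psi>' (l[?n := l ! ?n * r]) = weyl_act X w r * \<psi>' l"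
        unfolding \<psi>'_alt sum_list_const_mult[symmetric] using qs
        by (intro arg_cong[of _ _ sum_list] map_cong refl) (auto simp: mult.left_commute)
    qed
    moreover have "\<psi>' (1 # t) \<noteq> 0" using g by (simp add: \<psi>'_def)
    ultimately have "inv (z \<otimes> g) \<otimes> w \<in> path_set X Is"
      using Cons.IH[of "z \<otimes> g" \<psi>' "1 # t"] Cons.prems(1) Cons z w gc l by simp
    moreover have "inv z \<otimes> w = g \<otimes> (inv (z \<otimes> g) \<otimes> w)"
      using z w gc by (simp add: inv_mult_group m_assoc)
    ultimately show ?thesis using path_setI[OF g(1)] by simp
  qed
qed simp

end

section \<open>Bott-Samelson bimodules\<close>

lemma bs_class_iff: "y \<in> bs_class X Is x \<longleftrightarrow> y - x \<in> bs_kernel X Is"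
  unfolding bs_class_def r_coset_def by (auto simp: algebra_simps) (metis add_diff_cancel_left' diff_add_cancel)

text \<open>Both outer actions are of this form, with n the first or the last position; so is the
  action of R^{LR(p)}, at the position where the removal ends
  (\<open>redundancy_action_mul\<close>).\<close>

definition bs_mul ::
    "('w, 'k::field, 'v::ab_group_add) realization \<Rightarrow> 'w set list \<Rightarrow> nat \<Rightarrow> 'k polynomial \<Rightarrow>
     'k bs_elt \<Rightarrow> 'k bs_elt" where
  "bs_mul X Is n r = bs_induced X Is (\<lambda>a. a[n := a ! n * r])"

lemma BS_simps [simp]:
  "carrier (BS X Is) = carrier (bs_group X Is)"
  "\<zero>\<^bsub>BS X Is\<^esub> = \<one>\<^bsub>bs_group X Is\<^esub>"
  "add (BS X Is) = mult (bs_group X Is)"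
  "smult (BS X Is) = bs_mul X Is 0"
  "rsmult (BS X Is) = bs_mul X Is (length Is - 1)"
  "grade (BS X Is) = bs_grade X Is"
  by (simp_all add: BS_def bs_mul_def mult.commute fun_eq_iff)

definition frag_eval :: "('a \<Rightarrow> 'r::comm_ring_1) \<Rightarrow> ('a \<Rightarrow>\<^sub>0 int) \<Rightarrow> 'r" where
  "frag_eval \<psi> x = (\<Sum>a\<in>Poly_Mapping.keys x. of_int (Poly_Mapping.lookup x a) * \<psi> a)"

lemma frag_eval_add: "frag_eval \<psi> (x + y) = frag_eval \<psi> x + frag_eval \<psi> y"
proof -
  let ?A = "Poly_Mapping.keys x \<union> Poly_Mapping.keys y"
  have *: "frag_eval \<psi> z = (\<Sum>a\<in>?A. of_int (Poly_Mapping.lookup z a) * \<psi> a)"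
    if "Poly_Mapping.keys z \<subseteq> ?A" for z
    unfolding frag_eval_def using that by (intro sum.mono_neutral_left) (auto simp: in_keys_iff)
  have "Poly_Mapping.keys (x + y) \<subseteq> ?A" by (rule Poly_Mapping.keys_add)
  then show ?thesis by (simp add: * lookup_add distrib_right sum.distrib)
qed

lemma frag_eval_zero [simp]: "frag_eval \<psi> 0 = 0"
  by (simp add: frag_eval_def)

lemma frag_eval_uminus: "frag_eval \<psi> (- x) = - frag_eval \<psi> x"
  using frag_eval_add[of \<psi> x "- x"] by (simp add: add_eq_0_iff)

lemma frag_eval_diff: "frag_eval \<psi> (x - y) = frag_eval \<psi> x - frag_eval \<psi> y"
  using frag_eval_add[of \<psi> x "- y"] by (simp add: frag_eval_uminus)

lemma frag_eval_of [simp]: "frag_eval \<psi> (frag_of a) = \<psi> a"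
  by (simp add: frag_eval_def)

text \<open>The chosen representative is irrelevant for functionals respecting the relations
  (\<open>bs_lift_class\<close>).\<close>

definition bs_lift ::
    "('k polynomial list \<Rightarrow> 'k polynomial) \<Rightarrow> 'k::field bs_elt \<Rightarrow> 'k polynomial" where
  "bs_lift \<psi> u = frag_eval \<psi> (SOME x. x \<in> u)"

context faithful_realization
begin

lemma cring_inv_ring:
  assumes "I \<subseteq> S"
  shows "cring (inv_ring X I)"
proof (rule cringI)
  show "abelian_group (inv_ring X I)"
    by (rule abelian_groupI)
      (auto simp: inv_ring_def invariants_add[OF assms] invariants_zero[OF assms] add.assoc add.commute
        intro!: bexI[of _ "- _"] invariants_uminus[OF assms])
  show "Group.comm_monoid (inv_ring X I)"
    by (rule comm_monoidI)
      (auto simp: inv_ring_def invariants_mult[OF assms] invariants_one[OF assms] mult.assoc mult.commute)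
  show "(x \<oplus>\<^bsub>inv_ring X I\<^esub> y) \<otimes>\<^bsub>inv_ring X I\<^esub> z =
      x \<otimes>\<^bsub>inv_ring X I\<^esub> z \<oplus>\<^bsub>inv_ring X I\<^esub> y \<otimes>\<^bsub>inv_ring X I\<^esub> z" for x y z
    by (simp add: inv_ring_def distrib_right)
qed

section \<open>The abelian group underlying a tensor product\<close>

context
  fixes Is :: "'w set list"
  assumes IsS: "\<forall>I\<in>set Is. I \<subseteq> S"
begin

lemma bs_relations_carrier:
  "bs_relations X Is \<subseteq> carrier (free_Abelian_group (bs_tuples X Is))"
proof -
  have diff3: "frag_of a - frag_of b - frag_of c \<in> carrier (free_Abelian_group (bs_tuples X Is))"
    if "a \<in> bs_tuples X Is" "b \<in> bs_tuples X Is" "c \<in> bs_tuples X Is" for a b c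
    using that keys_diff[of "frag_of a - frag_of b" "frag_of c"] keys_diff[of "frag_of a" "frag_of b"]
    by (auto simp: carrier_free_Abelian_group_iff keys_frag_of)
  have diff2: "frag_of a - frag_of b \<in> carrier (free_Abelian_group (bs_tuples X Is))"
    if "a \<in> bs_tuples X Is" "b \<in> bs_tuples X Is" for a b
    using that keys_diff[of "frag_of a" "frag_of b"]
    by (auto simp: carrier_free_Abelian_group_iff keys_frag_of)
  show ?thesis
    unfolding bs_relations_def
  proof (rule Un_least; rule subsetI; elim CollectE exE conjE; hypsubst)
    fix a i b c
    assume *: "a \<in> bs_tuples X Is" "i < length Is" "b \<in> bs_entry X Is i" "c \<in> bs_entry X Is i"
    then show "frag_of (a[i := b + c]) - frag_of (a[i := b]) - frag_of (a[i := c])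
        \<in> carrier (free_Abelian_group (bs_tuples X Is))"
      by (intro diff3 bs_tuples_update bs_entry_mult[OF IsS])
  next
    fix a i r
    assume *: "a \<in> bs_tuples X Is" "Suc i < length Is" "r \<in> invariants X (Is ! i)"
    then have "a ! i \<in> bs_entry X Is i" "a ! Suc i \<in> bs_entry X Is (Suc i)"
      using bs_tuples_entry[OF *(1)] by simp_all
    then show "frag_of (a[i := a ! i * r]) - frag_of (a[Suc i := r * a ! Suc i])
        \<in> carrier (free_Abelian_group (bs_tuples X Is))"
      using * invariants_bs_entry[of r Is i] invariants_bs_entry_Suc[of r Is i]
      by (intro diff2 bs_tuples_update bs_entry_mult[OF IsS]) simp_all
  qed
qed

lemma bs_kernel_subgroup: "subgroup (bs_kernel X Is) (free_Abelian_group (bs_tuples X Is))"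
  unfolding bs_kernel_def using group.generate_is_subgroup[OF _ bs_relations_carrier] by simp

lemma bs_kernel_keys: "x \<in> bs_kernel X Is \<Longrightarrow> Poly_Mapping.keys x \<subseteq> bs_tuples X Is"
  using subgroup.mem_carrier[OF bs_kernel_subgroup] by (simp add: carrier_free_Abelian_group_iff)

lemma bs_kernel_zero: "0 \<in> bs_kernel X Is"
  using subgroup.one_closed[OF bs_kernel_subgroup] by simp

lemma bs_kernel_add: "x \<in> bs_kernel X Is \<Longrightarrow> y \<in> bs_kernel X Is \<Longrightarrow> x + y \<in> bs_kernel X Is"
  using subgroup.m_closed[OF bs_kernel_subgroup, of x y] by simp

lemma bs_kernel_uminus: "x \<in> bs_kernel X Is \<Longrightarrow> - x \<in> bs_kernel X Is"
  using subgroup.m_inv_closed[OF bs_kernel_subgroup, of x] bs_kernel_keys[of x] by simp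

lemma bs_kernel_diff: "x \<in> bs_kernel X Is \<Longrightarrow> y \<in> bs_kernel X Is \<Longrightarrow> x - y \<in> bs_kernel X Is"
  using bs_kernel_add[OF _ bs_kernel_uminus, of x y] by simp

lemma bs_class_eq_iff: "bs_class X Is x = bs_class X Is y \<longleftrightarrow> x - y \<in> bs_kernel X Is"
proof
  assume "bs_class X Is x = bs_class X Is y"
  moreover have "x \<in> bs_class X Is x" using bs_kernel_zero by (simp add: bs_class_iff)
  ultimately show "x - y \<in> bs_kernel X Is" by (simp add: bs_class_iff)
next
  assume *: "x - y \<in> bs_kernel X Is"
  have "z - x \<in> bs_kernel X Is \<longleftrightarrow> z - y \<in> bs_kernel X Is" for z
    using bs_kernel_add[OF _ *, of "z - x"] bs_kernel_diff[OF _ *, of "z - y"] by auto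
  then show "bs_class X Is x = bs_class X Is y" by (auto simp: bs_class_iff)
qed

lemma bs_carrier_iff:
  "u \<in> carrier (bs_group X Is) \<longleftrightarrow> (\<exists>x. Poly_Mapping.keys x \<subseteq> bs_tuples X Is \<and> u = bs_class X Is x)"
  unfolding bs_group_def FactGroup_def RCOSETS_def bs_class_def
  by (simp add: carrier_free_Abelian_group_iff Bex_def)

lemma bs_carrierE:
  assumes "u \<in> carrier (bs_group X Is)"
  obtains x where "Poly_Mapping.keys x \<subseteq> bs_tuples X Is" "u = bs_class X Is x"
  using assms bs_carrier_iff by blast

lemma bs_class_carrier [simp]:
  "Poly_Mapping.keys x \<subseteq> bs_tuples X Is \<Longrightarrow> bs_class X Is x \<in> carrier (bs_group X Is)"
  using bs_carrier_iff by blast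

lemma bs_group_mult:
  "bs_class X Is x \<otimes>\<^bsub>bs_group X Is\<^esub> bs_class X Is y = bs_class X Is (x + y)"
proof -
  have "z \<in> bs_class X Is x <#>\<^bsub>free_Abelian_group (bs_tuples X Is)\<^esub> bs_class X Is y \<longleftrightarrow>
      z \<in> bs_class X Is (x + y)" for z
  proof
    assume "z \<in> bs_class X Is x <#>\<^bsub>free_Abelian_group (bs_tuples X Is)\<^esub> bs_class X Is y"
    then obtain a b where "z = a + b" "a - x \<in> bs_kernel X Is" "b - y \<in> bs_kernel X Is"
      by (auto simp: set_mult_def bs_class_iff)
    then show "z \<in> bs_class X Is (x + y)"
      using bs_kernel_add[of "a - x" "b - y"] by (simp add: bs_class_iff algebra_simps)
  next
    assume z: "z \<in> bs_class X Is (x + y)"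
    then have "z - y \<in> bs_class X Is x" by (simp add: bs_class_iff algebra_simps)
    moreover have "y \<in> bs_class X Is y" using bs_kernel_zero by (simp add: bs_class_iff)
    ultimately show "z \<in> bs_class X Is x <#>\<^bsub>free_Abelian_group (bs_tuples X Is)\<^esub> bs_class X Is y"
      unfolding set_mult_def by simp (metis diff_add_cancel)
  qed
  then show ?thesis unfolding bs_group_def FactGroup_def by auto
qed

lemma bs_group_one: "\<one>\<^bsub>bs_group X Is\<^esub> = bs_class X Is 0"
  by (auto simp: bs_group_def FactGroup_def bs_class_iff)

lemma bs_comm_group: "comm_group (bs_group X Is)"
proof (rule comm_groupI)
  show "\<one>\<^bsub>bs_group X Is\<^esub> \<in> carrier (bs_group X Is)" by (simp add: bs_group_one)
  fix u v w assume u: "u \<in> carrier (bs_group X Is)"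
  then obtain x where x: "Poly_Mapping.keys x \<subseteq> bs_tuples X Is" "u = bs_class X Is x"
    using bs_carrier_iff by blast
  show "\<one>\<^bsub>bs_group X Is\<^esub> \<otimes>\<^bsub>bs_group X Is\<^esub> u = u" using x by (simp add: bs_group_one bs_group_mult)
  show "\<exists>v\<in>carrier (bs_group X Is). v \<otimes>\<^bsub>bs_group X Is\<^esub> u = \<one>\<^bsub>bs_group X Is\<^esub>"
    using x by (intro bexI[of _ "bs_class X Is (- x)"]) (simp_all add: bs_group_mult bs_group_one)
  assume v: "v \<in> carrier (bs_group X Is)"
  then obtain y where y: "Poly_Mapping.keys y \<subseteq> bs_tuples X Is" "v = bs_class X Is y"
    using bs_carrier_iff by blast
  show "u \<otimes>\<^bsub>bs_group X Is\<^esub> v \<in> carrier (bs_group X Is)"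
    using x y order_trans[OF Poly_Mapping.keys_add[of x y]] by (simp add: bs_group_mult)
  show "u \<otimes>\<^bsub>bs_group X Is\<^esub> v = v \<otimes>\<^bsub>bs_group X Is\<^esub> u"
    using x y by (simp add: bs_group_mult add.commute)
  assume "w \<in> carrier (bs_group X Is)"
  then obtain z where z: "w = bs_class X Is z"
    using bs_carrier_iff by blast
  show "u \<otimes>\<^bsub>bs_group X Is\<^esub> v \<otimes>\<^bsub>bs_group X Is\<^esub> w = u \<otimes>\<^bsub>bs_group X Is\<^esub> (v \<otimes>\<^bsub>bs_group X Is\<^esub> w)"
    using x y z by (simp add: bs_group_mult add.assoc)
qed

lemma bs_pure_carrier [simp]: "a \<in> bs_tuples X Is \<Longrightarrow> bs_pure X Is a \<in> carrier (bs_group X Is)"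
  by (simp add: bs_pure_def keys_frag_of)

lemma bs_pure_add:
  assumes "a \<in> bs_tuples X Is" "i < length Is" "b \<in> bs_entry X Is i" "c \<in> bs_entry X Is i"
  shows "bs_pure X Is (a[i := b + c]) = bs_pure X Is (a[i := b]) \<otimes>\<^bsub>bs_group X Is\<^esub> bs_pure X Is (a[i := c])"
proof -
  have "frag_of (a[i := b + c]) - frag_of (a[i := b]) - frag_of (a[i := c]) \<in> bs_kernel X Is"
    unfolding bs_kernel_def by (rule generate.incl) (use assms in \<open>auto simp: bs_relations_def\<close>)
  then show ?thesis unfolding bs_pure_def bs_group_mult bs_class_eq_iff by (simp add: algebra_simps)
qed

lemma bs_pure_balanced:
  assumes "a \<in> bs_tuples X Is" "Suc i < length Is" "r \<in> invariants X (Is ! i)"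
  shows "bs_pure X Is (a[i := a ! i * r]) = bs_pure X Is (a[Suc i := r * a ! Suc i])"
proof -
  have "frag_of (a[i := a ! i * r]) - frag_of (a[Suc i := r * a ! Suc i]) \<in> bs_kernel X Is"
    unfolding bs_kernel_def by (rule generate.incl) (use assms in \<open>auto simp: bs_relations_def\<close>)
  then show ?thesis unfolding bs_pure_def bs_class_eq_iff .
qed

text \<open>Sums of pure tensors suffice, without differences: the negative of a pure tensor is the
  pure tensor with entry 0 negated.\<close>

lemma bs_induct [consumes 2, case_names zero pure add]:
  assumes ne: "Is \<noteq> []" and u: "u \<in> carrier (bs_group X Is)" and zero: "P \<one>\<^bsub>bs_group X Is\<^esub>"
    and pure: "\<And>a. a \<in> bs_tuples X Is \<Longrightarrow> P (bs_pure X Is a)"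
    and add: "\<And>u v. u \<in> carrier (bs_group X Is) \<Longrightarrow> v \<in> carrier (bs_group X Is) \<Longrightarrow> P u \<Longrightarrow> P v \<Longrightarrow>
      P (u \<otimes>\<^bsub>bs_group X Is\<^esub> v)"
  shows "P u"
proof -
  obtain x where x: "Poly_Mapping.keys x \<subseteq> bs_tuples X Is" "u = bs_class X Is x"
    using u bs_carrier_iff by blast
  \<comment> \<open>The claim is carried for x and -x together because \<open>frag_induction\<close>
    builds elements by subtraction.\<close>
  have "Poly_Mapping.keys x \<subseteq> bs_tuples X Is \<and> P (bs_class X Is x) \<and> P (bs_class X Is (- x))"
    using x(1)
  proof (induction x rule: frag_induction)
    case zero
    show ?case using assms(3) by (simp add: bs_group_one)
  next
    case (one a)
    have len: "length a = length Is" using bs_tuples_length one by blast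
    have a0: "a ! 0 \<in> bs_entry X Is 0" using bs_tuples_entry[OF one, of 0] ne by simp
    then have ma0: "- (a ! 0) \<in> bs_entry X Is 0"
      using IsS ne nth_mem[of 0 Is] by (auto simp: bs_entry_def intro!: invariants_uminus)
    have "bs_pure X Is (a[0 := a ! 0 + - (a ! 0)]) =
        bs_pure X Is (a[0 := a ! 0]) \<otimes>\<^bsub>bs_group X Is\<^esub> bs_pure X Is (a[0 := - (a ! 0)])"
      using one ne a0 ma0 by (intro bs_pure_add) auto
    \<comment> \<open>Additivity applied to 0 + 0 shows that a pure tensor whose first entry is zero
      vanishes.\<close>
    moreover have "bs_pure X Is (a[0 := 0 + 0]) =
        bs_pure X Is (a[0 := 0]) \<otimes>\<^bsub>bs_group X Is\<^esub> bs_pure X Is (a[0 := 0])"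
      using one ne bs_entry_one[OF IsS] by (intro bs_pure_add) auto
    ultimately have "frag_of (a[0 := 0]) - (frag_of a + frag_of (a[0 := - (a ! 0)])) \<in> bs_kernel X Is"
        "frag_of (a[0 := 0]) - (frag_of (a[0 := 0]) + frag_of (a[0 := 0])) \<in> bs_kernel X Is"
      unfolding bs_pure_def bs_group_mult bs_class_eq_iff by simp_all
    from bs_kernel_diff[OF this(2) this(1)] bs_kernel_uminus[OF this(2)]
    have "frag_of a + frag_of (a[0 := - (a ! 0)]) - frag_of (a[0 := 0]) \<in> bs_kernel X Is"
        "frag_of (a[0 := 0]) \<in> bs_kernel X Is"
      using bs_kernel_uminus[OF \<open>_ - (frag_of a + _) \<in> _\<close>] by simp_all
    from bs_kernel_uminus[OF bs_kernel_add[OF this]]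
    have "bs_class X Is (- frag_of a) = bs_pure X Is (a[0 := - (a ! 0)])"
      unfolding bs_pure_def bs_class_eq_iff by (simp add: algebra_simps)
    then show ?case using pure one bs_tuples_update[OF one ma0]
      by (simp add: keys_frag_of) (simp add: bs_pure_def[symmetric])
  next
    case (diff x y)
    then have *: "bs_class X Is x \<in> carrier (bs_group X Is)" "bs_class X Is y \<in> carrier (bs_group X Is)"
      "bs_class X Is (- x) \<in> carrier (bs_group X Is)" "bs_class X Is (- y) \<in> carrier (bs_group X Is)"
      by simp_all
    have "P (bs_class X Is (x + - y))" "P (bs_class X Is (- x + y))"
      using add * diff unfolding bs_group_mult[symmetric] by blast+
    then show ?case using diff keys_diff[of x y] by auto
  qed
  with x show ?thesis by simp
qed

text \<open>The integer-linear extension of a tensor functional vanishes on the generators of the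
  kernel, hence on the kernel, so all representatives have the same value.\<close>

lemma bs_lift_class:
  assumes \<psi>: "tensor_functional X Is \<psi>"
  shows "bs_lift \<psi> (bs_class X Is x) = frag_eval \<psi> x"
proof -
  have rel: "frag_eval \<psi> k = 0" if "k \<in> bs_relations X Is" for k
    using that unfolding bs_relations_def
  proof (elim UnE CollectE exE conjE)
    fix a i b c
    assume *: "a \<in> bs_tuples X Is" "i < length Is" "b \<in> bs_entry X Is i" "c \<in> bs_entry X Is i"
      and k: "k = frag_of (a[i := b + c]) - frag_of (a[i := b]) - frag_of (a[i := c])"
    show ?thesis unfolding k frag_eval_diff frag_eval_of tensor_functionalD(1)[OF \<psi> *] by simp
  next
    fix a i r
    assume *: "a \<in> bs_tuples X Is" "Suc i < length Is" "r \<in> invariants X (Is ! i)"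
      and k: "k = frag_of (a[i := a ! i * r]) - frag_of (a[Suc i := r * a ! Suc i])"
    show ?thesis unfolding k frag_eval_diff frag_eval_of tensor_functionalD(2)[OF \<psi> *] by simp
  qed
  have ker: "frag_eval \<psi> k = 0" if "k \<in> bs_kernel X Is" for k
    using that[unfolded bs_kernel_def]
  proof (induction rule: generate.induct)
    case (inv k)
    then have "Poly_Mapping.keys k \<subseteq> bs_tuples X Is"
      using subsetD[OF bs_relations_carrier inv] by (simp add: carrier_free_Abelian_group_iff)
    then show ?case using rel[OF inv] by (simp add: frag_eval_uminus)
  qed (simp_all add: frag_eval_add rel)
  have "x \<in> bs_class X Is x" using bs_kernel_zero by (simp add: bs_class_iff)
  then have "(SOME y. y \<in> bs_class X Is x) \<in> bs_class X Is x" by (rule someI)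
  then have "frag_eval \<psi> ((SOME y. y \<in> bs_class X Is x) - x) = 0" by (simp add: bs_class_iff ker)
  then show ?thesis by (simp add: bs_lift_def frag_eval_diff)
qed

lemma bs_lift_pure: "tensor_functional X Is \<psi> \<Longrightarrow> bs_lift \<psi> (bs_pure X Is a) = \<psi> a"
  by (simp add: bs_pure_def bs_lift_class)

lemma bs_lift_mult:
  assumes "tensor_functional X Is \<psi>" "u \<in> carrier (bs_group X Is)" "v \<in> carrier (bs_group X Is)"
  shows "bs_lift \<psi> (u \<otimes>\<^bsub>bs_group X Is\<^esub> v) = bs_lift \<psi> u + bs_lift \<psi> v"
proof -
  obtain x y where "u = bs_class X Is x" "v = bs_class X Is y"
    using bs_carrierE[OF assms(2)] bs_carrierE[OF assms(3)] by metis
  then show ?thesis by (simp add: bs_group_mult bs_lift_class[OF assms(1)] frag_eval_add)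
qed

lemma bs_lift_one: "tensor_functional X Is \<psi> \<Longrightarrow> bs_lift \<psi> \<one>\<^bsub>bs_group X Is\<^esub> = 0"
  by (simp add: bs_group_one bs_lift_class)

end

text \<open>Compatibility is required only for classes in the target. It makes the union over
  representatives in \<open>bs_induced\<close> a union of equal classes.\<close>

definition tensor_map :: "'w set list \<Rightarrow> 'w set list \<Rightarrow> ('k polynomial list \<Rightarrow> 'k polynomial list) \<Rightarrow> bool" where
  "tensor_map Is Js t \<longleftrightarrow> (\<forall>a\<in>bs_tuples X Is. t a \<in> bs_tuples X Js \<and>
     (\<forall>i<length Is. \<forall>b\<in>bs_entry X Is i. \<forall>c\<in>bs_entry X Is i.
        bs_pure X Js (t (a[i := b + c])) =
        bs_pure X Js (t (a[i := b])) \<otimes>\<^bsub>bs_group X Js\<^esub> bs_pure X Js (t (a[i := c]))) \<and>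
     (\<forall>i. Suc i < length Is \<longrightarrow> (\<forall>r\<in>invariants X (Is ! i).
        bs_pure X Js (t (a[i := a ! i * r])) = bs_pure X Js (t (a[Suc i := r * a ! Suc i])))))"

context
  fixes Is Js :: "'w set list" and t :: "'k polynomial list \<Rightarrow> 'k polynomial list"
  assumes IsS: "\<forall>I\<in>set Is. I \<subseteq> S" and JsS: "\<forall>I\<in>set Js. I \<subseteq> S"
    and t: "tensor_map Is Js t"
begin

lemma bs_induced_class:
  assumes "Poly_Mapping.keys x \<subseteq> bs_tuples X Is"
  shows "bs_induced X Js t (bs_class X Is x) = bs_class X Js (frag_extend (\<lambda>a. frag_of (t a)) x)"
proof -
  let ?h = "frag_extend (\<lambda>a. frag_of (t a))"
  have rel: "?h k \<in> bs_kernel X Js" if "k \<in> bs_relations X Is" for k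
    using that t bs_class_eq_iff[OF JsS] bs_group_mult[OF JsS]
    unfolding tensor_map_def bs_relations_def bs_pure_def
    by (auto simp: frag_extend_diff frag_extend_add diff_diff_eq)
  have ker: "?h k \<in> bs_kernel X Js" if "k \<in> bs_kernel X Is" for k
    using that[unfolded bs_kernel_def]
  proof (induction rule: generate.induct)
    case (inv k)
    then have "Poly_Mapping.keys k \<subseteq> bs_tuples X Is"
      using subsetD[OF bs_relations_carrier[OF IsS] inv] by (simp add: carrier_free_Abelian_group_iff)
    then show ?case using rel[OF inv] bs_kernel_uminus[OF JsS] by (simp add: frag_extend_minus)
  qed (simp_all add: frag_extend_add rel bs_kernel_zero[OF JsS] bs_kernel_add[OF JsS])
  have "bs_class X Js (?h y) = bs_class X Js (?h x)" if "y \<in> bs_class X Is x" for y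
    using ker[of "y - x"] that by (simp add: bs_class_eq_iff[OF JsS] bs_class_iff frag_extend_diff)
  moreover have "x \<in> bs_class X Is x" using bs_kernel_zero[OF IsS] by (simp add: bs_class_iff)
  ultimately show ?thesis unfolding bs_induced_def by blast
qed

lemma bs_induced_pure:
  "a \<in> bs_tuples X Is \<Longrightarrow> bs_induced X Js t (bs_pure X Is a) = bs_pure X Js (t a)"
  unfolding bs_pure_def by (subst bs_induced_class) (simp_all add: keys_frag_of)

lemma bs_induced_carrier:
  assumes "u \<in> carrier (bs_group X Is)"
  shows "bs_induced X Js t u \<in> carrier (bs_group X Js)"
proof -
  obtain x where x: "Poly_Mapping.keys x \<subseteq> bs_tuples X Is" "u = bs_class X Is x"
    by (rule bs_carrierE[OF IsS assms])
  have "Poly_Mapping.keys (frag_extend (\<lambda>a. frag_of (t a)) x) \<subseteq> bs_tuples X Js"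
    using keys_frag_extend[of "\<lambda>a. frag_of (t a)" x] x(1) t
    by (fastforce simp: keys_frag_of tensor_map_def)
  then show ?thesis using x by (simp add: bs_induced_class bs_class_carrier[OF JsS])
qed

lemma bs_induced_mult:
  assumes "u \<in> carrier (bs_group X Is)" "v \<in> carrier (bs_group X Is)"
  shows "bs_induced X Js t (u \<otimes>\<^bsub>bs_group X Is\<^esub> v) =
    bs_induced X Js t u \<otimes>\<^bsub>bs_group X Js\<^esub> bs_induced X Js t v"
proof -
  obtain x y where x: "Poly_Mapping.keys x \<subseteq> bs_tuples X Is" "u = bs_class X Is x"
    and y: "Poly_Mapping.keys y \<subseteq> bs_tuples X Is" "v = bs_class X Is y"
    using bs_carrierE[OF IsS assms(1)] bs_carrierE[OF IsS assms(2)] by metis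
  have "Poly_Mapping.keys (x + y) \<subseteq> bs_tuples X Is"
    using x(1) y(1) Poly_Mapping.keys_add[of x y] by blast
  then show ?thesis using x y
    by (simp add: bs_group_mult[OF IsS] bs_group_mult[OF JsS] bs_induced_class frag_extend_add)
qed

lemma bs_induced_one: "bs_induced X Js t \<one>\<^bsub>bs_group X Is\<^esub> = \<one>\<^bsub>bs_group X Js\<^esub>"
  by (simp add: bs_group_one[OF IsS] bs_group_one[OF JsS] bs_induced_class)

end

end

section \<open>Generated subgroups and homogeneous polynomials\<close>

lemma generate_image_subset:
  assumes "group G" "group H" "f \<in> hom G H" "A \<subseteq> carrier G" "f ` A \<subseteq> B"
  shows "f ` generate G A \<subseteq> generate H B"
proof
  fix y assume "y \<in> f ` generate G A"
  then obtain x where x: "x \<in> generate G A" "y = f x" by blast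
  interpret group_hom G H f using assms by (simp add: group_hom_def group_hom_axioms_def)
  have "x \<in> carrier G \<and> f x \<in> generate H B"
    using x(1)
  proof (induction rule: generate.induct)
    case one
    then show ?case by (simp add: generate.one)
  next
    case (incl h)
    then show ?case using assms by (auto intro: generate.incl)
  next
    case (inv h)
    then have "h \<in> carrier G" "f h \<in> B" using assms by auto
    then show ?case by (auto intro: generate.inv)
  next
    case (eng h1 h2)
    then show ?case by (auto intro: generate.eng)
  qed
  then show "y \<in> generate H B" using x by simp
qed

lemma sum_lessThan_split:
  fixes k n :: nat
  shows "(\<Sum>i<k + n. f i) = (\<Sum>i<k. f i) + (\<Sum>i<n. f (k + i) :: 'a::comm_monoid_add)"
  by (induction n) (auto simp: add.assoc)

lemma homogeneous_one: "homogeneous 0 1"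
  by (simp add: homogeneous_def)

lemma homogeneous_mult:
  assumes "homogeneous d f" "homogeneous e g"
  shows "homogeneous (d + e) (f * g)"
  unfolding homogeneous_def
proof
  have deg: "(\<Sum>i\<in>Poly_Mapping.keys (a + b). Poly_Mapping.lookup (a + b) i) =
      (\<Sum>i\<in>Poly_Mapping.keys a. Poly_Mapping.lookup a i) + (\<Sum>i\<in>Poly_Mapping.keys b. Poly_Mapping.lookup b i)"
    for a b :: "nat \<Rightarrow>\<^sub>0 nat"
  proof -
    let ?A = "Poly_Mapping.keys a \<union> Poly_Mapping.keys b"
    have *: "(\<Sum>i\<in>Poly_Mapping.keys c. Poly_Mapping.lookup c i) = (\<Sum>i\<in>?A. Poly_Mapping.lookup c i)"
      if "Poly_Mapping.keys c \<subseteq> ?A" for c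
      using that by (intro sum.mono_neutral_left) (auto simp: in_keys_iff)
    have "Poly_Mapping.keys (a + b) \<subseteq> ?A" by (rule Poly_Mapping.keys_add)
    then show ?thesis using *[of "a + b"] *[of a] *[of b] by (simp add: lookup_add sum.distrib)
  qed
  fix m assume "m \<in> Poly_Mapping.keys (f * g)"
  then obtain a b where "m = a + b" "a \<in> Poly_Mapping.keys f" "b \<in> Poly_Mapping.keys g"
    using keys_mult[of f g] by blast
  then show "2 * int (\<Sum>i\<in>Poly_Mapping.keys m. Poly_Mapping.lookup m i) = d + e"
    using assms unfolding homogeneous_def by (simp only: deg of_nat_add distrib_left)
qed

lemma homogeneous_prod:
  "finite A \<Longrightarrow> (\<And>i. i \<in> A \<Longrightarrow> homogeneous (e i) (f i)) \<Longrightarrow> homogeneous (\<Sum>i\<in>A. e i) (\<Prod>i\<in>A. f i)"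
  by (induction A rule: finite_induct) (auto simp: homogeneous_one intro: homogeneous_mult)

context faithful_realization
begin

section \<open>Multiplication in one tensor position\<close>

context
  fixes Is :: "'w set list"
  assumes IsS: "\<forall>I\<in>set Is. I \<subseteq> S" and ne: "Is \<noteq> []"
begin

interpretation B: comm_group "bs_group X Is"
  by (rule bs_comm_group[OF IsS])

lemmas bs_ind = bs_induct[OF IsS ne, consumes 1, case_names zero pure add]

text \<open>As R is commutative, a factor in position n passes by every relation, including the
  balancing relations that involve position n.\<close>

lemma tensor_map_mul:
  assumes n: "n < length Is" and r: "r \<in> bs_entry X Is n"
  shows "tensor_map Is Is (\<lambda>a. a[n := a ! n * r])"
  unfolding tensor_map_def
proof (intro ballI conjI allI impI)
  fix a assume a: "a \<in> bs_tuples X Is"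
  note len = bs_tuples_length[OF a]
  have ar: "a ! n * r \<in> bs_entry X Is n" using bs_entry_mult[OF IsS n] bs_tuples_entry[OF a n] r by blast
  show a': "a[n := a ! n * r] \<in> bs_tuples X Is" using a ar by (rule bs_tuples_update)
  {
    fix i b c assume i: "i < length Is" "b \<in> bs_entry X Is i" "c \<in> bs_entry X Is i"
    show "bs_pure X Is ((a[i := b + c])[n := a[i := b + c] ! n * r]) =
        bs_pure X Is ((a[i := b])[n := a[i := b] ! n * r]) \<otimes>\<^bsub>bs_group X Is\<^esub>
        bs_pure X Is ((a[i := c])[n := a[i := c] ! n * r])"
    proof (cases "i = n")
      case True
      then show ?thesis
        using bs_pure_add[OF IsS a n bs_entry_mult(1)[OF IsS n _ r] bs_entry_mult(1)[OF IsS n _ r], of b c] i n len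
        by (simp add: distrib_right)
    next
      case False
      then show ?thesis using bs_pure_add[OF IsS a' i] by (simp add: list_update_swap)
    qed
  next
    fix i s assume i: "Suc i < length Is" "s \<in> invariants X (Is ! i)"
    show "bs_pure X Is ((a[i := a ! i * s])[n := a[i := a ! i * s] ! n * r]) =
        bs_pure X Is ((a[Suc i := s * a ! Suc i])[n := a[Suc i := s * a ! Suc i] ! n * r])"
    proof -
      have "(a[i := a ! i * s])[n := a[i := a ! i * s] ! n * r] =
          (a[n := a ! n * r])[i := a[n := a ! n * r] ! i * s]"
        using i len by (cases "i = n") (auto simp: list_update_swap mult_ac)
      moreover have "(a[Suc i := s * a ! Suc i])[n := a[Suc i := s * a ! Suc i] ! n * r] =
          (a[n := a ! n * r])[Suc i := s * a[n := a ! n * r] ! Suc i]"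
        using i len by (cases "Suc i = n") (auto simp: list_update_swap mult_ac)
      ultimately show ?thesis using bs_pure_balanced[OF IsS a' i] by simp
    qed
  }
qed

context
  fixes n :: nat
  assumes n: "n < length Is"
begin

lemma bs_mul_pure:
  "r \<in> bs_entry X Is n \<Longrightarrow> a \<in> bs_tuples X Is \<Longrightarrow>
    bs_mul X Is n r (bs_pure X Is a) = bs_pure X Is (a[n := a ! n * r])"
  unfolding bs_mul_def by (subst bs_induced_pure[OF IsS IsS tensor_map_mul[OF n]]) auto

lemma bs_mul_carrier:
  "r \<in> bs_entry X Is n \<Longrightarrow> u \<in> carrier (bs_group X Is) \<Longrightarrow> bs_mul X Is n r u \<in> carrier (bs_group X Is)"
  unfolding bs_mul_def by (rule bs_induced_carrier[OF IsS IsS tensor_map_mul[OF n]])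

lemma bs_mul_mult:
  "r \<in> bs_entry X Is n \<Longrightarrow> u \<in> carrier (bs_group X Is) \<Longrightarrow> v \<in> carrier (bs_group X Is) \<Longrightarrow>
    bs_mul X Is n r (u \<otimes>\<^bsub>bs_group X Is\<^esub> v) = bs_mul X Is n r u \<otimes>\<^bsub>bs_group X Is\<^esub> bs_mul X Is n r v"
  unfolding bs_mul_def by (rule bs_induced_mult[OF IsS IsS tensor_map_mul[OF n]])

lemma bs_mul_one:
  "r \<in> bs_entry X Is n \<Longrightarrow> bs_mul X Is n r \<one>\<^bsub>bs_group X Is\<^esub> = \<one>\<^bsub>bs_group X Is\<^esub>"
  unfolding bs_mul_def by (rule bs_induced_one[OF IsS IsS tensor_map_mul[OF n]])

lemma bs_mul_scalar_add:
  assumes r: "r \<in> bs_entry X Is n" and s: "s \<in> bs_entry X Is n" and u: "u \<in> carrier (bs_group X Is)"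
  shows "bs_mul X Is n (r + s) u = bs_mul X Is n r u \<otimes>\<^bsub>bs_group X Is\<^esub> bs_mul X Is n s u"
proof -
  note rs = bs_entry_mult(2)[OF IsS n r s]
  show ?thesis
    using u
  proof (induction u rule: bs_ind)
    case zero
    then show ?case using r s rs by (simp add: bs_mul_one)
  next
    case (pure a)
    then show ?case
      using bs_pure_add[OF IsS pure n bs_entry_mult(1)[OF IsS n bs_tuples_entry[OF pure n] r]
          bs_entry_mult(1)[OF IsS n bs_tuples_entry[OF pure n] s]] r s rs
      by (simp add: bs_mul_pure distrib_left)
  next
    case (add u v)
    then show ?case using r s rs bs_mul_carrier by (simp add: bs_mul_mult B.m_ac)
  qed
qed

lemma bs_mul_scalar_mult:
  assumes r: "r \<in> bs_entry X Is n" and s: "s \<in> bs_entry X Is n" and u: "u \<in> carrier (bs_group X Is)"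
  shows "bs_mul X Is n (r * s) u = bs_mul X Is n r (bs_mul X Is n s u)"
proof -
  note rs = bs_entry_mult(1)[OF IsS n r s]
  show ?thesis
    using u
  proof (induction u rule: bs_ind)
    case zero
    then show ?case using r s rs by (simp add: bs_mul_one)
  next
    case (pure a)
    then show ?case
      using bs_tuples_update[OF pure bs_entry_mult(1)[OF IsS n bs_tuples_entry[OF pure n] s]] r s rs n
        bs_tuples_length[OF pure]
      by (simp add: bs_mul_pure mult_ac)
  next
    case (add u v)
    then show ?case using r s rs bs_mul_carrier by (simp add: bs_mul_mult)
  qed
qed

lemma bs_mul_scalar_one: "u \<in> carrier (bs_group X Is) \<Longrightarrow> bs_mul X Is n 1 u = u"
proof (induction u rule: bs_ind)
  case (pure a)
  then show ?case using bs_entry_one[OF IsS n] by (simp add: bs_mul_pure)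
qed (use bs_entry_one[OF IsS n] in \<open>simp_all add: bs_mul_one bs_mul_mult\<close>)

lemma bs_module:
  assumes I: "I \<subseteq> S" "invariants X I \<subseteq> bs_entry X Is n"
    and M: "carrier M = carrier (bs_group X Is)" "add M = mult (bs_group X Is)" "zero M = one (bs_group X Is)"
    and smult: "\<And>r u. r \<in> invariants X I \<Longrightarrow> u \<in> carrier (bs_group X Is) \<Longrightarrow> r \<odot>\<^bsub>M\<^esub> u = bs_mul X Is n r u"
  shows "Module.module (inv_ring X I) M"
proof -
  have eI: "r \<in> bs_entry X Is n" if "r \<in> invariants X I" for r using that I by blast
  note [simp] = M smult
  show ?thesis
  proof (rule moduleI)
    show "cring (inv_ring X I)" by (rule cring_inv_ring[OF I(1)])
    show "abelian_group M"
    proof (rule abelian_groupI)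
      fix u assume "u \<in> carrier M"
      then show "\<exists>v\<in>carrier M. v \<oplus>\<^bsub>M\<^esub> u = \<zero>\<^bsub>M\<^esub>"
        by (intro bexI[of _ "inv\<^bsub>bs_group X Is\<^esub> u"]) auto
    qed (simp_all add: B.m_ac)
  qed (simp_all add: inv_ring_def invariants_mult[OF I(1)] invariants_add[OF I(1)] invariants_one[OF I(1)]
      eI bs_mul_carrier bs_mul_mult bs_mul_scalar_add bs_mul_scalar_mult bs_mul_scalar_one)
qed

end

lemma bs_mul_commute:
  assumes m: "m < length Is" and n: "n < length Is"
    and r: "r \<in> bs_entry X Is n" and s: "s \<in> bs_entry X Is m"
    and u: "u \<in> carrier (bs_group X Is)"
  shows "bs_mul X Is n r (bs_mul X Is m s u) = bs_mul X Is m s (bs_mul X Is n r u)"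
  using u
proof (induction u rule: bs_ind)
  case zero
  then show ?case using r s m n by (simp add: bs_mul_one)
next
  case (pure a)
  have "a[n := a ! n * r] \<in> bs_tuples X Is" "a[m := a ! m * s] \<in> bs_tuples X Is"
    using pure bs_tuples_entry r s m n by (auto intro!: bs_tuples_update bs_entry_mult[OF IsS])
  moreover have "(a[n := a ! n * r])[m := a[n := a ! n * r] ! m * s] =
      (a[m := a ! m * s])[n := a[m := a ! m * s] ! n * r]"
    using bs_tuples_length[OF pure] m n by (cases "m = n") (auto simp: list_update_swap mult_ac)
  ultimately show ?case using r s m n pure by (simp add: bs_mul_pure)
next
  case (add u v)
  then show ?case using r s m n by (simp add: bs_mul_mult bs_mul_carrier)
qed

end

end

section \<open>Evaluation along a path\<close>

context faithful_realization
begin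

text \<open>\<open>x i\<close> is the product of the factors before position i, so the factor of
  that position leads from \<open>x i\<close> to \<open>x (Suc i)\<close>.\<close>

lemma path_set_sequence:
  assumes "\<forall>I\<in>set Is. I \<subseteq> S" "w \<in> path_set X Is"
  shows "\<exists>x. x 0 = \<one> \<and> x (length Is) = w \<and> (\<forall>i\<le>length Is. x i \<in> carrier X) \<and>
    (\<forall>i<length Is. \<exists>u\<in>parabolic X (Is ! i). x (Suc i) = x i \<otimes> u)"
  using assms
proof (induction Is arbitrary: w)
  case Nil
  then show ?case by (intro exI[of _ "\<lambda>_. \<one>"]) simp
next
  case (Cons I Is)
  then obtain u y where uy: "w = u \<otimes> y" "u \<in> parabolic X I" "y \<in> path_set X Is" by auto
  have uc: "u \<in> carrier X" using parabolic_carrier[OF _ uy(2)] Cons.prems(1) by simp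
  obtain x where x: "x 0 = \<one>" "x (length Is) = y" "\<forall>i\<le>length Is. x i \<in> carrier X"
      "\<forall>i<length Is. \<exists>u\<in>parabolic X (Is ! i). x (Suc i) = x i \<otimes> u"
    using Cons.IH[of y] Cons.prems(1) uy(3) by auto
  define x' where "x' i = (case i of 0 \<Rightarrow> \<one> | Suc j \<Rightarrow> u \<otimes> x j)" for i
  have "x' i \<in> carrier X" if "i \<le> length (I # Is)" for i
    using that x uc by (cases i) (auto simp: x'_def)
  moreover have "\<exists>v\<in>parabolic X ((I # Is) ! i). x' (Suc i) = x' i \<otimes> v" if i: "i < length (I # Is)" for i
  proof (cases i)
    case 0
    then show ?thesis using x uy uc by (intro bexI[of _ u]) (auto simp: x'_def)
  next
    case (Suc j)
    then have j: "j < length Is" using i by simp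
    then obtain v where v: "v \<in> parabolic X (Is ! j)" "x (Suc j) = x j \<otimes> v" using x by blast
    moreover have "v \<in> carrier X" "x j \<in> carrier X"
      using v parabolic_carrier[of "Is ! j" v] Cons.prems(1) j x by auto
    ultimately show ?thesis using Suc uc by (intro bexI[of _ v]) (auto simp: x'_def m_assoc)
  qed
  moreover have "x' 0 = \<one>" "x' (length (I # Is)) = w" using x uy by (auto simp: x'_def)
  ultimately show ?case by blast
qed

text \<open>Position i is evaluated by the element reached before its factor. For a path from 1 this
  leaves position 0 untwisted.\<close>

definition path_eval :: "(nat \<Rightarrow> 'w) \<Rightarrow> 'k polynomial list \<Rightarrow> 'k polynomial" where
  "path_eval x a = (\<Prod>i<length a. weyl_act X (x i) (a ! i))"

lemma path_eval_update:
  "i < length a \<Longrightarrow>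
    path_eval x (a[i := b]) = weyl_act X (x i) b * (\<Prod>j\<in>{..<length a} - {i}. weyl_act X (x j) (a ! j))"
  unfolding path_eval_def
  by (subst prod.remove[of _ i]) (auto intro!: arg_cong2[of _ _ _ _ "(*)"] prod.cong)

lemma bs_entry_sym_ring: "r \<in> bs_entry X Is i \<Longrightarrow> r \<in> sym_ring X"
  by (auto simp: bs_entry_def invariants_def split: if_splits)

context
  fixes Is :: "'w set list" and x :: "nat \<Rightarrow> 'w"
  assumes IsS: "\<forall>I\<in>set Is. I \<subseteq> S" and xc: "\<forall>i\<le>length Is. x i \<in> carrier X"
    and path: "\<forall>i<length Is. \<exists>u\<in>parabolic X (Is ! i). x (Suc i) = x i \<otimes> u"
begin

lemma path_eval_mul:
  assumes a: "a \<in> bs_tuples X Is" and i: "i < length Is" and r: "r \<in> sym_ring X"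
  shows "path_eval x (a[i := a ! i * r]) = weyl_act X (x i) r * path_eval x a"
proof -
  have ia: "i < length a" using i bs_tuples_length[OF a] by simp
  have "path_eval x a = path_eval x (a[i := a ! i])" by simp
  also have "\<dots> = weyl_act X (x i) (a ! i) * (\<Prod>j\<in>{..<length a} - {i}. weyl_act X (x j) (a ! j))"
    by (rule path_eval_update[OF ia])
  finally show ?thesis
    unfolding path_eval_update[OF ia] using xc i r bs_entry_sym_ring[OF bs_tuples_entry[OF a i]]
    by (simp add: act_mult)
qed

lemma path_step_invariant:
  assumes "i < length Is" "r \<in> invariants X (Is ! i)"
  shows "weyl_act X (x (Suc i)) r = weyl_act X (x i) r"
proof -
  obtain u where u: "u \<in> parabolic X (Is ! i)" "x (Suc i) = x i \<otimes> u" using path assms(1) by blast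
  have "u \<in> carrier X" using parabolic_carrier[of "Is ! i" u] u IsS assms(1) by simp
  then show ?thesis
    using u xc assms invariants_sym_ring[OF assms(2)] by (simp add: act_comp) (simp add: invariants_def)
qed

text \<open>Moving an r invariant under the i-th parabolic subgroup to the next position replaces
  \<open>x i\<close> by \<open>x (Suc i)\<close>. These differ on the right by an element of that
  subgroup, so they agree on r.\<close>

lemma path_eval_functional: "tensor_functional X Is (path_eval x)"
  unfolding tensor_functional_def
proof (intro ballI conjI allI impI)
  fix a i b c
  assume a: "a \<in> bs_tuples X Is" and i: "i < length Is" and bc: "b \<in> bs_entry X Is i" "c \<in> bs_entry X Is i"
  have "i < length a" using i bs_tuples_length[OF a] by simp
  then show "path_eval x (a[i := b + c]) = path_eval x (a[i := b]) + path_eval x (a[i := c])"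
    using xc i bs_entry_sym_ring[OF bc(1)] bs_entry_sym_ring[OF bc(2)]
    by (simp add: path_eval_update act_add distrib_right)
next
  fix a i r
  assume a: "a \<in> bs_tuples X Is" and i: "Suc i < length Is" and r: "r \<in> invariants X (Is ! i)"
  have "path_eval x (a[i := a ! i * r]) = weyl_act X (x i) r * path_eval x a"
    using path_eval_mul[OF a] i invariants_sym_ring[OF r] by simp
  also have "\<dots> = weyl_act X (x (Suc i)) r * path_eval x a"
    using path_step_invariant[of i r] i r by simp
  also have "\<dots> = path_eval x (a[Suc i := r * a ! Suc i])"
    using path_eval_mul[OF a i invariants_sym_ring[OF r]] by (simp add: mult.commute)
  finally show "path_eval x (a[i := a ! i * r]) = path_eval x (a[Suc i := r * a ! Suc i])" .
qed

lemma path_eval_lift_mul: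
  assumes i: "i < length Is" and r: "r \<in> bs_entry X Is i" and u: "u \<in> carrier (bs_group X Is)"
  shows "bs_lift (path_eval x) (bs_mul X Is i r u) = weyl_act X (x i) r * bs_lift (path_eval x) u"
proof -
  have ne: "Is \<noteq> []" using i by auto
  note lift = bs_lift_pure[OF IsS path_eval_functional] bs_lift_mult[OF IsS path_eval_functional]
    bs_lift_one[OF IsS path_eval_functional]
  show ?thesis
    using u
  proof (induction u rule: bs_induct[OF IsS ne, consumes 1, case_names zero pure add])
    case zero
    show ?case unfolding bs_mul_one[OF IsS ne i r] lift by simp
  next
    case (pure a)
    show ?case unfolding bs_mul_pure[OF IsS ne i r pure] lift
      by (rule path_eval_mul[OF pure i bs_entry_sym_ring[OF r]])
  next
    case (add u v)
    show ?case
      unfolding bs_mul_mult[OF IsS ne i r add(1,2)]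
        lift(2)[OF add(1,2)] lift(2)[OF bs_mul_carrier[OF IsS ne i r add(1)] bs_mul_carrier[OF IsS ne i r add(2)]]
        add(3,4) by (simp add: distrib_left)
  qed
qed

end

section \<open>Restriction along a removal expression\<close>

context
  fixes Ds Ks :: "'w set list" and I L :: "'w set" and k :: nat
  assumes IS: "I \<subseteq> S" and rem: "removal_expression Ds I L"
    and KsS: "\<forall>K\<in>set Ks. K \<subseteq> S" and Ks_ne: "Ks \<noteq> []" and hdK: "hd Ks = L"
    and k: "length Ds = Suc k"
begin

abbreviation (input) "N \<equiv> concat_expr Ds Ks"

lemma Ds_ne: "Ds \<noteq> []"
  using k by auto

lemma removal_subset: "i \<le> j \<Longrightarrow> j < length Ds \<Longrightarrow> Ds ! j \<subseteq> Ds ! i"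
proof (induction j rule: dec_induct)
  case (step j)
  then have "Ds ! Suc j \<subseteq> Ds ! j" using rem by (auto simp: removal_expression_def)
  with step show ?case by auto
qed simp

lemma removal_le: "i < length Ds \<Longrightarrow> Ds ! i \<subseteq> I"
  using removal_subset[of 0 i] rem by (auto simp: removal_expression_def hd_conv_nth)

lemma Ds_last: "Ds ! k = L"
  using rem k by (auto simp: removal_expression_def last_conv_nth)

lemma length_N: "length N = k + length Ks"
  using k Ks_ne by (cases Ks) (auto simp: concat_expr_def)

lemma nth_N_Ds: "i \<le> k \<Longrightarrow> N ! i = Ds ! i"
  using k by (simp add: concat_expr_def nth_append)

lemma nth_N_Ks: "i < length Ks \<Longrightarrow> N ! (k + i) = Ks ! i"
proof (cases i)
  case 0
  then show ?thesis using nth_N_Ds[of k] Ds_last hdK Ks_ne by (simp add: hd_conv_nth)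
next
  case (Suc j)
  moreover assume "i < length Ks"
  ultimately show ?thesis by (simp add: concat_expr_def nth_append nth_tl k)
qed

lemma NS: "\<forall>K\<in>set N. K \<subseteq> S"
proof -
  have "\<forall>D\<in>set Ds. D \<subseteq> S" using removal_le IS by (metis in_set_conv_nth order_trans)
  then show ?thesis using KsS Ks_ne by (auto simp: concat_expr_def dest: list.set_sel(2))
qed

lemma N_ne: "N \<noteq> []"
  using Ds_ne by (simp add: concat_expr_def)

lemma LS: "L \<subseteq> S"
  using hdK KsS Ks_ne by auto

text \<open>Along the removal part the later of two neighbouring sets is the smaller one, so it
  determines the entry.\<close>

lemma bs_entry_N_Ds: "i \<le> k \<Longrightarrow> bs_entry X N i = invariants X (Ds ! i)"
proof (cases i)
  case (Suc j)
  assume i: "i \<le> k"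
  then have "Ds ! i \<subseteq> Ds ! j" using Suc Ds_ne by (intro removal_subset) (auto simp: k)
  then have "Ds ! j \<inter> Ds ! i = Ds ! i" by blast
  then show ?thesis using i Suc nth_N_Ds[of i] nth_N_Ds[of j] by (simp add: bs_entry_def)
qed (simp add: bs_entry_def nth_N_Ds)

lemma bs_entry_N_Ks: "i < length Ks \<Longrightarrow> bs_entry X N (k + i) = bs_entry X Ks i"
proof (cases i)
  case 0
  then show ?thesis using bs_entry_N_Ds[of k] Ds_last hdK Ks_ne by (simp add: bs_entry_def hd_conv_nth)
next
  case (Suc j)
  assume "i < length Ks"
  then show ?thesis using Suc nth_N_Ks[of i] nth_N_Ks[of j] by (simp add: bs_entry_def)
qed

abbreviation (input) "P a \<equiv> replicate k (1 :: 'k polynomial) @ a"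

section \<open>Prepending ones and its inverse\<close>

lemma prepend_tuple:
  assumes a: "a \<in> bs_tuples X Ks"
  shows "P a \<in> bs_tuples X N"
proof -
  have "P a ! i \<in> bs_entry X N i" if i: "i < length N" for i
  proof (cases "i < k")
    case True
    then have "Ds ! i \<subseteq> S" using removal_le[of i] IS k by simp
    then show ?thesis using True by (simp add: nth_append bs_entry_N_Ds invariants_one)
  next
    case False
    then have "i - k < length Ks" "k + (i - k) = i" using i length_N by auto
    then show ?thesis using False bs_tuples_entry[OF a, of "i - k"] bs_entry_N_Ks[of "i - k"]
      by (simp add: nth_append)
  qed
  then show ?thesis using bs_tuples_length[OF a] length_N by (simp add: bs_tuples_def)
qed

lemma prepend_update: "P (a[i := b]) = (P a)[k + i := b]"
  by (simp add: list_update_append)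

lemma prepend_nth: "P a ! (k + i) = a ! i"
  by (simp add: nth_append)

lemma prepend_tensor_map: "tensor_map Ks N P"
  unfolding tensor_map_def
proof (intro ballI conjI allI impI)
  fix a assume a: "a \<in> bs_tuples X Ks"
  show "P a \<in> bs_tuples X N" by (rule prepend_tuple[OF a])
  {
    fix i b c assume i: "i < length Ks" "b \<in> bs_entry X Ks i" "c \<in> bs_entry X Ks i"
    show "bs_pure X N (P (a[i := b + c])) = bs_pure X N (P (a[i := b])) \<otimes>\<^bsub>bs_group X N\<^esub> bs_pure X N (P (a[i := c]))"
      unfolding prepend_update using i length_N
      by (intro bs_pure_add[OF NS prepend_tuple[OF a]]) (simp_all add: bs_entry_N_Ks)
  next
    fix i r assume i: "Suc i < length Ks" "r \<in> invariants X (Ks ! i)"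
    show "bs_pure X N (P (a[i := a ! i * r])) = bs_pure X N (P (a[Suc i := r * a ! Suc i]))"
      using bs_pure_balanced[OF NS prepend_tuple[OF a], of "k + i" r] i length_N nth_N_Ks[of i]
        prepend_nth[of a i] prepend_nth[of a "Suc i"]
      unfolding prepend_update by simp
  }
qed

text \<open>Inverse to prepending ones, up to the relations: the entries 0 to k all lie in R^L, and
  their product can serve as the redundant first entry of a tuple for \<open>Ks\<close>.\<close>

definition collapse :: "'k polynomial list \<Rightarrow> 'k polynomial list" where
  "collapse a = (\<Prod>j\<le>k. a ! j) # drop (Suc k) a"

context
  fixes a assumes a: "a \<in> bs_tuples X N"
begin

text \<open>Invariant rings grow as the sets shrink, so all entries up to position i are available
  in the invariants of \<open>Ds ! i\<close>.\<close>

lemma prod_prefix: "i \<le> k \<Longrightarrow> A \<subseteq> {..i} \<Longrightarrow> (\<Prod>j\<in>A. a ! j) \<in> invariants X (Ds ! i)"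
proof -
  assume i: "i \<le> k" "A \<subseteq> {..i}"
  have S: "Ds ! i \<subseteq> S" using removal_le[of i] IS i k by simp
  have "a ! j \<in> invariants X (Ds ! i)" if "j \<in> A" for j
  proof -
    have j: "j \<le> i" using that i by auto
    then have "a ! j \<in> invariants X (Ds ! j)"
      using bs_tuples_entry[OF a, of j] bs_entry_N_Ds[of j] i length_N Ks_ne by (cases Ks) auto
    moreover have "Ds ! i \<subseteq> Ds ! j" using removal_subset[of j i] j i k by simp
    ultimately show ?thesis using invariants_antimono by blast
  qed
  moreover have "finite A" using i finite_subset by blast
  ultimately show ?thesis
    by (induction A rule: infinite_finite_induct) (auto simp: invariants_one[OF S] intro: invariants_mult[OF S])
qed

lemma length_a: "length a = k + length Ks"
  using bs_tuples_length[OF a] length_N by simp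

lemma collapse_nth_Suc: "collapse a ! Suc i = a ! (k + Suc i)"
  using length_a Ks_ne by (cases Ks) (simp_all add: collapse_def)

lemma collapse_tuple: "collapse a \<in> bs_tuples X Ks"
proof -
  have "collapse a ! i \<in> bs_entry X Ks i" if i: "i < length Ks" for i
  proof (cases i)
    case 0
    then show ?thesis using prod_prefix[of k "{..k}"] Ds_last hdK Ks_ne
      by (simp add: collapse_def bs_entry_def hd_conv_nth)
  next
    case (Suc j)
    then show ?thesis using bs_tuples_entry[OF a, of "k + i"] bs_entry_N_Ks[OF i] i length_N
      by (simp add: collapse_nth_Suc del: add_Suc_right)
  qed
  moreover have "length (collapse a) = length Ks"
    using length_a Ks_ne by (cases Ks) (auto simp: collapse_def)
  ultimately show ?thesis by (simp add: bs_tuples_def)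
qed

lemma collapse_update_gt: "k < i \<Longrightarrow> collapse (a[i := b]) = (collapse a)[i - k := b]"
proof -
  assume i: "k < i"
  have "(\<Prod>j\<le>k. a[i := b] ! j) = (\<Prod>j\<le>k. a ! j)" using i by (intro prod.cong) auto
  moreover obtain j where "i = Suc (k + j)" using i less_imp_Suc_add by blast
  ultimately show ?thesis by (simp add: collapse_def drop_update_swap)
qed

lemma collapse_update_le:
  "i \<le> k \<Longrightarrow> collapse (a[i := b]) = (collapse a)[0 := b * (\<Prod>j\<in>{..k} - {i}. a ! j)]"
proof -
  assume i: "i \<le> k"
  have "(\<Prod>j\<le>k. a[i := b] ! j) = a[i := b] ! i * (\<Prod>j\<in>{..k} - {i}. a[i := b] ! j)"
    using i by (intro prod.remove) auto
  also have "(\<Prod>j\<in>{..k} - {i}. a[i := b] ! j) = (\<Prod>j\<in>{..k} - {i}. a ! j)"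
    by (intro prod.cong) auto
  also have "a[i := b] ! i = b" using i length_a Ks_ne by (cases Ks) auto
  finally show ?thesis using i by (simp add: collapse_def)
qed

lemma collapse_zero: "i \<le> k \<Longrightarrow> collapse a ! 0 = a ! i * (\<Prod>j\<in>{..k} - {i}. a ! j)"
  using prod.remove[of "{..k}" i "\<lambda>j. a ! j"] by (simp add: collapse_def)

text \<open>This tuple interpolates between a, for j = 0, and the collapsed tuple preceded by ones,
  for j = k: the product of the first entries has been pushed into position j.\<close>

definition "moved j = map (\<lambda>i. if i < j then 1 else if i = j then \<Prod>l\<le>j. a ! l else a ! i) [0..<length a]"

lemma moved_tuple:
  assumes j: "j \<le> k"
  shows "(moved j)[j := 1] \<in> bs_tuples X N"
proof -
  have "(moved j)[j := 1] ! i \<in> bs_entry X N i" if i: "i < length N" for i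
  proof -
    have "i < length a" using i length_a length_N by simp
    then have "(moved j)[j := 1] ! i = (if i \<le> j then 1 else a ! i)"
      by (cases "i = j") (auto simp: moved_def)
    then show ?thesis using bs_entry_one[OF NS i] bs_tuples_entry[OF a i] by simp
  qed
  then show ?thesis using length_a length_N by (simp add: bs_tuples_def moved_def)
qed

text \<open>Each push is a single balancing relation, because the product of the entries up to j is
  invariant under the parabolic subgroup of \<open>Ds ! j\<close>.\<close>

lemma moved_pure: "j \<le> k \<Longrightarrow> bs_pure X N (moved j) = bs_pure X N a"
proof (induction j)
  case 0
  have "moved 0 = a" by (rule nth_equalityI) (auto simp: moved_def)
  then show ?case by simp
next
  case (Suc j)
  let ?r = "\<Prod>l\<le>j. a ! l" and ?b = "(moved j)[j := 1]"
  have len: "Suc j < length a" using Suc.prems length_a Ks_ne by (cases Ks) auto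
  have "?r \<in> invariants X (N ! j)" using prod_prefix[of j "{..j}"] Suc.prems nth_N_Ds[of j] by simp
  then have "bs_pure X N (?b[j := ?b ! j * ?r]) = bs_pure X N (?b[Suc j := ?r * ?b ! Suc j])"
    using Suc.prems length_N len length_a by (intro bs_pure_balanced[OF NS moved_tuple]) auto
  moreover have "?b[j := ?b ! j * ?r] = moved j"
    using len by (intro nth_equalityI) (auto simp: moved_def nth_list_update)
  moreover have "?b[Suc j := ?r * ?b ! Suc j] = moved (Suc j)"
    using len by (intro nth_equalityI) (auto simp: moved_def nth_list_update)
  ultimately show ?case using Suc by simp
qed

lemma prepend_collapse_pure: "bs_pure X N (P (collapse a)) = bs_pure X N a"
proof -
  have "P (collapse a) = moved k"
  proof (rule nth_equalityI)
    show len: "length (P (collapse a)) = length (moved k)"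
      using bs_tuples_length[OF collapse_tuple] length_a by (simp add: moved_def)
    fix i assume i: "i < length (P (collapse a))"
    then have ia: "i < length a" using bs_tuples_length[OF collapse_tuple] length_a by simp
    consider "i < k" | "i = k" | l where "i = k + Suc l"
      by (metis less_imp_Suc_add linorder_neqE_nat add_Suc_right)
    then show "P (collapse a) ! i = moved k ! i"
    proof cases
      case 2
      then show ?thesis using ia by (simp add: nth_append moved_def collapse_def)
    next
      case (3 l)
      then show ?thesis using ia collapse_nth_Suc[of l] by (simp add: nth_append moved_def)
    qed (use ia in \<open>simp add: nth_append moved_def\<close>)
  qed
  then show ?thesis using moved_pure[of k] by simp
qed

end

lemma collapse_tensor_map: "tensor_map N Ks collapse"
  unfolding tensor_map_def
proof (intro ballI conjI allI impI)
  fix a assume a: "a \<in> bs_tuples X N"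
  note ca = collapse_tuple[OF a]
  have K0: "bs_entry X Ks 0 = invariants X L" using hdK Ks_ne by (simp add: bs_entry_def hd_conv_nth)
  have Q: "b * (\<Prod>j\<in>{..k} - {i}. a ! j) \<in> bs_entry X Ks 0" if "i \<le> k" "b \<in> bs_entry X N i" for i b
  proof -
    have "Ds ! k \<subseteq> Ds ! i" using removal_subset[of i k] that k by simp
    then have "b \<in> invariants X L"
      using that bs_entry_N_Ds[of i] invariants_antimono Ds_last by blast
    moreover have "(\<Prod>j\<in>{..k} - {i}. a ! j) \<in> invariants X L"
      using prod_prefix[OF a, of k "{..k} - {i}"] Ds_last by auto
    ultimately show ?thesis unfolding K0 by (rule invariants_mult[OF LS])
  qed
  show "collapse a \<in> bs_tuples X Ks" by (rule ca)
  {
    fix i b c assume i: "i < length N" "b \<in> bs_entry X N i" "c \<in> bs_entry X N i"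
    show "bs_pure X Ks (collapse (a[i := b + c])) =
        bs_pure X Ks (collapse (a[i := b])) \<otimes>\<^bsub>bs_group X Ks\<^esub> bs_pure X Ks (collapse (a[i := c]))"
    proof (cases "i \<le> k")
      case True
      then show ?thesis using bs_pure_add[OF KsS ca, of 0] Ks_ne Q[OF True i(2)] Q[OF True i(3)]
        by (simp add: collapse_update_le[OF a] distrib_right)
    next
      case False
      then have "k + (i - k) = i" "i - k < length Ks" using i length_N by auto
      then show ?thesis using False bs_pure_add[OF KsS ca, of "i - k"] i bs_entry_N_Ks[of "i - k"]
        by (simp add: collapse_update_gt[OF a])
    qed
  next
    fix i r assume i: "Suc i < length N" "r \<in> invariants X (N ! i)"
    \<comment> \<open>Balancing inside the collapsed block only rearranges one product; for i = k it
      becomes balancing in position 0 of \<open>Ks\<close>, and beyond k it is balancing in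
      \<open>Ks\<close> shifted by k.\<close>
    consider "i < k" | "i = k" | "i > k" by linarith
    then show "bs_pure X Ks (collapse (a[i := a ! i * r])) =
        bs_pure X Ks (collapse (a[Suc i := r * a ! Suc i]))"
    proof cases
      case 1
      have e1: "a ! i * r * (\<Prod>j\<in>{..k} - {i}. a ! j) = r * collapse a ! 0"
        unfolding collapse_zero[OF a less_imp_le[OF 1]] by (simp only: mult_ac)
      have e2: "r * a ! Suc i * (\<Prod>j\<in>{..k} - {Suc i}. a ! j) = r * collapse a ! 0"
        unfolding collapse_zero[OF a Suc_leI[OF 1]] by (simp only: mult_ac)
      show ?thesis
        unfolding collapse_update_le[OF a less_imp_le[OF 1]] collapse_update_le[OF a Suc_leI[OF 1]] e1 e2 ..
    next
      case 2
      have e: "a ! k * r * (\<Prod>j\<in>{..k} - {k}. a ! j) = collapse a ! 0 * r"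
        unfolding collapse_zero[OF a order_refl] by (simp only: mult_ac)
      have "collapse (a[i := a ! i * r]) = (collapse a)[0 := collapse a ! 0 * r]"
        unfolding 2 collapse_update_le[OF a order_refl] e ..
      moreover have "collapse (a[Suc i := r * a ! Suc i]) = (collapse a)[Suc 0 := r * collapse a ! Suc 0]"
        using 2 collapse_nth_Suc[OF a, of 0] by (simp add: collapse_update_gt[OF a])
      moreover have "Suc 0 < length Ks" "r \<in> invariants X (Ks ! 0)"
        using i 2 length_N nth_N_Ks[of 0] Ks_ne by auto
      ultimately show ?thesis using bs_pure_balanced[OF KsS ca] by simp
    next
      case 3
      then obtain j where j: "i = k + Suc j" using less_imp_Suc_add by fastforce
      have "Suc (Suc j) < length Ks" "r \<in> invariants X (Ks ! Suc j)"
        using i j length_N nth_N_Ks[of "Suc j"] by auto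
      then show ?thesis
        using bs_pure_balanced[OF KsS ca, of "Suc j" r] j 3 collapse_nth_Suc[OF a, of j] collapse_nth_Suc[OF a, of "Suc j"]
        by (simp add: collapse_update_gt[OF a] Suc_diff_le)
    qed
  }
qed

lemma collapse_prepend: "a \<in> bs_tuples X Ks \<Longrightarrow> collapse (P a) = a"
proof -
  assume a: "a \<in> bs_tuples X Ks"
  then obtain b c where bc: "a = b # c" using bs_tuples_length[OF a] Ks_ne by (cases a) auto
  have "(\<Prod>j\<le>k. P a ! j) = (\<Prod>j<k. P a ! j) * P a ! k" by (simp add: lessThan_Suc_atMost[symmetric])
  also have "(\<Prod>j<k. P a ! j) = 1" by (intro prod.neutral) (auto simp: nth_append)
  finally show ?thesis using bc by (simp add: collapse_def nth_append)
qed

section \<open>The isomorphism and the transported action\<close>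

lemma prepend_ones_induced: "prepend_ones X Ds Ks = bs_induced X N P"
  by (rule ext) (simp add: prepend_ones_def k)

abbreviation (input) "F \<equiv> prepend_ones X Ds Ks"
abbreviation (input) "C \<equiv> bs_induced X Ks collapse"

lemma prepend_ones_pure: "a \<in> bs_tuples X Ks \<Longrightarrow> F (bs_pure X Ks a) = bs_pure X N (P a)"
  unfolding prepend_ones_induced by (rule bs_induced_pure[OF KsS NS prepend_tensor_map])

lemma prepend_ones_carrier: "u \<in> carrier (bs_group X Ks) \<Longrightarrow> F u \<in> carrier (bs_group X N)"
  unfolding prepend_ones_induced by (rule bs_induced_carrier[OF KsS NS prepend_tensor_map])

lemma prepend_ones_mult:
  "u \<in> carrier (bs_group X Ks) \<Longrightarrow> v \<in> carrier (bs_group X Ks) \<Longrightarrow>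
    F (u \<otimes>\<^bsub>bs_group X Ks\<^esub> v) = F u \<otimes>\<^bsub>bs_group X N\<^esub> F v"
  unfolding prepend_ones_induced by (rule bs_induced_mult[OF KsS NS prepend_tensor_map])

lemma prepend_ones_one: "F \<one>\<^bsub>bs_group X Ks\<^esub> = \<one>\<^bsub>bs_group X N\<^esub>"
  unfolding prepend_ones_induced by (rule bs_induced_one[OF KsS NS prepend_tensor_map])

lemmas collapse_pure = bs_induced_pure[OF NS KsS collapse_tensor_map]
lemmas collapse_carrier = bs_induced_carrier[OF NS KsS collapse_tensor_map]
lemmas collapse_mult = bs_induced_mult[OF NS KsS collapse_tensor_map]
lemmas collapse_one = bs_induced_one[OF NS KsS collapse_tensor_map]

lemmas bs_ind_Ks = bs_induct[OF KsS Ks_ne, consumes 1, case_names zero pure add]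
lemmas bs_ind_N = bs_induct[OF NS N_ne, consumes 1, case_names zero pure add]

lemma collapse_prepend_ones: "u \<in> carrier (bs_group X Ks) \<Longrightarrow> C (F u) = u"
proof (induction u rule: bs_ind_Ks)
  case (pure a)
  then show ?case by (simp add: prepend_ones_pure collapse_pure prepend_tuple collapse_prepend)
qed (simp_all add: prepend_ones_one collapse_one prepend_ones_mult collapse_mult prepend_ones_carrier)

lemma prepend_ones_collapse: "u \<in> carrier (bs_group X N) \<Longrightarrow> F (C u) = u"
proof (induction u rule: bs_ind_N)
  case (pure a)
  then show ?case
    by (simp add: prepend_ones_pure collapse_pure collapse_tuple prepend_collapse_pure)
qed (simp_all add: prepend_ones_one collapse_one prepend_ones_mult collapse_mult collapse_carrier)

lemma prepend_ones_bij: "bij_betw F (carrier (bs_group X Ks)) (carrier (bs_group X N))"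
  by (rule bij_betw_byWitness[where f' = C])
    (auto simp: collapse_prepend_ones prepend_ones_collapse prepend_ones_carrier collapse_carrier)

lemma prepend_ones_mul:
  assumes i: "i < length Ks" and r: "r \<in> bs_entry X Ks i" and u: "u \<in> carrier (bs_group X Ks)"
  shows "F (bs_mul X Ks i r u) = bs_mul X N (k + i) r (F u)"
proof -
  have ki: "k + i < length N" "r \<in> bs_entry X N (k + i)" using i r length_N by (simp_all add: bs_entry_N_Ks)
  show ?thesis
    using u
  proof (induction u rule: bs_ind_Ks)
    case zero
    then show ?case using i r ki
      by (simp add: bs_mul_one[OF KsS Ks_ne] bs_mul_one[OF NS N_ne] prepend_ones_one)
  next
    case (pure a)
    have "a[i := a ! i * r] \<in> bs_tuples X Ks"
      using bs_tuples_update[OF pure bs_entry_mult(1)[OF KsS i bs_tuples_entry[OF pure i] r]] .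
    then show ?case using i r ki pure prepend_update[of a i "a ! i * r"] prepend_nth[of a i]
      by (simp add: bs_mul_pure[OF KsS Ks_ne] bs_mul_pure[OF NS N_ne] prepend_ones_pure prepend_tuple)
  next
    case (add u v)
    then show ?case using i r ki
      by (simp add: bs_mul_mult[OF KsS Ks_ne] bs_mul_mult[OF NS N_ne] prepend_ones_mult
          bs_mul_carrier[OF KsS Ks_ne] prepend_ones_carrier)
  qed
qed

lemma invariants_Ds: "r \<in> invariants X I \<Longrightarrow> i \<le> k \<Longrightarrow> r \<in> invariants X (Ds ! i)"
  using removal_le[of i] invariants_antimono[of "Ds ! i" I] k by auto

text \<open>R^I lies in the invariants of every set of the removal part, so r can be passed through
  this part by balancing.\<close>

lemma mul_prefix:
  assumes r: "r \<in> invariants X I" and j: "j \<le> k" and u: "u \<in> carrier (bs_group X N)"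
  shows "bs_mul X N j r u = bs_mul X N 0 r u"
proof -
  have "0 < length Ks" using Ks_ne by simp
  then have "i < length N" if "i \<le> k" for i
    using that length_N by linarith
  moreover have "r \<in> bs_entry X N i" if "i \<le> k" for i
    using invariants_Ds[OF r that] bs_entry_N_Ds[OF that] by simp
  ultimately have ent: "r \<in> bs_entry X N i" "i < length N" if "i \<le> k" for i
    using that by simp_all
  note ej = ent(2,1)[OF j] and e0 = ent(2,1)[OF le0]
  show ?thesis
    using u
  proof (induction u rule: bs_ind_N)
    case zero
    show ?case unfolding bs_mul_one[OF NS N_ne ej] bs_mul_one[OF NS N_ne e0] ..
  next
    case (pure a)
    have "bs_pure X N (a[j := a ! j * r]) = bs_pure X N (a[0 := a ! 0 * r])"
      using j
    proof (induction j)
      case (Suc j)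
      then show ?case
        using bs_pure_balanced[OF NS pure, of j r] ent[of "Suc j"] invariants_Ds[OF r, of j] nth_N_Ds[of j]
        by (simp add: mult.commute)
    qed simp
    then show ?case unfolding bs_mul_pure[OF NS N_ne ej pure] bs_mul_pure[OF NS N_ne e0 pure] .
  next
    case (add u v)
    show ?case
      unfolding bs_mul_mult[OF NS N_ne ej add(1,2)] bs_mul_mult[OF NS N_ne e0 add(1,2)] add(3,4) ..
  qed
qed

text \<open>Position k is where L is reached and where the tensor product of \<open>Ks\<close>
  begins, so multiplying there is the transported left action.\<close>

lemma redundancy_action_mul:
  assumes r: "r \<in> invariants X L" and u: "u \<in> carrier (bs_group X N)"
  shows "redundancy_action X Ds Ks r u = bs_mul X N k r u"
proof -
  have "inv_into (carrier (bs_group X Ks)) F u = C u"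
    using prepend_ones_bij u
    by (intro inv_into_f_eq) (auto simp: bij_betw_def collapse_carrier prepend_ones_collapse)
  moreover have "r \<in> bs_entry X Ks 0" using r hdK Ks_ne by (simp add: bs_entry_def hd_conv_nth)
  ultimately show ?thesis
    unfolding redundancy_action_def using Ks_ne u prepend_ones_mul[of 0 r "C u"]
    by (simp add: collapse_carrier prepend_ones_collapse)
qed

text \<open>Prepending and collapsing both take homogeneous pure tensors, which generate the graded
  pieces, to homogeneous pure tensors. The difference of the two values of \<open>bs_shift\<close>
  is the normalization contributed by the removal steps.\<close>

lemma prepend_ones_grade:
  "F ` bs_grade X Ks (bs_shift X N - bs_shift X Ks + j) = bs_grade X N j"
proof -
  define A where "A = {bs_pure X Ks a | a. a \<in> bs_tuples X Ks \<and> (\<exists>e. (\<forall>i<length Ks. homogeneous (e i) (a ! i)) \<and>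
    (\<Sum>i<length Ks. e i) - bs_shift X Ks = bs_shift X N - bs_shift X Ks + j)}"
  define B where "B = {bs_pure X N a | a. a \<in> bs_tuples X N \<and> (\<exists>e. (\<forall>i<length N. homogeneous (e i) (a ! i)) \<and>
    (\<Sum>i<length N. e i) - bs_shift X N = j)}"
  have gA: "bs_grade X Ks (bs_shift X N - bs_shift X Ks + j) = generate (bs_group X Ks) A"
    unfolding bs_grade_def A_def ..
  have gB: "bs_grade X N j = generate (bs_group X N) B"
    unfolding bs_grade_def B_def ..
  have AK: "A \<subseteq> carrier (bs_group X Ks)" and BN: "B \<subseteq> carrier (bs_group X N)"
    using bs_pure_carrier[OF KsS] bs_pure_carrier[OF NS] by (auto simp: A_def B_def)
  have gK: "group (bs_group X Ks)" and gN: "group (bs_group X N)"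
    using bs_comm_group[OF KsS] bs_comm_group[OF NS] comm_group.axioms(2) by blast+
  have FA: "F ` A \<subseteq> B"
  proof
    fix y assume "y \<in> F ` A"
    then obtain a e where a: "a \<in> bs_tuples X Ks" "y = F (bs_pure X Ks a)"
        and e: "\<And>i. i < length Ks \<Longrightarrow> homogeneous (e i) (a ! i)" "(\<Sum>i<length Ks. e i) = bs_shift X N + j"
      unfolding A_def by fastforce
    define e' where "e' i = (if i < k then 0 else e (i - k))" for i
    have "homogeneous (e' i) (P a ! i)" if "i < length N" for i
      using that e(1)[of "i - k"] length_N by (auto simp: e'_def nth_append homogeneous_one)
    moreover have "(\<Sum>i<length N. e' i) - bs_shift X N = j"
      unfolding length_N sum_lessThan_split using e(2) by (simp add: e'_def)
    ultimately show "y \<in> B" unfolding B_def a(2) prepend_ones_pure[OF a(1)]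
      using prepend_tuple[OF a(1)] by blast
  qed
  have CB: "C ` B \<subseteq> A"
  proof
    fix y assume "y \<in> C ` B"
    then obtain a e where a: "a \<in> bs_tuples X N" "y = C (bs_pure X N a)"
        and e: "\<And>i. i < length N \<Longrightarrow> homogeneous (e i) (a ! i)" "(\<Sum>i<length N. e i) = bs_shift X N + j"
      unfolding B_def by fastforce
    obtain m where m: "length Ks = Suc m" using Ks_ne by (cases Ks) auto
    \<comment> \<open>Degrees add under multiplication, so the collapsed entry has the total degree
      of the first k + 1 entries.\<close>
    define e' where "e' i = (if i = 0 then \<Sum>l\<le>k. e l else e (k + i))" for i
    have "homogeneous (e' i) (collapse a ! i)" if i: "i < length Ks" for i
    proof (cases i)
      case 0
      have "homogeneous (\<Sum>l\<le>k. e l) (\<Prod>l\<le>k. a ! l)"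
        using e(1) length_N m by (intro homogeneous_prod) auto
      then show ?thesis using 0 by (simp add: e'_def collapse_def)
    next
      case (Suc l)
      then show ?thesis using e(1)[of "k + i"] i length_N collapse_nth_Suc[OF a(1), of l]
        by (simp add: e'_def)
    qed
    moreover have "(\<Sum>i<length Ks. e' i) = (\<Sum>i<length N. e i)"
    proof -
      have "(\<Sum>i<length N. e i) = (\<Sum>i<Suc k + m. e i)" using length_N m by simp
      also have "\<dots> = (\<Sum>l<Suc k. e l) + (\<Sum>i<m. e (Suc k + i))" by (rule sum_lessThan_split)
      also have "\<dots> = (\<Sum>i<Suc m. e' i)"
        unfolding sum.lessThan_Suc_shift[of e'] by (simp add: e'_def lessThan_Suc_atMost)
      finally show ?thesis using m by simp
    qed
    ultimately show "y \<in> A" unfolding A_def a(2) collapse_pure[OF a(1)]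
      using collapse_tuple[OF a(1)] e(2) by fastforce
  qed
  have homF: "F \<in> hom (bs_group X Ks) (bs_group X N)"
    by (auto simp: hom_def prepend_ones_carrier prepend_ones_mult)
  have homC: "C \<in> hom (bs_group X N) (bs_group X Ks)"
    by (auto simp: hom_def collapse_carrier collapse_mult)
  have 1: "F ` generate (bs_group X Ks) A \<subseteq> generate (bs_group X N) B"
    by (rule generate_image_subset[OF gK gN homF AK FA])
  have 2: "C ` generate (bs_group X N) B \<subseteq> generate (bs_group X Ks) A"
    by (rule generate_image_subset[OF gN gK homC BN CB])
  have "x \<in> F ` generate (bs_group X Ks) A" if x: "x \<in> generate (bs_group X N) B" for x
  proof -
    have "x \<in> carrier (bs_group X N)" using group.generate_in_carrier[OF gN BN x] .
    then have "x = F (C x)" by (simp add: prepend_ones_collapse)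
    then show ?thesis using 2 x by blast
  qed
  then show ?thesis unfolding gA gB using 1 by blast
qed

lemma prepend_ones_graded_iso:
  "prepend_ones X Ds Ks \<in> graded_iso (inv_ring X I) (inv_ring X (last Ks))
    (shift (bs_shift X N - bs_shift X Ks) (BS X Ks)) (BS X N)"
proof -
  have l: "length Ks - 1 < length Ks" "k + (length Ks - 1) = length N - 1"
    using Ks_ne length_N by (cases Ks; simp)+
  have "F (bs_mul X Ks 0 r u) = bs_mul X N 0 r (F u)"
    if r: "r \<in> invariants X I" and u: "u \<in> carrier (bs_group X Ks)" for r u
  proof -
    have "r \<in> invariants X L" using invariants_Ds[OF r, of k] Ds_last by simp
    then have "r \<in> bs_entry X Ks 0" using hdK Ks_ne by (simp add: bs_entry_def hd_conv_nth)
    then show ?thesis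
      using prepend_ones_mul[of 0 r u] mul_prefix[OF r, of k "F u"] u Ks_ne by (simp add: prepend_ones_carrier)
  qed
  moreover have "F (bs_mul X Ks (length Ks - 1) r u) = bs_mul X N (length N - 1) r (F u)"
    if r: "r \<in> invariants X (last Ks)" and u: "u \<in> carrier (bs_group X Ks)" for r u
  proof -
    have "r \<in> bs_entry X Ks (length Ks - 1)"
      using r Ks_ne by (intro invariants_bs_entry) (simp add: last_conv_nth)
    then show ?thesis using prepend_ones_mul[OF l(1) _ u] l(2) by simp
  qed
  ultimately show ?thesis
    unfolding graded_iso_def bimodule_hom_def shift_def
    using prepend_ones_bij prepend_ones_grade
    by (auto simp: prepend_ones_carrier prepend_ones_mult inv_ring_def)
qed

lemma redundancy_bimodule:
  "is_bimodule (inv_ring X L) (inv_ring X (last Ks)) ((BS X N)\<lparr>smult := redundancy_action X Ds Ks\<rparr>)"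
proof -
  have kN: "k < length N" using length_N Ks_ne by simp
  have lN: "length N - 1 < length N" using N_ne by simp
  have ekL: "invariants X L \<subseteq> bs_entry X N k" using bs_entry_N_Ds[of k] Ds_last by simp
  have JS: "last Ks \<subseteq> S" using KsS Ks_ne by simp
  have eJ: "invariants X (last Ks) \<subseteq> bs_entry X N (length N - 1)"
  proof -
    have "N ! (length N - 1) = last Ks"
      using nth_N_Ks[of "length Ks - 1"] length_N Ks_ne by (cases Ks) (auto simp: last_conv_nth)
    then show ?thesis using invariants_bs_entry[of _ N "length N - 1"] by auto
  qed
  show ?thesis
    unfolding is_bimodule_def
  proof (intro conjI ballI)
    show "Module.module (inv_ring X L) ((BS X N)\<lparr>smult := redundancy_action X Ds Ks\<rparr>)"
      by (rule bs_module[OF NS N_ne kN LS ekL]) (simp_all add: redundancy_action_mul)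
    show "Module.module (inv_ring X (last Ks)) ((BS X N)\<lparr>smult := redundancy_action X Ds Ks,
        smult := rsmult ((BS X N)\<lparr>smult := redundancy_action X Ds Ks\<rparr>)\<rparr>)"
      by (rule bs_module[OF NS N_ne lN JS eJ]) simp_all
    fix a b x
    assume "a \<in> carrier (inv_ring X L)" "b \<in> carrier (inv_ring X (last Ks))"
      and "x \<in> carrier ((BS X N)\<lparr>smult := redundancy_action X Ds Ks\<rparr>)"
    then have a: "a \<in> invariants X L" and b: "b \<in> invariants X (last Ks)"
      and x: "x \<in> carrier (bs_group X N)" by (auto simp: inv_ring_def)
    have "bs_mul X N (length N - 1) b x \<in> carrier (bs_group X N)"
      using bs_mul_carrier[OF NS N_ne lN] b eJ x by blast
    then show "rsmult ((BS X N)\<lparr>smult := redundancy_action X Ds Ks\<rparr>) b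
        (a \<odot>\<^bsub>(BS X N)\<lparr>smult := redundancy_action X Ds Ks\<rparr>\<^esub> x) =
      a \<odot>\<^bsub>(BS X N)\<lparr>smult := redundancy_action X Ds Ks\<rparr>\<^esub>
        rsmult ((BS X N)\<lparr>smult := redundancy_action X Ds Ks\<rparr>) b x"
      using redundancy_action_mul[OF a] bs_mul_commute[OF NS N_ne kN lN, of b a x] a b eJ ekL x by auto
  qed
qed

lemma redundancy_action_restricts:
  assumes "r \<in> invariants X I" "x \<in> carrier (BS X N)"
  shows "redundancy_action X Ds Ks r x = r \<odot>\<^bsub>BS X N\<^esub> x"
  using assms redundancy_action_mul[of r x] mul_prefix[of r k x] invariants_Ds[of r k] Ds_last by simp

text \<open>A path in $K_\bullet$ is continued to the left by the constant path $1$, so that the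
  elements of $R^L$ act on the left by themselves.\<close>

lemma evaluation_exists:
  assumes w: "w \<in> path_set X Ks"
  shows "\<exists>\<phi>. (\<forall>u\<in>carrier (bs_group X N). \<forall>v\<in>carrier (bs_group X N).
      \<phi> (u \<otimes>\<^bsub>bs_group X N\<^esub> v) = \<phi> u + \<phi> v) \<and>
    (\<forall>r\<in>invariants X I. \<forall>u\<in>carrier (bs_group X N). \<phi> (bs_mul X N 0 r u) = r * \<phi> u) \<and>
    (\<forall>r\<in>invariants X (last Ks). \<forall>u\<in>carrier (bs_group X N).
      \<phi> (bs_mul X N (length N - 1) r u) = weyl_act X w r * \<phi> u) \<and>
    (\<forall>r\<in>invariants X L. \<phi> (redundancy_action X Ds Ks r (one_tensor X N)) = r)"
proof -
  obtain x where x: "x 0 = \<one>" "x (length Ks) = w" "\<forall>i\<le>length Ks. x i \<in> carrier X"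
      "\<forall>i<length Ks. \<exists>u\<in>parabolic X (Ks ! i). x (Suc i) = x i \<otimes> u"
    using path_set_sequence[OF KsS w] by blast
  note ev = path_eval_functional[OF KsS x(3,4)] and ev_mul = path_eval_lift_mul[OF KsS x(3,4)]
  \<comment> \<open>Collapsing first makes position k of the long expression the start of the path,
    so elements of R^L act there through 1.\<close>
  define \<phi> where "\<phi> u = bs_lift (path_eval x) (C u)" for u
  have l: "0 < length Ks" "length Ks - 1 < length Ks" "k + (length Ks - 1) = length N - 1"
      "Suc (length Ks - 1) = length Ks"
    using Ks_ne length_N by (cases Ks; simp)+
  have mul: "\<phi> (bs_mul X N (k + i) r u) = weyl_act X (x i) r * \<phi> u"
    if i: "i < length Ks" and r: "r \<in> bs_entry X Ks i" and u: "u \<in> carrier (bs_group X N)" for i r u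
  proof -
    have Cu: "C u \<in> carrier (bs_group X Ks)" using u by (rule collapse_carrier)
    have "bs_mul X N (k + i) r u = F (bs_mul X Ks i r (C u))"
      unfolding prepend_ones_mul[OF i r Cu] prepend_ones_collapse[OF u] ..
    then have "C (bs_mul X N (k + i) r u) = bs_mul X Ks i r (C u)"
      using collapse_prepend_ones[OF bs_mul_carrier[OF KsS Ks_ne i r Cu]] by simp
    then show ?thesis unfolding \<phi>_def using ev_mul[OF i r Cu] by simp
  qed
  have e0: "r \<in> bs_entry X Ks 0" "r \<in> sym_ring X" if "r \<in> invariants X L" for r
    using that hdK Ks_ne by (auto simp: bs_entry_def hd_conv_nth invariants_def)
  have mul0: "\<phi> (bs_mul X N k r u) = r * \<phi> u"
    if r: "r \<in> invariants X L" and u: "u \<in> carrier (bs_group X N)" for r u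
    using mul[OF l(1) e0(1)[OF r] u] e0(2)[OF r] x(1) by simp
  have "\<phi> (u \<otimes>\<^bsub>bs_group X N\<^esub> v) = \<phi> u + \<phi> v"
    if "u \<in> carrier (bs_group X N)" "v \<in> carrier (bs_group X N)" for u v
    unfolding \<phi>_def collapse_mult[OF that]
    by (rule bs_lift_mult[OF KsS ev collapse_carrier[OF that(1)] collapse_carrier[OF that(2)]])
  moreover have "\<phi> (bs_mul X N 0 r u) = r * \<phi> u"
    if r: "r \<in> invariants X I" and u: "u \<in> carrier (bs_group X N)" for r u
  proof -
    have "r \<in> invariants X L" using invariants_Ds[OF r, of k] Ds_last by simp
    from mul0[OF this u] show ?thesis unfolding mul_prefix[OF r order_refl u] .
  qed
  moreover have "\<phi> (bs_mul X N (length N - 1) r u) = weyl_act X w r * \<phi> u"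
    if r: "r \<in> invariants X (last Ks)" and u: "u \<in> carrier (bs_group X N)" for r u
  proof -
    have r': "r \<in> invariants X (Ks ! (length Ks - 1))" using r Ks_ne by (simp add: last_conv_nth)
    \<comment> \<open>The last position is evaluated by the element before the last factor of the
      path. That factor fixes the invariants of \<open>last Ks\<close>, so the twist can be taken to
      be w.\<close>
    have "weyl_act X w r = weyl_act X (x (length Ks - 1)) r"
      using path_step_invariant[OF KsS x(3,4) l(2) r'] x(2) l(4) by simp
    then show ?thesis using mul[OF l(2) invariants_bs_entry[OF r'] u] l(3) by simp
  qed
  moreover have "\<phi> (redundancy_action X Ds Ks r (one_tensor X N)) = r" if r: "r \<in> invariants X L" for r
  proof -
    let ?o = "replicate (length Ks) (1 :: 'k polynomial)"
    have o: "?o \<in> bs_tuples X Ks" using bs_entry_one[OF KsS] by (simp add: bs_tuples_def)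
    have "one_tensor X N = F (bs_pure X Ks ?o)"
      unfolding one_tensor_def prepend_ones_pure[OF o] length_N replicate_add ..
    then have o1: "one_tensor X N \<in> carrier (bs_group X N)" "C (one_tensor X N) = bs_pure X Ks ?o"
      using prepend_ones_carrier collapse_prepend_ones bs_pure_carrier[OF KsS o] by simp_all
    have "path_eval x ?o = 1" unfolding path_eval_def using x(3) by (intro prod.neutral) auto
    then have "\<phi> (one_tensor X N) = 1"
      unfolding \<phi>_def o1(2) bs_lift_pure[OF KsS ev] .
    then show ?thesis using mul0[OF r o1(1)] redundancy_action_mul[OF r o1(1)] by simp
  qed
  ultimately show ?thesis by blast
qed

end

end

section \<open>Morphisms through lower terms\<close>

lemma graded_homE:
  assumes "g \<in> graded_hom A B M N"
  obtains F :: "int set" and h where "finite F" "\<And>i. i \<in> F \<Longrightarrow> h i \<in> bimodule_hom A B M N"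
    "\<And>x. x \<in> carrier M \<Longrightarrow> g x = (\<Oplus>\<^bsub>N\<^esub>i\<in>F. h i x)"
proof -
  obtain F h where "finite F" "\<forall>i\<in>F. h i \<in> hom_deg A B i M N"
      "\<forall>x\<in>carrier M. g x = (\<Oplus>\<^bsub>N\<^esub>i\<in>F. h i x)"
    using assms unfolding graded_hom_def by blast
  then show ?thesis by (intro that[of F h]) (auto simp: hom_deg_def)
qed

context faithful_realization
begin

text \<open>The module axioms contain the additive group in the form in which finite sums of
  morphisms are expressed.\<close>

lemma bs_abelian_group:
  assumes "\<forall>I\<in>set Is. I \<subseteq> S" "Is \<noteq> []"
  shows "abelian_group (BS X Is)"
proof -
  have "hd Is \<subseteq> S" using assms by simp
  moreover have "invariants X (hd Is) \<subseteq> bs_entry X Is 0"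
    using assms(2) by (auto simp: bs_entry_def hd_conv_nth)
  ultimately have "Module.module (inv_ring X (hd Is)) (BS X Is)"
    using assms by (intro bs_module[OF assms, of 0]) auto
  then show ?thesis by (rule module.axioms(2))
qed

lemma bs_finsum_hom:
  assumes Is: "\<forall>I\<in>set Is. I \<subseteq> S" "Is \<noteq> []"
    and hom: "\<And>u v. u \<in> carrier (bs_group X Is) \<Longrightarrow> v \<in> carrier (bs_group X Is) \<Longrightarrow>
      \<phi> (u \<otimes>\<^bsub>bs_group X Is\<^esub> v) = \<phi> u + \<phi> v"
    and A: "finite A" "h \<in> A \<rightarrow> carrier (bs_group X Is)"
  shows "\<phi> (\<Oplus>\<^bsub>BS X Is\<^esub>i\<in>A. h i) = (\<Sum>i\<in>A. \<phi> (h i) :: 'k polynomial)"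
proof -
  interpret B: abelian_group "BS X Is" by (rule bs_abelian_group[OF Is])
  have "\<phi> (\<zero>\<^bsub>BS X Is\<^esub> \<oplus>\<^bsub>BS X Is\<^esub> \<zero>\<^bsub>BS X Is\<^esub>) = \<phi> \<zero>\<^bsub>BS X Is\<^esub> + \<phi> \<zero>\<^bsub>BS X Is\<^esub>"
    using hom[of "\<zero>\<^bsub>BS X Is\<^esub>" "\<zero>\<^bsub>BS X Is\<^esub>"] B.zero_closed by simp
  then have zero: "\<phi> \<zero>\<^bsub>BS X Is\<^esub> = 0"
    unfolding B.l_zero[OF B.zero_closed] by (metis add_cancel_right_right)
  from A show ?thesis
  proof (induction A rule: finite_induct)
    case empty
    show ?case using zero by (simp only: B.finsum_empty sum.empty)
  next
    case (insert a A)
    then have h: "h \<in> A \<rightarrow> carrier (BS X Is)" "h a \<in> carrier (BS X Is)" by auto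
    have "\<phi> (\<Oplus>\<^bsub>BS X Is\<^esub>i\<in>insert a A. h i) = \<phi> (h a \<oplus>\<^bsub>BS X Is\<^esub> (\<Oplus>\<^bsub>BS X Is\<^esub>i\<in>A. h i))"
      using B.finsum_insert[OF insert.hyps h] by simp
    also have "\<dots> = \<phi> (h a) + \<phi> (\<Oplus>\<^bsub>BS X Is\<^esub>i\<in>A. h i)"
      using hom h(2) B.finsum_closed[OF h(1)] by simp
    finally show ?case using insert h by simp
  qed
qed

text \<open>The evaluation of \<open>\<phi>\<close> on the image of a morphism from $\mathrm{BS}(M_\bullet)$
  gives a functional on $\mathrm{BS}(M_\bullet)$ twisted by \<open>w\<close> on the right, which vanishes
  by the description of the support.\<close>

lemma graded_hom_evaluation_zero:
  assumes Ms: "\<forall>I\<in>set Ms. finitary X I" "Ms \<noteq> []" and Ns: "\<forall>I\<in>set Ns. I \<subseteq> S" "Ns \<noteq> []"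
    and ends: "hd Ms = hd Ns" "last Ms = last Ns"
    and w: "w \<in> carrier X" "w \<notin> path_set X Ms"
    and g: "g \<in> graded_hom (inv_ring X (hd Ns)) (inv_ring X (last Ns)) (BS X Ms) (BS X Ns)"
    and add: "\<And>u v. u \<in> carrier (bs_group X Ns) \<Longrightarrow> v \<in> carrier (bs_group X Ns) \<Longrightarrow>
      \<phi> (u \<otimes>\<^bsub>bs_group X Ns\<^esub> v) = \<phi> u + \<phi> v"
    and left: "\<And>r u. r \<in> invariants X (hd Ns) \<Longrightarrow> u \<in> carrier (bs_group X Ns) \<Longrightarrow>
      \<phi> (bs_mul X Ns 0 r u) = r * \<phi> u"
    and right: "\<And>r u. r \<in> invariants X (last Ns) \<Longrightarrow> u \<in> carrier (bs_group X Ns) \<Longrightarrow>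
      \<phi> (bs_mul X Ns (length Ns - 1) r u) = weyl_act X w r * \<phi> u"
    and u: "u \<in> carrier (bs_group X Ms)"
  shows "\<phi> (g u) = 0"
proof -
  have MsS: "\<forall>I\<in>set Ms. I \<subseteq> S" using Ms finitaryD by blast
  obtain A :: "int set" and h where A: "finite A" and h: "\<And>i. i \<in> A \<Longrightarrow> h i \<in> bimodule_hom (inv_ring X (hd Ns)) (inv_ring X (last Ns)) (BS X Ms) (BS X Ns)"
    and gh: "\<And>u. u \<in> carrier (bs_group X Ms) \<Longrightarrow> g u = (\<Oplus>\<^bsub>BS X Ns\<^esub>i\<in>A. h i u)"
    by (rule graded_homE[OF g, unfolded BS_simps(1)]) (rule that)
  \<comment> \<open>Homogeneous components are treated one at a time: they are bimodule maps by
    definition, while g is only given as their sum.\<close>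
  have "\<phi> (h i u) = 0" if i: "i \<in> A" for i
  proof -
    have hc: "h i u \<in> carrier (bs_group X Ns)" if "u \<in> carrier (bs_group X Ms)" for u
      using h[OF i] that by (auto simp: bimodule_hom_def)
    have hadd: "\<phi> (h i (u \<otimes>\<^bsub>bs_group X Ms\<^esub> v)) = \<phi> (h i u) + \<phi> (h i v)"
      if "u \<in> carrier (bs_group X Ms)" "v \<in> carrier (bs_group X Ms)" for u v
      using h[OF i] that add[OF hc hc] by (auto simp: bimodule_hom_def)
    define \<psi> where "\<psi> a = \<phi> (h i (bs_pure X Ms a))" for a
    have pc: "bs_pure X Ms a \<in> carrier (bs_group X Ms)" if "a \<in> bs_tuples X Ms" for a
      using bs_pure_carrier[OF MsS that] .
    have tf: "tensor_functional X Ms \<psi>"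
      unfolding tensor_functional_def \<psi>_def
    proof (intro ballI conjI allI impI)
      fix a j b c
      assume *: "a \<in> bs_tuples X Ms" "j < length Ms" "b \<in> bs_entry X Ms j" "c \<in> bs_entry X Ms j"
      show "\<phi> (h i (bs_pure X Ms (a[j := b + c]))) =
          \<phi> (h i (bs_pure X Ms (a[j := b]))) + \<phi> (h i (bs_pure X Ms (a[j := c])))"
        unfolding bs_pure_add[OF MsS *]
        by (rule hadd[OF pc[OF bs_tuples_update[OF *(1,3)]] pc[OF bs_tuples_update[OF *(1,4)]]])
    next
      fix a j r
      assume *: "a \<in> bs_tuples X Ms" "Suc j < length Ms" "r \<in> invariants X (Ms ! j)"
      show "\<phi> (h i (bs_pure X Ms (a[j := a ! j * r]))) = \<phi> (h i (bs_pure X Ms (a[Suc j := r * a ! Suc j])))"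
        unfolding bs_pure_balanced[OF MsS *] ..
    qed
    have n: "0 < length Ms" "length Ms - 1 < length Ms" using Ms(2) by auto
    have tw: "twisted_linear X Ms \<one> w \<psi>"
      unfolding twisted_linear_def
    proof (intro ballI conjI)
      fix a r assume a: "a \<in> bs_tuples X Ms" and r: "r \<in> invariants X (hd Ms)"
      have re: "r \<in> bs_entry X Ms 0" using r Ms(2) by (simp add: bs_entry_def hd_conv_nth)
      have "h i (bs_mul X Ms 0 r (bs_pure X Ms a)) = bs_mul X Ns 0 r (h i (bs_pure X Ms a))"
        using h[OF i] r pc[OF a] ends by (simp add: bimodule_hom_def inv_ring_def)
      then show "\<psi> (a[0 := r * a ! 0]) = weyl_act X \<one> r * \<psi> a"
        using left[of r "h i (bs_pure X Ms a)"] r ends hc[OF pc[OF a]] invariants_sym_ring[OF r]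
          bs_mul_pure[OF MsS Ms(2) n(1) re a]
        by (simp add: \<psi>_def mult.commute)
    next
      fix a r assume a: "a \<in> bs_tuples X Ms" and r: "r \<in> invariants X (last Ms)"
      have re: "r \<in> bs_entry X Ms (length Ms - 1)"
        using r Ms(2) by (intro invariants_bs_entry) (simp add: last_conv_nth)
      have "h i (bs_mul X Ms (length Ms - 1) r (bs_pure X Ms a)) =
          bs_mul X Ns (length Ns - 1) r (h i (bs_pure X Ms a))"
        using h[OF i] r pc[OF a] ends by (simp add: bimodule_hom_def inv_ring_def)
      then show "\<psi> (a[length Ms - 1 := a ! (length Ms - 1) * r]) = weyl_act X w r * \<psi> a"
        using right[of r "h i (bs_pure X Ms a)"] r ends hc[OF pc[OF a]]
          bs_mul_pure[OF MsS Ms(2) n(2) re a]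
        by (simp add: \<psi>_def)
    qed
    \<comment> \<open>The left twist is 1 and the right twist is w, so a nonzero value would put w
      into the product set of \<open>Ms\<close>.\<close>
    have \<psi>0: "\<psi> a = 0" if "a \<in> bs_tuples X Ms" for a
      using tensor_functional_support[OF Ms one_closed w(1) tf tw that] w by auto
    from u show ?thesis
    proof (induction u rule: bs_induct[OF MsS Ms(2), consumes 1, case_names zero pure add])
      case zero
      have one: "\<one>\<^bsub>bs_group X Ms\<^esub> \<in> carrier (bs_group X Ms)"
        using monoid.one_closed[OF comm_monoid.axioms(1)[OF comm_group.axioms(1)[OF bs_comm_group[OF MsS]]]] .
      then have "\<one>\<^bsub>bs_group X Ms\<^esub> \<otimes>\<^bsub>bs_group X Ms\<^esub> \<one>\<^bsub>bs_group X Ms\<^esub> = \<one>\<^bsub>bs_group X Ms\<^esub>"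
        using monoid.l_one[OF comm_monoid.axioms(1)[OF comm_group.axioms(1)[OF bs_comm_group[OF MsS]]]] by blast
      then show ?case using hadd[OF one one] by (metis add_cancel_right_right)
    next
      case (pure a)
      then show ?case using \<psi>0 by (simp add: \<psi>_def)
    next
      case (add u v)
      then show ?case using hadd by simp
    qed
  qed
  moreover have "(\<lambda>i. h i u) \<in> A \<rightarrow> carrier (bs_group X Ns)"
    using h u by (fastforce simp: bimodule_hom_def)
  then have "\<phi> (g u) = (\<Sum>i\<in>A. \<phi> (h i u))"
    unfolding gh[OF u]
    by (intro bs_finsum_hom[where \<phi> = \<phi> and h = "\<lambda>i. h i u", OF Ns _ A] add)
  ultimately show ?thesis by simp
qed

text \<open>Used to exhibit 0 in the image of f, since the intersection has to equal the zero
  submodule and not merely lie in it. As in the evaluation, the homogeneous components carry the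
  linearity.\<close>

lemma graded_hom_zero:
  assumes Ms: "\<forall>I\<in>set Ms. I \<subseteq> S" "Ms \<noteq> []" and Ns: "\<forall>I\<in>set Ns. I \<subseteq> S" "Ns \<noteq> []"
    and g: "g \<in> graded_hom A B (BS X Ms) (BS X Ns)"
  shows "g \<zero>\<^bsub>BS X Ms\<^esub> = \<zero>\<^bsub>BS X Ns\<^esub>"
proof -
  interpret M: abelian_group "BS X Ms" by (rule bs_abelian_group[OF Ms])
  interpret N: abelian_group "BS X Ns" by (rule bs_abelian_group[OF Ns])
  obtain F :: "int set" and h where "finite F" and h: "\<And>i. i \<in> F \<Longrightarrow> h i \<in> bimodule_hom A B (BS X Ms) (BS X Ns)"
    and gh: "\<And>u. u \<in> carrier (BS X Ms) \<Longrightarrow> g u = (\<Oplus>\<^bsub>BS X Ns\<^esub>i\<in>F. h i u)"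
    by (rule graded_homE[OF g]) (rule that)
  have "h i \<zero>\<^bsub>BS X Ms\<^esub> = \<zero>\<^bsub>BS X Ns\<^esub>" if "i \<in> F" for i
  proof -
    have c: "h i \<zero>\<^bsub>BS X Ms\<^esub> \<in> carrier (BS X Ns)" using h[OF that] M.zero_closed by (auto simp: bimodule_hom_def)
    have "h i (\<zero>\<^bsub>BS X Ms\<^esub> \<oplus>\<^bsub>BS X Ms\<^esub> \<zero>\<^bsub>BS X Ms\<^esub>) = h i \<zero>\<^bsub>BS X Ms\<^esub> \<oplus>\<^bsub>BS X Ns\<^esub> h i \<zero>\<^bsub>BS X Ms\<^esub>"
      using h[OF that] M.zero_closed unfolding bimodule_hom_def by blast
    then have "h i \<zero>\<^bsub>BS X Ms\<^esub> \<oplus>\<^bsub>BS X Ns\<^esub> h i \<zero>\<^bsub>BS X Ms\<^esub> = h i \<zero>\<^bsub>BS X Ms\<^esub>"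
      unfolding M.l_zero[OF M.zero_closed] by simp
    then show ?thesis using N.add.l_cancel_one[OF c c] by blast
  qed
  then have "(\<Oplus>\<^bsub>BS X Ns\<^esub>i\<in>F. h i \<zero>\<^bsub>BS X Ms\<^esub>) = \<zero>\<^bsub>BS X Ns\<^esub>"
    by (intro N.add.finprod_one_eqI) simp_all
  then show ?thesis using gh[OF M.zero_closed] by simp
qed

end

theorem proposition3p34:
  fixes X :: "('w, 'k::field, 'v::ab_group_add) realization"
    and I J p :: "'w set" and Is Is' Ds Ks :: "'w set list"
  assumes "is_realization X" and "balanced X" and "reflection_faithful X"
    and "demazure_surjective X"
    and "finitary X I" and "finitary X J"
    and "p \<in> double_cosets X I J"
    and "reduced_expression X I J Is p"
    and "reduced_expression X I J Is' p"
    and "removal_expression Ds I (left_redundancy X I J p)"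
    and "expression X Ks" and "hd Ks = left_redundancy X I J p"
    and "Is' = concat_expr Ds Ks"
  shows "(\<exists>c. prepend_ones X Ds Ks
              \<in> graded_iso (inv_ring X I) (inv_ring X J) (shift c (BS X Ks)) (BS X Is')) \<and>
         is_bimodule (inv_ring X (left_redundancy X I J p)) (inv_ring X J)
           ((BS X Is')\<lparr>smult := redundancy_action X Ds Ks\<rparr>) \<and>
         (\<forall>r\<in>invariants X I. \<forall>x\<in>carrier (BS X Is').
            redundancy_action X Ds Ks r x = r \<odot>\<^bsub>BS X Is'\<^esub> x) \<and>
         (\<forall>f\<in>hom_less X I J p (BS X Is) (BS X Is').
            f ` carrier (BS X Is) \<inter>
            {redundancy_action X Ds Ks r (one_tensor X Is') | r.
               r \<in> invariants X (left_redundancy X I J p)} = {\<zero>\<^bsub>BS X Is'\<^esub>})"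
proof -
  interpret faithful_realization X using assms by unfold_locales
  define L where "L = left_redundancy X I J p"
  have rem: "removal_expression Ds I L" and hdK: "hd Ks = L" using assms by (simp_all add: L_def)
  note IS = finitaryD(1)[OF assms(5)]
  have Ks: "Ks \<noteq> []" "\<forall>K\<in>set Ks. finitary X K" using assms(11) by (auto simp: expression_def)
  have KsS: "\<forall>K\<in>set Ks. K \<subseteq> S" using Ks finitaryD by blast
  have Ds: "Ds \<noteq> []" "hd Ds = I" "last Ds = L" using rem by (auto simp: removal_expression_def)
  then obtain k where k: "length Ds = Suc k" by (cases Ds) auto
  note ctx = IS rem KsS Ks(1) hdK k
  let ?N = "concat_expr Ds Ks"
  have Is': "expresses X I J ?N p" and Is: "expresses X I J Is p"
    using assms(8,9,13) by (auto simp: reduced_expression_def)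
  have N: "?N \<noteq> []" "\<forall>I\<in>set ?N. I \<subseteq> S" "hd ?N = I" "last ?N = J"
    using Is' finitaryD by (auto simp: expresses_def expression_def)
  have IsS: "Is \<noteq> []" "\<forall>I\<in>set Is. I \<subseteq> S"
    using Is finitaryD by (auto simp: expresses_def expression_def)
  have lastK: "last Ks = J"
    using N(4) Ks(1) Ds hdK by (cases Ks) (auto simp: concat_expr_def split: if_splits)
  have iso: "prepend_ones X Ds Ks \<in> graded_iso (inv_ring X I) (inv_ring X J)
      (shift (bs_shift X ?N - bs_shift X Ks) (BS X Ks)) (BS X ?N)"
    using prepend_ones_graded_iso[OF ctx] lastK by simp
  have bim: "is_bimodule (inv_ring X L) (inv_ring X J) ((BS X ?N)\<lparr>smult := redundancy_action X Ds Ks\<rparr>)"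
    using redundancy_bimodule[OF ctx] lastK by simp
  have restr: "redundancy_action X Ds Ks r x = r \<odot>\<^bsub>BS X ?N\<^esub> x"
    if "r \<in> invariants X I" "x \<in> carrier (BS X ?N)" for r x
    using redundancy_action_restricts[OF ctx that] .
  \<comment> \<open>A path for the full expression begins with factors from subgroups of W_I. They
    combine to one factor in W_I, and a path through \<open>Ks\<close> remains.\<close>
  have "p \<inter> path_set X (I # Ks) \<noteq> {}"
  proof -
    have "D \<subseteq> I" if "D \<in> set Ds" for D
      using that removal_le[OF ctx] by (metis in_set_conv_nth)
    then have "path_set X (Ds @ tl Ks) \<subseteq> path_set X (I # tl Ks)"
      using IS KsS list.set_sel(2)[OF Ks(1)] by (intro path_set_append_subset) auto
    \<comment> \<open>Concatenation has dropped the head of \<open>Ks\<close>; the factor belonging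
      to it may be taken to be 1.\<close>
    moreover have "path_set X (I # tl Ks) \<subseteq> path_set X (I # Ks)"
    proof
      fix y assume "y \<in> path_set X (I # tl Ks)"
      then obtain u z where uz: "y = u \<otimes>\<^bsub>X\<^esub> z" "u \<in> parabolic X I" "z \<in> path_set X (tl Ks)" by auto
      have "z \<in> carrier X" using path_set_carrier[OF _ uz(3)] KsS list.set_sel(2)[OF Ks(1)] by blast
      then have "z \<in> path_set X (hd Ks # tl Ks)" using path_setI[OF parabolic_one uz(3), of "hd Ks"] by simp
      then have "z \<in> path_set X Ks" using Ks(1) by simp
      then show "y \<in> path_set X (I # Ks)" using path_setI[OF uz(2)] uz(1) by simp
    qed
    ultimately show ?thesis using expresses_meets_path_set[OF Is'] unfolding concat_expr_def by blast
  qed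
  then obtain u w where uw: "u \<in> parabolic X I" "w \<in> path_set X Ks" "u \<otimes>\<^bsub>X\<^esub> w \<in> p" by auto
  have wc: "w \<in> carrier X" using path_set_carrier[OF KsS uw(2)] .
  have wp: "w \<in> p"
  proof -
    have "inv\<^bsub>X\<^esub> u \<otimes>\<^bsub>X\<^esub> (u \<otimes>\<^bsub>X\<^esub> w) \<in> p"
      using double_coset_closed_left[OF IS finitaryD(1)[OF assms(6)] assms(7) uw(3) parabolic_inv[OF IS uw(1)]] .
    then show ?thesis using wc parabolic_carrier[OF IS uw(1)] by simp
  qed
  obtain \<phi> where \<phi>_add: "\<And>u v. u \<in> carrier (bs_group X ?N) \<Longrightarrow> v \<in> carrier (bs_group X ?N) \<Longrightarrow>
        \<phi> (u \<otimes>\<^bsub>bs_group X ?N\<^esub> v) = \<phi> u + \<phi> v"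
    and \<phi>_left: "\<And>r u. r \<in> invariants X I \<Longrightarrow> u \<in> carrier (bs_group X ?N) \<Longrightarrow> \<phi> (bs_mul X ?N 0 r u) = r * \<phi> u"
    and \<phi>_right: "\<And>r u. r \<in> invariants X J \<Longrightarrow> u \<in> carrier (bs_group X ?N) \<Longrightarrow>
        \<phi> (bs_mul X ?N (length ?N - 1) r u) = weyl_act X w r * \<phi> u"
    and \<phi>_one: "\<And>r. r \<in> invariants X L \<Longrightarrow> \<phi> (redundancy_action X Ds Ks r (one_tensor X ?N)) = r"
    using evaluation_exists[OF ctx uw(2)] unfolding lastK by blast
  have o: "one_tensor X ?N \<in> carrier (bs_group X ?N)"
    unfolding one_tensor_def using bs_entry_one[OF N(2)] by (intro bs_pure_carrier[OF N(2)]) (simp add: bs_tuples_def)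
  have LM: "Module.module (inv_ring X L) ((BS X ?N)\<lparr>smult := redundancy_action X Ds Ks\<rparr>)"
    using bim by (simp add: is_bimodule_def)
  have zero: "redundancy_action X Ds Ks 0 (one_tensor X ?N) = \<zero>\<^bsub>BS X ?N\<^esub>"
    using module.smult_l_null[OF LM, of "one_tensor X ?N"] o by (simp add: inv_ring_def)
  have image: "f ` carrier (BS X Is) \<inter> {redundancy_action X Ds Ks r (one_tensor X ?N) | r. r \<in> invariants X L}
      = {\<zero>\<^bsub>BS X ?N\<^esub>}" if f: "f \<in> hom_less X I J p (BS X Is) (BS X ?N)" for f
  proof -
    obtain n :: nat and Ms g h where
        Ms: "\<And>l. l < n \<Longrightarrow> \<exists>q\<in>double_cosets X I J. coset_less X q p \<and> expresses X I J (Ms l) q"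
      and h: "\<And>l. l < n \<Longrightarrow> h l \<in> graded_hom (inv_ring X I) (inv_ring X J) (BS X Is) (BS X (Ms l))"
      and g: "\<And>l. l < n \<Longrightarrow> g l \<in> graded_hom (inv_ring X I) (inv_ring X J) (BS X (Ms l)) (BS X ?N)"
      and fgh: "\<And>x. x \<in> carrier (BS X Is) \<Longrightarrow> f x = (\<Oplus>\<^bsub>BS X ?N\<^esub>l\<in>{..<n}. g l (h l x))"
      using f unfolding hom_less_def hom_ideal_def by blast
    have Msl: "Ms l \<noteq> []" "\<forall>I\<in>set (Ms l). finitary X I" "hd (Ms l) = hd ?N" "last (Ms l) = last ?N"
        "w \<notin> path_set X (Ms l)" if l: "l < n" for l
    proof -
      obtain q where q: "q \<in> double_cosets X I J" "coset_less X q p" "expresses X I J (Ms l) q"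
        using Ms[OF l] by blast
      then show "Ms l \<noteq> []" "\<forall>I\<in>set (Ms l). finitary X I" "hd (Ms l) = hd ?N" "last (Ms l) = last ?N"
        using N by (auto simp: expresses_def expression_def)
      show "w \<notin> path_set X (Ms l)"
        by (rule path_set_lower[OF assms(5,6,7) q wp])
    qed
    have hc: "h l x \<in> carrier (bs_group X (Ms l))" if "l < n" "x \<in> carrier (BS X Is)" for l x
      using h[OF that(1)] that(2) by (auto simp: graded_hom_def)
    have gc: "g l y \<in> carrier (bs_group X ?N)" if "l < n" "y \<in> carrier (bs_group X (Ms l))" for l y
      using g[OF that(1)] that(2) by (auto simp: graded_hom_def)
    \<comment> \<open>Every summand of f passes through some \<open>Ms l\<close> whose product set
      misses w, so \<phi> vanishes on its values.\<close>
    have \<phi>f: "\<phi> (f x) = 0" if x: "x \<in> carrier (BS X Is)" for x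
    proof -
      have "\<phi> (f x) = (\<Sum>l<n. \<phi> (g l (h l x)))"
        unfolding fgh[OF x] using hc[OF _ x] gc
        by (intro bs_finsum_hom[where \<phi> = \<phi> and h = "\<lambda>l. g l (h l x)", OF N(2,1)] \<phi>_add) auto
      also have "\<dots> = 0"
      proof (intro sum.neutral ballI)
        fix l assume "l \<in> {..<n}"
        then have l: "l < n" by simp
        show "\<phi> (g l (h l x)) = 0"
          using g[OF l] hc[OF l x] \<phi>_add \<phi>_left \<phi>_right N
          by (intro graded_hom_evaluation_zero[OF Msl(2,1)[OF l] N(2,1) Msl(3,4)[OF l] wc Msl(5)[OF l]]) auto
      qed
      finally show ?thesis .
    qed
    have f0: "f \<zero>\<^bsub>BS X Is\<^esub> = \<zero>\<^bsub>BS X ?N\<^esub>"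
    proof -
      interpret B: abelian_group "BS X Is" by (rule bs_abelian_group[OF IsS(2,1)])
      interpret BN: abelian_group "BS X ?N" by (rule bs_abelian_group[OF N(2,1)])
      have "g l (h l \<zero>\<^bsub>BS X Is\<^esub>) = \<zero>\<^bsub>BS X ?N\<^esub>" if l: "l < n" for l
      proof -
        have MS: "\<forall>I\<in>set (Ms l). I \<subseteq> S" using Msl(2)[OF l] finitaryD by blast
        show ?thesis
          unfolding graded_hom_zero[OF IsS(2,1) MS Msl(1)[OF l] h[OF l]]
          by (rule graded_hom_zero[OF MS Msl(1)[OF l] N(2,1) g[OF l]])
      qed
      then show ?thesis unfolding fgh[OF B.zero_closed] by (intro BN.add.finprod_one_eqI) simp_all
    qed
    have z: "\<zero>\<^bsub>BS X Is\<^esub> \<in> carrier (BS X Is)"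
      using abelian_monoid.zero_closed[OF abelian_group.axioms(1)[OF bs_abelian_group[OF IsS(2,1)]]] .
    have i0: "0 \<in> invariants X L" using invariants_zero[OF LS[OF ctx]] .
    have key: "redundancy_action X Ds Ks r (one_tensor X ?N) = \<zero>\<^bsub>BS X ?N\<^esub>"
      if r: "r \<in> invariants X L" and x: "x \<in> carrier (BS X Is)"
        and eq: "f x = redundancy_action X Ds Ks r (one_tensor X ?N)" for r x
    proof -
      \<comment> \<open>\<phi> returns the coefficient r on the right-hand side of \<open>eq\<close>
        but vanishes on the image of f.\<close>
      have "r = 0" using \<phi>_one[OF r] \<phi>f[OF x] eq by simp
      then show ?thesis using zero by simp
    qed
    show ?thesis
    proof (intro equalityI subsetI)
      fix y assume "y \<in> f ` carrier (BS X Is) \<inter>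
        {redundancy_action X Ds Ks r (one_tensor X ?N) | r. r \<in> invariants X L}"
      then obtain x r where "x \<in> carrier (BS X Is)" "r \<in> invariants X L"
          "y = f x" "y = redundancy_action X Ds Ks r (one_tensor X ?N)" by blast
      then show "y \<in> {\<zero>\<^bsub>BS X ?N\<^esub>}" using key[of r x] by simp
    next
      fix y assume "y \<in> {\<zero>\<^bsub>BS X ?N\<^esub>}"
      then have y: "y = f \<zero>\<^bsub>BS X Is\<^esub>" "y = redundancy_action X Ds Ks 0 (one_tensor X ?N)"
        unfolding f0 zero by simp_all
      show "y \<in> f ` carrier (BS X Is) \<inter>
          {redundancy_action X Ds Ks r (one_tensor X ?N) | r. r \<in> invariants X L}"
        using imageI[OF z, of f, folded y(1)] y(2) i0 by blast
    qed
  qed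
  show ?thesis
    unfolding assms(13) L_def[symmetric] using iso bim restr image by blast
qed

end
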